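(* Let $K$ be a field, $S=K[x_1,\dots,x_m,y_1,\dots,y_n]$ the standard bigraded polynomial ring and $Q=(y_1,\dots,y_n)$. Let $f\in S$ be a bihomogeneous element of degree $(a,b)$ and let $R=S/fS$ be the hypersurface ring. Then the following statements are equivalent: (a) $R$ is sequentially Cohen--Macaulay with respect to $Q$; (b) $f=h_1h_2$ where $h_1,h_2\in S$ are bihomogeneous with $\deg h_1=(a,0)$, $a\ge 0$, and $\deg h_2=(0,b)$, $b\ge 0$.
   Context: $S$ is bigraded by $\deg x_i=(1,0)$ and $\deg y_j=(0,1)$ for all $i,j$. An element said to be bihomogeneous of a given degree is understood to be non-zero. For a finitely generated bigraded $S$-module $M$, $\operatorname{cd}(Q,M)$ is the largest integer $i$ with $H^i_Q(M)\neq 0$. $M$ is Cohen--Macaulay with respect to $Q$ if exactly one local cohomology module $H^i_Q(M)$ is non-zero (equivalently, $\operatorname{grade}(Q,M)=\operatorname{cd}(Q,M)$). A Cohen--Macaulay filtration of $M$ with respect to $Q$ is a finite filtration $0=M_0\subsetneq M_1\subsetneq\dots\subsetneq M_r=M$ by bigraded submodules such that each quotient $M_i/M_{i-1}$ is Cohen--Macaulay with respect to $Q$ and $0\le \operatorname{cd}(Q,M_1/M_0)<\operatorname{cd}(Q,M_2/M_1)<\dots<\operatorname{cd}(Q,M_r/M_{r-1})$. $M$ is sequentially Cohen--Macaulay with respect to $Q$ if it admits such a filtration. The zero module counts as sequentially Cohen--Macaulay with respect to $Q$ (filtration of length $r=0$). *)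

theory Defs
  imports "HOL-Algebra.QuotRing" "HOL-Algebra.Module" "HOL-Library.Poly_Mapping"
begin

section \<open>Modules over a commutative ring\<close>

text \<open>
  Only the additive group and the scalar multiplication of a \<open>module\<close> record are relevant
  (see the locale \<^locale>\<open>module\<close>); the ring multiplication and unit that the record type inherits
  are left \<^const>\<open>undefined\<close> where they make no sense.  A submodule \<open>N\<close> of \<open>M\<close> is
  turned into a module by \<open>M\<lparr>carrier := N\<rparr>\<close>.
\<close>

definition quotient_module :: "('a, 'b, 's) module_scheme \<Rightarrow> 'b set \<Rightarrow> ('a, 'b set) module" where
  "quotient_module M N =
    \<lparr>carrier = a_rcosets\<^bsub>M\<^esub> N, mult = undefined, one = undefined,
     zero = N, add = (\<lambda>A B. A <+>\<^bsub>M\<^esub> B),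
     smult = (\<lambda>r A. \<Union>u\<in>A. N +>\<^bsub>M\<^esub> (r \<odot>\<^bsub>M\<^esub> u))\<rparr>"

text \<open>The residue class ring \<open>R Quot I\<close>, regarded as an \<open>R\<close>-module.\<close>

definition Quot_module :: "('a, 'r) ring_scheme \<Rightarrow> 'a set \<Rightarrow> ('a, 'a set) module" where
  "Quot_module R I =
     ring.extend (R Quot I) (module.fields (\<lambda>r A. (I +>\<^bsub>R\<^esub> r) \<otimes>\<^bsub>R Quot I\<^esub> A))"

text \<open>
  The localization of \<open>M\<close> at the powers of \<open>s\<close>.  The fraction \<open>u / s\<^sup>k\<close> is the class of
  the pair \<open>(u, k)\<close>.
\<close>

definition frac ::
    "('a, 'r) ring_scheme \<Rightarrow> ('a, 'b, 's) module_scheme \<Rightarrow> 'a \<Rightarrow> 'b \<Rightarrow> nat \<Rightarrow> ('b \<times> nat) set" where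
  "frac R M s u k =
    {(v, l). v \<in> carrier M \<and>
       (\<exists>t::nat. (s [^]\<^bsub>R\<^esub> (t + l)) \<odot>\<^bsub>M\<^esub> u = (s [^]\<^bsub>R\<^esub> (t + k)) \<odot>\<^bsub>M\<^esub> v)}"

definition localization ::
    "('a, 'r) ring_scheme \<Rightarrow> ('a, 'b, 's) module_scheme \<Rightarrow> 'a \<Rightarrow> ('a, ('b \<times> nat) set) module" where
  "localization R M s =
    \<lparr>carrier = {frac R M s u k | u k. u \<in> carrier M}, mult = undefined, one = undefined,
     zero = frac R M s \<zero>\<^bsub>M\<^esub> 0,
     add = (\<lambda>A B. \<Union>(u, k)\<in>A. \<Union>(v, l)\<in>B.
        frac R M s ((s [^]\<^bsub>R\<^esub> l) \<odot>\<^bsub>M\<^esub> u \<oplus>\<^bsub>M\<^esub> (s [^]\<^bsub>R\<^esub> k) \<odot>\<^bsub>M\<^esub> v) (k + l)),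
     smult = (\<lambda>r A. \<Union>(u, k)\<in>A. frac R M s (r \<odot>\<^bsub>M\<^esub> u) k)\<rparr>"

text \<open>The canonical map from the localization at \<open>s\<close> to the localization at \<open>s w\<close>,
  given by \<open>u / s\<^sup>k \<mapsto> w\<^sup>k u / (s w)\<^sup>k\<close>.\<close>

definition localization_map ::
    "('a, 'r) ring_scheme \<Rightarrow> ('a, 'b, 's) module_scheme \<Rightarrow> 'a \<Rightarrow> 'a \<Rightarrow> ('b \<times> nat) set \<Rightarrow> ('b \<times> nat) set" where
  "localization_map R M s w A =
    (\<Union>(u, k)\<in>A. frac R M (s \<otimes>\<^bsub>R\<^esub> w) ((w [^]\<^bsub>R\<^esub> k) \<odot>\<^bsub>M\<^esub> u) k)"


section \<open>Local cohomology\<close>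

text \<open>
  The local cohomology of \<open>M\<close> with respect to the ideal generated by \<open>y 1, \<dots>, y n\<close> is
  the cohomology of the \v{C}ech complex
  \<open>0 \<rightarrow> M \<rightarrow> \<Oplus>\<^sub>i M\<^sub>y\<^sub>i \<rightarrow> \<Oplus>\<^sub>i\<^sub><\<^sub>j M\<^sub>y\<^sub>i\<^sub>y\<^sub>j \<rightarrow> \<dots> \<rightarrow> M\<^sub>y\<^sub>1\<^sub>\<dots>\<^sub>y\<^sub>n \<rightarrow> 0\<close>.
  A cochain of degree \<open>p\<close> assigns to every \<open>p\<close>-element subset \<open>\<sigma>\<close> of \<open>{1..n}\<close> an element of the
  localization of \<open>M\<close> at the product of the \<open>y j\<close> with \<open>j \<in> \<sigma>\<close>.
\<close>

definition cech_index :: "nat \<Rightarrow> nat \<Rightarrow> nat set set" where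
  "cech_index n p = {\<sigma>. \<sigma> \<subseteq> {1..n} \<and> card \<sigma> = p}"

definition cech_loc ::
    "('a, 'r) ring_scheme \<Rightarrow> (nat \<Rightarrow> 'a) \<Rightarrow> ('a, 'b, 's) module_scheme \<Rightarrow> nat set \<Rightarrow> ('a, ('b \<times> nat) set) module" where
  "cech_loc R y M \<sigma> = localization R M (\<Otimes>\<^bsub>R\<^esub>j\<in>\<sigma>. y j)"

definition cech_cochains ::
    "('a, 'r) ring_scheme \<Rightarrow> nat \<Rightarrow> (nat \<Rightarrow> 'a) \<Rightarrow> ('a, 'b, 's) module_scheme \<Rightarrow> nat
      \<Rightarrow> ('a, nat set \<Rightarrow> ('b \<times> nat) set) module" where
  "cech_cochains R n y M p =
    \<lparr>carrier = (\<Pi>\<^sub>E \<sigma>\<in>cech_index n p. carrier (cech_loc R y M \<sigma>)),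
     mult = undefined, one = undefined,
     zero = (\<lambda>\<sigma>\<in>cech_index n p. \<zero>\<^bsub>cech_loc R y M \<sigma>\<^esub>),
     add = (\<lambda>c d. \<lambda>\<sigma>\<in>cech_index n p. c \<sigma> \<oplus>\<^bsub>cech_loc R y M \<sigma>\<^esub> d \<sigma>),
     smult = (\<lambda>r c. \<lambda>\<sigma>\<in>cech_index n p. r \<odot>\<^bsub>cech_loc R y M \<sigma>\<^esub> c \<sigma>)\<rparr>"

definition cech_diff ::
    "('a, 'r) ring_scheme \<Rightarrow> nat \<Rightarrow> (nat \<Rightarrow> 'a) \<Rightarrow> ('a, 'b, 's) module_scheme \<Rightarrow> nat
      \<Rightarrow> (nat set \<Rightarrow> ('b \<times> nat) set) \<Rightarrow> nat set \<Rightarrow> ('b \<times> nat) set" where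
  "cech_diff R n y M p c =
    (\<lambda>\<tau>\<in>cech_index n (Suc p). \<Oplus>\<^bsub>cech_loc R y M \<tau>\<^esub>j\<in>\<tau>.
       ((\<ominus>\<^bsub>R\<^esub> \<one>\<^bsub>R\<^esub>) [^]\<^bsub>R\<^esub> card {i\<in>\<tau>. i < j}) \<odot>\<^bsub>cech_loc R y M \<tau>\<^esub>
         localization_map R M (\<Otimes>\<^bsub>R\<^esub>i\<in>\<tau> - {j}. y i) (y j) (c (\<tau> - {j})))"

definition cech_cocycles ::
    "('a, 'r) ring_scheme \<Rightarrow> nat \<Rightarrow> (nat \<Rightarrow> 'a) \<Rightarrow> ('a, 'b, 's) module_scheme \<Rightarrow> nat
      \<Rightarrow> (nat set \<Rightarrow> ('b \<times> nat) set) set" where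
  "cech_cocycles R n y M p =
    {c \<in> carrier (cech_cochains R n y M p).
       cech_diff R n y M p c = \<zero>\<^bsub>cech_cochains R n y M (Suc p)\<^esub>}"

fun cech_coboundaries ::
    "('a, 'r) ring_scheme \<Rightarrow> nat \<Rightarrow> (nat \<Rightarrow> 'a) \<Rightarrow> ('a, 'b, 's) module_scheme \<Rightarrow> nat
      \<Rightarrow> (nat set \<Rightarrow> ('b \<times> nat) set) set" where
  "cech_coboundaries R n y M 0 = {\<zero>\<^bsub>cech_cochains R n y M 0\<^esub>}"
| "cech_coboundaries R n y M (Suc p) =
     cech_diff R n y M p ` carrier (cech_cochains R n y M p)"

definition local_cohomology ::
    "('a, 'r) ring_scheme \<Rightarrow> nat \<Rightarrow> (nat \<Rightarrow> 'a) \<Rightarrow> ('a, 'b, 's) module_scheme \<Rightarrow> nat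
      \<Rightarrow> ('a, (nat set \<Rightarrow> ('b \<times> nat) set) set) module" where
  "local_cohomology R n y M p =
     quotient_module ((cech_cochains R n y M p)\<lparr>carrier := cech_cocycles R n y M p\<rparr>)
       (cech_coboundaries R n y M p)"


section \<open>The standard bigraded polynomial ring\<close>

datatype var = X nat | Y nat

type_synonym 'k bipoly = "(var \<Rightarrow>\<^sub>0 nat) \<Rightarrow>\<^sub>0 'k"

definition indet :: "var \<Rightarrow> 'k::field bipoly" where
  "indet v = Poly_Mapping.single (Poly_Mapping.single v 1) 1"

text \<open>The polynomial ring over the field \<open>'k\<close> in the variables \<open>X 1, \<dots>, X m, Y 1, \<dots>, Y n\<close>.\<close>

definition bipoly_ring :: "nat \<Rightarrow> nat \<Rightarrow> 'k::field bipoly ring" where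
  "bipoly_ring m n =
    \<lparr>carrier = {g. \<forall>t\<in>Poly_Mapping.keys g. Poly_Mapping.keys t \<subseteq> X ` {1..m} \<union> Y ` {1..n}},
     mult = (*), one = 1, zero = 0, add = (+)\<rparr>"

definition xdeg :: "(var \<Rightarrow>\<^sub>0 nat) \<Rightarrow> nat" where
  "xdeg t = (\<Sum>v\<in>Poly_Mapping.keys t. case v of X i \<Rightarrow> Poly_Mapping.lookup t v | Y j \<Rightarrow> 0)"

definition ydeg :: "(var \<Rightarrow>\<^sub>0 nat) \<Rightarrow> nat" where
  "ydeg t = (\<Sum>v\<in>Poly_Mapping.keys t. case v of X i \<Rightarrow> 0 | Y j \<Rightarrow> Poly_Mapping.lookup t v)"

text \<open>The component of bidegree \<open>d\<close>, which contains \<open>0\<close>.\<close>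

definition bipoly_comp :: "nat \<Rightarrow> nat \<Rightarrow> int \<times> int \<Rightarrow> 'k::field bipoly set" where
  "bipoly_comp m n d =
    {g \<in> carrier (bipoly_ring m n).
       \<forall>t\<in>Poly_Mapping.keys g. (int (xdeg t), int (ydeg t)) = d}"

definition bihomogeneous :: "nat \<Rightarrow> nat \<Rightarrow> nat \<times> nat \<Rightarrow> 'k::field bipoly \<Rightarrow> bool" where
  "bihomogeneous m n d g \<longleftrightarrow>
     g \<noteq> 0 \<and> g \<in> bipoly_comp m n (int (fst d), int (snd d))"

text \<open>The hypersurface ring \<open>S/fS\<close> as an \<open>S\<close>-module, and its bigrading induced from \<open>S\<close>.\<close>

definition hypersurface :: "nat \<Rightarrow> nat \<Rightarrow> 'k::field bipoly \<Rightarrow> ('k bipoly, 'k bipoly set) module" where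
  "hypersurface m n f =
     Quot_module (bipoly_ring m n) (PIdl\<^bsub>bipoly_ring m n\<^esub> f)"

definition hypersurface_comp ::
    "nat \<Rightarrow> nat \<Rightarrow> 'k::field bipoly \<Rightarrow> int \<times> int \<Rightarrow> 'k bipoly set set" where
  "hypersurface_comp m n f d =
     (\<lambda>g. (PIdl\<^bsub>bipoly_ring m n\<^esub> f) +>\<^bsub>bipoly_ring m n\<^esub> g) ` bipoly_comp m n d"


section \<open>The sequentially Cohen--Macaulay property with respect to Q\<close>

text \<open>
  In what follows \<open>M\<close> is a module over \<open>S = bipoly_ring m n\<close>, and \<open>Q\<close> is the ideal of \<open>S\<close>
  generated by \<open>Y 1, \<dots>, Y n\<close>.  The bigrading of \<open>M\<close> is given by the family \<open>G\<close> of its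
  homogeneous components.
\<close>

definition H_Q :: "nat \<Rightarrow> nat \<Rightarrow> nat \<Rightarrow> ('k::field bipoly, 'b) module
    \<Rightarrow> ('k bipoly, (nat set \<Rightarrow> ('b \<times> nat) set) set) module" where
  "H_Q m n i M = local_cohomology (bipoly_ring m n) n (\<lambda>j. indet (Y j)) M i"

definition H_Q_nonzero :: "nat \<Rightarrow> nat \<Rightarrow> nat \<Rightarrow> ('k::field bipoly, 'b) module \<Rightarrow> bool" where
  "H_Q_nonzero m n i M \<longleftrightarrow> carrier (H_Q m n i M) \<noteq> {\<zero>\<^bsub>H_Q m n i M\<^esub>}"

definition cd_Q :: "nat \<Rightarrow> nat \<Rightarrow> ('k::field bipoly, 'b) module \<Rightarrow> nat" where
  "cd_Q m n M = (GREATEST i. H_Q_nonzero m n i M)"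

definition CM_Q :: "nat \<Rightarrow> nat \<Rightarrow> ('k::field bipoly, 'b) module \<Rightarrow> bool" where
  "CM_Q m n M \<longleftrightarrow> (\<exists>!i. H_Q_nonzero m n i M)"

text \<open>A submodule \<open>N\<close> is bigraded if it is the sum of the intersections \<open>N \<inter> G d\<close>.\<close>

definition bigraded_submodule ::
    "nat \<Rightarrow> nat \<Rightarrow> ('k::field bipoly, 'b) module \<Rightarrow> (int \<times> int \<Rightarrow> 'b set) \<Rightarrow> 'b set \<Rightarrow> bool" where
  "bigraded_submodule m n M G N \<longleftrightarrow>
     submodule N (bipoly_ring m n) M \<and>
     (\<forall>u\<in>N. \<exists>D c. finite D \<and> (\<forall>d\<in>D. c d \<in> N \<inter> G d) \<and> u = (\<Oplus>\<^bsub>M\<^esub>d\<in>D. c d))"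

text \<open>The modules of the filtration are \<open>F 0, \<dots>, F r\<close>.  The condition that the cohomological
  dimensions are at least \<open>0\<close> is automatic, as they are natural numbers.\<close>

definition CM_filtration_Q ::
    "nat \<Rightarrow> nat \<Rightarrow> ('k::field bipoly, 'b) module \<Rightarrow> (int \<times> int \<Rightarrow> 'b set) \<Rightarrow> nat
      \<Rightarrow> (nat \<Rightarrow> 'b set) \<Rightarrow> bool" where
  "CM_filtration_Q m n M G r F \<longleftrightarrow>
     F 0 = {\<zero>\<^bsub>M\<^esub>} \<and> F r = carrier M \<and>
     (\<forall>i\<le>r. bigraded_submodule m n M G (F i)) \<and>
     (\<forall>i<r. F i \<subset> F (Suc i)) \<and>
     (\<forall>i<r. CM_Q m n (quotient_module (M\<lparr>carrier := F (Suc i)\<rparr>) (F i))) \<and>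
     (\<forall>i. Suc i < r \<longrightarrow>
        cd_Q m n (quotient_module (M\<lparr>carrier := F (Suc i)\<rparr>) (F i))
        < cd_Q m n (quotient_module (M\<lparr>carrier := F (Suc (Suc i))\<rparr>) (F (Suc i))))"

definition sequentially_CM_Q ::
    "nat \<Rightarrow> nat \<Rightarrow> ('k::field bipoly, 'b) module \<Rightarrow> (int \<times> int \<Rightarrow> 'b set) \<Rightarrow> bool" where
  "sequentially_CM_Q m n M G \<longleftrightarrow> (\<exists>r F. CM_filtration_Q m n M G r F)"

end

theory Submission
  imports Defs
begin

text \<open>
  Write \<open>S = K[X, Y]\<close>.  A \v{C}ech cochain whose components have the common denominator exponent \<open>t\<close> is a
  Koszul cochain on the powers \<open>Y j ^ t\<close>, so local cohomology is a colimit of Koszul cohomology.  For ideals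
  \<open>I \<subseteq> J\<close> of \<open>S\<close>, the vanishing of the \<open>p\<close>-th local cohomology of \<open>J/I\<close> thereby becomes an elementary
  statement \<open>cech_exact J I p\<close> about polynomials (\<open>local_cohomology_zero_iff\<close>), and a Cohen--Macaulay
  filtration of \<open>S/fS\<close> becomes a chain of bigraded ideals from \<open>fS\<close> to \<open>S\<close>
  (\<open>sequentially_CM_iff_chain\<close>).

  If \<open>f = h1 * h2\<close>, the chain is \<open>fS \<subseteq> h1 S \<subseteq> S\<close>, up to repetitions.  On \<open>S / h1 S\<close> with \<open>h1 \<in> K[X]\<close> the
  \<open>Y j\<close> form a regular sequence, so its local cohomology is concentrated in degree \<open>n\<close>
  (\<open>cech_exact_no_Y_iff\<close>).  And \<open>h1 S / fS\<close> is isomorphic to \<open>S / h2 S\<close> with \<open>h2 \<in> K[Y]\<close> homogeneous.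
  Multiplication by \<open>h2\<close> is triangular, hence surjective, on the top local cohomology
  \<open>K[X] \<otimes> K[Y\<^sup>-\<^sup>1]\<close> of \<open>S\<close>, so only degree \<open>n - 1\<close> remains (\<open>cech_exact_no_X_iff\<close>).

  Conversely, let \<open>a\<close> and \<open>b\<close> be positive; otherwise \<open>f * 1\<close> or \<open>1 * f\<close> is the factorization.  Let \<open>I\<close> be the
  last ideal of the chain before \<open>S\<close>.  Since \<open>S/fS\<close> has cohomological dimension \<open>n\<close> and the dimensions
  increase along the chain, \<open>H\<^sup>n(I/fS) = 0\<close> and \<open>S/I\<close> has local cohomology in degree \<open>n\<close> only.  By depth
  sensitivity (\<open>koszul_exact_if_cech_exact\<close>) the Koszul cohomology of \<open>S/I\<close> vanishes below \<open>n\<close> as well.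
  This means \<open>I \<inter> Q = Q I\<close>, so \<open>I\<close> is extended from \<open>K[X]\<close> and contains the coefficients \<open>f\<^sub>\<beta>\<close> of
  \<open>f = (\<Sum>\<beta>. f\<^sub>\<beta> Y\<^sup>\<beta>)\<close> (\<open>div_Y_mem_graded_ideal\<close>).  Now \<open>H\<^sup>n(I/fS) = 0\<close> makes every class \<open>f\<^sub>\<beta> / Y\<^sup>1\<^sup>+\<^sup>\<alpha>\<close> a
  multiple of \<open>f\<close>.  Comparing the coefficients of two monomials in the \<open>X i\<close> shows that all \<open>2 \<times> 2\<close> minors
  of the matrix of coefficients of \<open>f\<close> vanish (\<open>coefficient_minors\<close>), and a matrix of rank one is the
  product of a column and a row (\<open>factor_of_minors\<close>).
\<close>

section \<open>Koszul complexes of subquotients\<close>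

text \<open>
  These are the signs of the \v{C}ech differential, so that a common denominator turns the one
  differential into the other.
\<close>

definition koszul_sign :: "nat \<Rightarrow> nat set \<Rightarrow> 'a::comm_ring_1" where
  "koszul_sign j \<tau> = (- 1) ^ card {i \<in> \<tau>. i < j}"

definition koszul_diff ::
    "(nat \<Rightarrow> 'a::comm_ring_1) \<Rightarrow> (nat \<Rightarrow> nat) \<Rightarrow> (nat set \<Rightarrow> 'a) \<Rightarrow> nat set \<Rightarrow> 'a" where
  "koszul_diff y s z \<tau> = (\<Sum>j\<in>\<tau>. koszul_sign j \<tau> * y j ^ s j * z (\<tau> - {j}))"

lemma koszul_sign_square [simp]: "koszul_sign j \<tau> * koszul_sign j \<tau> = 1"
  by (simp add: koszul_sign_def power_mult_distrib [symmetric])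

lemma koszul_sign_square_left [simp]: "koszul_sign j \<tau> * (koszul_sign j \<tau> * u) = u"
  by (simp add: mult.assoc [symmetric])

lemma koszul_sign_anticommute:
  assumes "finite \<tau>" "i \<in> \<tau>" "j \<in> \<tau>" "i \<noteq> j"
  shows "koszul_sign i \<tau> * koszul_sign j (\<tau> - {i}) =
    - (koszul_sign j \<tau> * koszul_sign i (\<tau> - {j}) :: 'a::comm_ring_1)"
proof -
  have *: "koszul_sign i \<tau> * koszul_sign j (\<tau> - {i}) =
      - (koszul_sign j \<tau> * koszul_sign i (\<tau> - {j}) :: 'a)"
    if "i \<in> \<tau>" "i < j" for i j
  proof -
    have "{l \<in> \<tau> - {j}. l < i} = {l \<in> \<tau>. l < i}" using that by auto
    moreover have "{l \<in> \<tau>. l < j} = insert i {l \<in> \<tau> - {i}. l < j}" using that by auto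
    then have "card {l \<in> \<tau>. l < j} = Suc (card {l \<in> \<tau> - {i}. l < j})"
      using assms(1) by (metis (no_types, lifting) card_insert_disjoint finite_Diff finite_Collect_conjI
        finite_subset insertI1 mem_Collect_eq Diff_iff finite.emptyI subsetI)
    ultimately show ?thesis by (simp add: koszul_sign_def)
  qed
  show ?thesis
  proof (cases "i < j")
    case True then show ?thesis using *[of i j] assms by blast
  next
    case False
    then show ?thesis using *[of j i] assms by simp
  qed
qed

text \<open>
  Anticommutation solved for the signs of the two smaller index sets, as it is needed when the
  differential on \<open>\<tau> - {j}\<close> is compared with the one on \<open>\<tau>\<close>.
\<close>

lemma koszul_sign_split:
  assumes "finite \<tau>" "i \<in> \<tau>" "j \<in> \<tau>" "i \<noteq> j"
  shows "koszul_sign i (\<tau> - {j}) * koszul_sign j (\<tau> - {i}) =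
    - (koszul_sign i \<tau> * koszul_sign j \<tau> :: 'a::comm_ring_1)"
proof -
  have "koszul_sign i (\<tau> - {j}) * koszul_sign j (\<tau> - {i}) =
      koszul_sign i (\<tau> - {j}) * (koszul_sign i \<tau> * (koszul_sign i \<tau> * koszul_sign j (\<tau> - {i}))) "
    by simp
  also have "\<dots> = - (koszul_sign i \<tau> * koszul_sign j \<tau> *
      (koszul_sign i (\<tau> - {j}) * koszul_sign i (\<tau> - {j}) :: 'a))"
    by (subst koszul_sign_anticommute [OF assms]) (simp add: algebra_simps del: koszul_sign_square koszul_sign_square_left)
  finally show ?thesis by simp
qed

lemma koszul_diff_cong:
  assumes "\<And>j. j \<in> \<tau> \<Longrightarrow> s j = s' j" "\<And>j. j \<in> \<tau> \<Longrightarrow> z (\<tau> - {j}) = z' (\<tau> - {j})"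
  shows "koszul_diff y s z \<tau> = koszul_diff y s' z' \<tau>"
  using assms by (simp add: koszul_diff_def)

lemma koszul_diff_empty [simp]: "koszul_diff y s z {} = 0"
  by (simp add: koszul_diff_def)

lemma koszul_diff_add: "koszul_diff y s (\<lambda>\<sigma>. z \<sigma> + w \<sigma>) \<tau> = koszul_diff y s z \<tau> + koszul_diff y s w \<tau>"
  by (simp add: koszul_diff_def algebra_simps sum.distrib)

lemma koszul_diff_diff: "koszul_diff y s (\<lambda>\<sigma>. z \<sigma> - w \<sigma>) \<tau> = koszul_diff y s z \<tau> - koszul_diff y s w \<tau>"
  by (simp add: koszul_diff_def algebra_simps sum_subtractf)

lemma koszul_diff_mult: "koszul_diff y s (\<lambda>\<sigma>. c * z \<sigma>) \<tau> = c * koszul_diff y s z \<tau>"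
  by (simp add: koszul_diff_def algebra_simps sum_distrib_left)

lemma koszul_diff_remove:
  assumes "finite \<tau>" "j \<in> \<tau>"
  shows "koszul_diff y s z \<tau> = koszul_sign j \<tau> * y j ^ s j * z (\<tau> - {j}) +
    (\<Sum>i\<in>\<tau> - {j}. koszul_sign i \<tau> * y i ^ s i * z (\<tau> - {i}))"
  unfolding koszul_diff_def by (rule sum.remove) (use assms in auto)

lemma sum_complement: "j \<in> N \<Longrightarrow> (\<Sum>i\<in>N - (N - {j}). c i) = c j"
proof -
  assume "j \<in> N"
  then have "N - (N - {j}) = {j}" by blast
  then show ?thesis by simp
qed

text \<open>At \<open>N - {j}\<close> the cochain has the value \<open>koszul_sign j N * g j\<close>.\<close>

lemma koszul_diff_complement:
  "koszul_diff y s (\<lambda>\<sigma>. \<Sum>j\<in>N - \<sigma>. koszul_sign j N * g j) N = (\<Sum>j\<in>N. y j ^ s j * g j)"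
  unfolding koszul_diff_def
  by (rule sum.cong) (simp_all only: sum_complement mult.assoc mult.left_commute koszul_sign_square_left)

lemma koszul_diff_koszul_diff:
  assumes "finite \<tau>"
  shows "koszul_diff y s (koszul_diff y s z) \<tau> = (0::'a::comm_ring_1)"
proof -
  define g where "g i j = koszul_sign i \<tau> * y i ^ s i *
    (koszul_sign j (\<tau> - {i}) * y j ^ s j * z (\<tau> - {i} - {j}))" for i j
  have anti: "g i j = - g j i" if "i \<in> \<tau>" "j \<in> \<tau>" "i \<noteq> j" for i j
  proof -
    have "g i j = (koszul_sign i \<tau> * koszul_sign j (\<tau> - {i})) * (y i ^ s i * y j ^ s j * z (\<tau> - {i} - {j}))"
      by (simp add: g_def algebra_simps)
    also have "\<dots> = - (koszul_sign j \<tau> * koszul_sign i (\<tau> - {j})) * (y i ^ s i * y j ^ s j * z (\<tau> - {i} - {j}))"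
      using koszul_sign_anticommute [OF assms that, where 'a = 'a] by simp
    also have "\<dots> = - g j i"
      by (simp add: g_def algebra_simps Diff_insert [symmetric] insert_commute)
    finally show ?thesis .
  qed
  have fin: "finite {j \<in> \<tau>. P j}" for P using assms by simp
  have "koszul_diff y s (koszul_diff y s z) \<tau> = (\<Sum>i\<in>\<tau>. \<Sum>j\<in>\<tau> - {i}. g i j)"
    by (simp add: koszul_diff_def g_def sum_distrib_left)
  also have "\<dots> = (\<Sum>i\<in>\<tau>. (\<Sum>j\<in>{j\<in>\<tau>. j < i}. g i j) + (\<Sum>j\<in>{j\<in>\<tau>. i < j}. g i j))"
  proof (rule sum.cong)
    fix i assume "i \<in> \<tau>"
    have "\<tau> - {i} = {j\<in>\<tau>. j < i} \<union> {j\<in>\<tau>. i < j}" by auto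
    then show "(\<Sum>j\<in>\<tau> - {i}. g i j) = (\<Sum>j\<in>{j\<in>\<tau>. j < i}. g i j) + (\<Sum>j\<in>{j\<in>\<tau>. i < j}. g i j)"
      by (simp only:) (rule sum.union_disjoint, use fin in auto)
  qed simp
  also have "\<dots> = (\<Sum>i\<in>\<tau>. \<Sum>j\<in>{j\<in>\<tau>. j < i}. g i j) + (\<Sum>i\<in>\<tau>. \<Sum>j\<in>{j\<in>\<tau>. i < j}. g i j)"
    by (rule sum.distrib)
  also have "(\<Sum>i\<in>\<tau>. \<Sum>j\<in>{j\<in>\<tau>. i < j}. g i j) = (\<Sum>j\<in>\<tau>. \<Sum>i\<in>{i\<in>\<tau>. i < j}. g i j)"
    by (rule sum.swap_restrict) (use assms in auto)
  also have "\<dots> = (\<Sum>j\<in>\<tau>. \<Sum>i\<in>{i\<in>\<tau>. i < j}. - g j i)"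
    by (intro sum.cong refl) (auto intro: anti)
  finally show ?thesis by (simp add: sum_negf)
qed

text \<open>
  Multiplication by \<open>\<Prod>i\<in>\<sigma>. y i ^ d i\<close> in position \<open>\<sigma>\<close> is a map of complexes from
  the Koszul complex on the powers \<open>y i ^ s i\<close> to the one on the powers \<open>y i ^ (s i + d i)\<close>.
\<close>

lemma koszul_diff_shift:
  assumes "finite \<tau>"
  shows "koszul_diff y (\<lambda>i. s i + d i) (\<lambda>\<sigma>. (\<Prod>i\<in>\<sigma>. y i ^ d i) * z \<sigma>) \<tau> =
    (\<Prod>i\<in>\<tau>. y i ^ d i) * koszul_diff y s z \<tau>"
  unfolding koszul_diff_def sum_distrib_left
proof (rule sum.cong)
  fix j assume "j \<in> \<tau>"
  then have "(\<Prod>i\<in>\<tau>. y i ^ d i) = y j ^ d j * (\<Prod>i\<in>\<tau> - {j}. y i ^ d i)"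
    using assms by (simp add: prod.remove)
  then show "koszul_sign j \<tau> * y j ^ (s j + d j) * ((\<Prod>i\<in>\<tau> - {j}. y i ^ d i) * z (\<tau> - {j})) =
      (\<Prod>i\<in>\<tau>. y i ^ d i) * (koszul_sign j \<tau> * y j ^ s j * z (\<tau> - {j}))"
    by (simp add: power_add algebra_simps)
qed simp

lemma finite_cech_index [simp]: "finite (cech_index n p)"
  by (rule finite_subset[of _ "Pow {1..n}"]) (auto simp: cech_index_def)

lemma cech_index_finite: "\<sigma> \<in> cech_index n p \<Longrightarrow> finite \<sigma>"
  by (auto simp: cech_index_def intro: finite_subset)

lemma cech_index_subset: "\<sigma> \<in> cech_index n p \<Longrightarrow> \<sigma> \<subseteq> {1..n}"
  by (simp add: cech_index_def)

lemma cech_index_remove: "\<tau> \<in> cech_index n (Suc p) \<Longrightarrow> j \<in> \<tau> \<Longrightarrow> \<tau> - {j} \<in> cech_index n p"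
  by (auto simp: cech_index_def intro: finite_subset)

lemma cech_index_insert:
  "\<sigma> \<in> cech_index n p \<Longrightarrow> j \<in> {1..n} \<Longrightarrow> j \<notin> \<sigma> \<Longrightarrow> insert j \<sigma> \<in> cech_index n (Suc p)"
  by (auto simp: cech_index_def card_insert_if dest: finite_subset)

lemma cech_index_0: "cech_index n 0 = {{}}"
  by (auto simp: cech_index_def dest: finite_subset)

lemma cech_index_top: "cech_index n n = {{1..n}}"
  by (auto simp: cech_index_def dest: card_subset_eq [rotated])

lemma cech_index_above: "n < p \<Longrightarrow> cech_index n p = {}"
  by (auto simp: cech_index_def dest!: card_mono [rotated])

text \<open>
  The subring \<open>A\<close> will be the polynomial ring in finitely many variables inside a type with infinitely
  many.  Subquotients \<open>J/I\<close> of the ambient ring are handled through their representatives.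
\<close>

locale subring_sequence =
  fixes A :: "'a::comm_ring_1 set" and n :: nat and y :: "nat \<Rightarrow> 'a"
  assumes one_closed: "1 \<in> A"
    and minus_one_closed: "- 1 \<in> A"
    and add_closed: "u \<in> A \<Longrightarrow> v \<in> A \<Longrightarrow> u + v \<in> A"
    and mult_closed: "u \<in> A \<Longrightarrow> v \<in> A \<Longrightarrow> u * v \<in> A"
    and seq_closed: "j \<in> {1..n} \<Longrightarrow> y j \<in> A"
begin

definition submod :: "'a set \<Rightarrow> bool" where
  "submod J \<longleftrightarrow> 0 \<in> J \<and> (\<forall>u\<in>J. \<forall>v\<in>J. u + v \<in> J) \<and> (\<forall>a\<in>A. \<forall>u\<in>J. a * u \<in> J)"

lemma submod_0: "submod J \<Longrightarrow> 0 \<in> J" by (simp add: submod_def)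
lemma submod_add: "submod J \<Longrightarrow> u \<in> J \<Longrightarrow> v \<in> J \<Longrightarrow> u + v \<in> J" by (simp add: submod_def)
lemma submod_mult: "submod J \<Longrightarrow> a \<in> A \<Longrightarrow> u \<in> J \<Longrightarrow> a * u \<in> J" by (simp add: submod_def)
lemma submod_uminus: "submod J \<Longrightarrow> u \<in> J \<Longrightarrow> - u \<in> J"
  using submod_mult[of J "- 1" u] minus_one_closed by simp
lemma submod_diff: "submod J \<Longrightarrow> u \<in> J \<Longrightarrow> v \<in> J \<Longrightarrow> u - v \<in> J"
  using submod_add[of J u "- v"] submod_uminus[of J v] by simp
lemma submod_sum: "submod J \<Longrightarrow> (\<And>i. i \<in> B \<Longrightarrow> g i \<in> J) \<Longrightarrow> sum g B \<in> J"
  by (induction B rule: infinite_finite_induct) (auto intro: submod_0 submod_add)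
lemma submod_A: "submod A"
  using add_closed[OF one_closed minus_one_closed] by (auto simp: submod_def add_closed mult_closed)

lemma power_closed: "u \<in> A \<Longrightarrow> u ^ k \<in> A"
  by (induction k) (auto intro: one_closed mult_closed)
lemma prod_closed: "(\<And>i. i \<in> B \<Longrightarrow> g i \<in> A) \<Longrightarrow> prod g B \<in> A"
  by (induction B rule: infinite_finite_induct) (auto intro: one_closed mult_closed)
lemma sign_closed: "koszul_sign j \<tau> \<in> A"
  by (simp add: koszul_sign_def power_closed minus_one_closed)
lemma seq_power_closed: "\<tau> \<subseteq> {1..n} \<Longrightarrow> j \<in> \<tau> \<Longrightarrow> y j ^ k \<in> A"
  by (auto intro!: power_closed seq_closed)
lemma seq_prod_closed: "\<tau> \<subseteq> {1..n} \<Longrightarrow> (\<Prod>i\<in>\<tau>. y i ^ d i) \<in> A"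
  by (auto intro!: prod_closed seq_power_closed)

lemma koszul_diff_closed:
  assumes "submod J" "\<tau> \<subseteq> {1..n}" "\<And>j. j \<in> \<tau> \<Longrightarrow> z (\<tau> - {j}) \<in> J"
  shows "koszul_diff y s z \<tau> \<in> J"
  unfolding koszul_diff_def
  by (rule submod_sum[OF assms(1)], rule submod_mult[OF assms(1)])
    (use assms in \<open>auto intro!: mult_closed sign_closed seq_power_closed[OF assms(2)]\<close>)

text \<open>
  The vanishing of the \<open>p\<close>-th cohomology of the Koszul complex of \<open>J/I\<close> on the powers \<open>y i ^ s i\<close>,
  in terms of representatives in \<open>J\<close>.
\<close>

definition koszul_exact :: "'a set \<Rightarrow> 'a set \<Rightarrow> (nat \<Rightarrow> nat) \<Rightarrow> nat \<Rightarrow> bool" where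
  "koszul_exact J I s p \<longleftrightarrow>
    (\<forall>z. (\<forall>\<sigma>. z \<sigma> \<in> J) \<longrightarrow> (\<forall>\<tau>\<in>cech_index n (Suc p). koszul_diff y s z \<tau> \<in> I) \<longrightarrow>
      (\<exists>w. (\<forall>\<sigma>. w \<sigma> \<in> J) \<and> (\<forall>\<sigma>\<in>cech_index n p. z \<sigma> - koszul_diff y s w \<sigma> \<in> I)))"

text \<open>
  A \v{C}ech cochain with common denominator exponent \<open>t\<close> is a Koszul cochain on the powers
  \<open>y i ^ t\<close>, and raising \<open>t\<close> is the map of complexes above.  So the vanishing of the \<open>p\<close>-th local
  cohomology of \<open>J/I\<close> says that every Koszul cocycle becomes a coboundary after such a shift.
\<close>

definition cech_exact :: "'a set \<Rightarrow> 'a set \<Rightarrow> nat \<Rightarrow> bool" where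
  "cech_exact J I p \<longleftrightarrow>
    (\<forall>t z. (\<forall>\<sigma>. z \<sigma> \<in> J) \<longrightarrow> (\<forall>\<tau>\<in>cech_index n (Suc p). koszul_diff y (\<lambda>_. t) z \<tau> \<in> I) \<longrightarrow>
      (\<exists>e w. (\<forall>\<sigma>. w \<sigma> \<in> J) \<and>
        (\<forall>\<sigma>\<in>cech_index n p. (\<Prod>i\<in>\<sigma>. y i ^ e) * z \<sigma> - koszul_diff y (\<lambda>_. t + e) w \<sigma> \<in> I)))"

lemma koszul_exactD:
  assumes "koszul_exact J I s p" "\<And>\<sigma>. z \<sigma> \<in> J"
    "\<And>\<tau>. \<tau> \<in> cech_index n (Suc p) \<Longrightarrow> koszul_diff y s z \<tau> \<in> I"
  obtains w where "\<And>\<sigma>. w \<sigma> \<in> J" "\<And>\<sigma>. \<sigma> \<in> cech_index n p \<Longrightarrow> z \<sigma> - koszul_diff y s w \<sigma> \<in> I"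
proof -
  have "\<exists>w. (\<forall>\<sigma>. w \<sigma> \<in> J) \<and> (\<forall>\<sigma>\<in>cech_index n p. z \<sigma> - koszul_diff y s w \<sigma> \<in> I)"
    using assms(2,3) by (intro assms(1)[unfolded koszul_exact_def, rule_format]) auto
  then show thesis using that by blast
qed

lemma cech_exactD:
  assumes "cech_exact J I p" "\<And>\<sigma>. z \<sigma> \<in> J"
    "\<And>\<tau>. \<tau> \<in> cech_index n (Suc p) \<Longrightarrow> koszul_diff y (\<lambda>_. t) z \<tau> \<in> I"
  obtains e w where "\<And>\<sigma>. w \<sigma> \<in> J"
    "\<And>\<sigma>. \<sigma> \<in> cech_index n p \<Longrightarrow> (\<Prod>i\<in>\<sigma>. y i ^ e) * z \<sigma> - koszul_diff y (\<lambda>_. t + e) w \<sigma> \<in> I"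
proof -
  have "\<exists>e w. (\<forall>\<sigma>. w \<sigma> \<in> J) \<and>
      (\<forall>\<sigma>\<in>cech_index n p. (\<Prod>i\<in>\<sigma>. y i ^ e) * z \<sigma> - koszul_diff y (\<lambda>_. t + e) w \<sigma> \<in> I)"
    using assms(2,3) by (intro assms(1)[unfolded cech_exact_def, rule_format]) auto
  then show thesis using that by blast
qed

lemma cech_exact_if_koszul_exact:
  assumes "\<And>t. koszul_exact J I (\<lambda>_. t) p"
  shows "cech_exact J I p"
  unfolding cech_exact_def
proof (intro allI impI)
  fix t z assume "\<forall>\<sigma>. z \<sigma> \<in> J" "\<forall>\<tau>\<in>cech_index n (Suc p). koszul_diff y (\<lambda>_. t) z \<tau> \<in> I"
  then obtain w where "\<And>\<sigma>. w \<sigma> \<in> J" "\<And>\<sigma>. \<sigma> \<in> cech_index n p \<Longrightarrow> z \<sigma> - koszul_diff y (\<lambda>_. t) w \<sigma> \<in> I"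
    using koszul_exactD[OF assms, of z t] by metis
  then show "\<exists>e w. (\<forall>\<sigma>. w \<sigma> \<in> J) \<and> (\<forall>\<sigma>\<in>cech_index n p.
      (\<Prod>i\<in>\<sigma>. y i ^ e) * z \<sigma> - koszul_diff y (\<lambda>_. t + e) w \<sigma> \<in> I)"
    by (intro exI[of _ 0] exI[of _ w]) simp
qed

lemma cech_exact_above: "n < p \<Longrightarrow> submod J \<Longrightarrow> cech_exact J I p"
  unfolding cech_exact_def
  by (intro allI impI exI[of _ 0] exI[of _ "\<lambda>_. 0"]) (simp add: cech_index_above submod_0)

lemma cech_exact_refl: "submod J \<Longrightarrow> cech_exact J J p"
  unfolding cech_exact_def
  by (intro allI impI exI[of _ 0] exI[of _ "\<lambda>_. 0"]) (auto simp: submod_0 koszul_diff_def)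

text \<open>
  The long exact sequence at its middle term: a cocycle of \<open>I\<^sub>3/I\<^sub>1\<close> becomes a coboundary in
  \<open>I\<^sub>3/I\<^sub>2\<close> after a shift, so up to a coboundary it is a cocycle of \<open>I\<^sub>2/I\<^sub>1\<close>.
\<close>

lemma cech_exact_extension:
  assumes "submod I\<^sub>1" "submod I\<^sub>2" "submod I\<^sub>3" "I\<^sub>1 \<subseteq> I\<^sub>2" "I\<^sub>2 \<subseteq> I\<^sub>3"
    and "cech_exact I\<^sub>2 I\<^sub>1 p" "cech_exact I\<^sub>3 I\<^sub>2 p"
  shows "cech_exact I\<^sub>3 I\<^sub>1 p"
  unfolding cech_exact_def
proof (intro allI impI)
  fix t z assume z: "\<forall>\<sigma>. z \<sigma> \<in> I\<^sub>3" "\<forall>\<tau>\<in>cech_index n (Suc p). koszul_diff y (\<lambda>_. t) z \<tau> \<in> I\<^sub>1"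
  obtain e w where w: "\<And>\<sigma>. w \<sigma> \<in> I\<^sub>3"
    "\<And>\<sigma>. \<sigma> \<in> cech_index n p \<Longrightarrow> (\<Prod>i\<in>\<sigma>. y i ^ e) * z \<sigma> - koszul_diff y (\<lambda>_. t + e) w \<sigma> \<in> I\<^sub>2"
    by (rule cech_exactD[OF assms(7), of z t]) (use z assms(4) in auto)
  define z' where "z' \<sigma> = (if \<sigma> \<in> cech_index n p then
    (\<Prod>i\<in>\<sigma>. y i ^ e) * z \<sigma> - koszul_diff y (\<lambda>_. t + e) w \<sigma> else 0)" for \<sigma>
  have "z' \<sigma> \<in> I\<^sub>2" for \<sigma> using w submod_0[OF assms(2)] by (simp add: z'_def)
  moreover have "koszul_diff y (\<lambda>_. t + e) z' \<tau> \<in> I\<^sub>1" if \<tau>: "\<tau> \<in> cech_index n (Suc p)" for \<tau>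
  proof -
    have "koszul_diff y (\<lambda>_. t + e) z' \<tau> = koszul_diff y (\<lambda>_. t + e) (\<lambda>\<sigma>.
        (\<Prod>i\<in>\<sigma>. y i ^ e) * z \<sigma> - koszul_diff y (\<lambda>_. t + e) w \<sigma>) \<tau>"
      by (rule koszul_diff_cong) (auto simp: z'_def cech_index_remove[OF \<tau>])
    also have "\<dots> = (\<Prod>i\<in>\<tau>. y i ^ e) * koszul_diff y (\<lambda>_. t) z \<tau>"
      using koszul_diff_shift[OF cech_index_finite[OF \<tau>], of y "\<lambda>_. t" "\<lambda>_. e" z]
      by (simp add: koszul_diff_diff koszul_diff_koszul_diff[OF cech_index_finite[OF \<tau>]])
    also have "\<dots> \<in> I\<^sub>1"
      using z \<tau> assms(1) by (auto intro!: submod_mult seq_prod_closed cech_index_subset[OF \<tau>])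
    finally show ?thesis .
  qed
  ultimately obtain e' w' where w': "\<And>\<sigma>. w' \<sigma> \<in> I\<^sub>2" "\<And>\<sigma>. \<sigma> \<in> cech_index n p \<Longrightarrow>
      (\<Prod>i\<in>\<sigma>. y i ^ e') * z' \<sigma> - koszul_diff y (\<lambda>_. t + e + e') w' \<sigma> \<in> I\<^sub>1"
    using cech_exactD[OF assms(6), of z' "t + e"] by metis
  define w'' where "w'' \<sigma> = (if \<sigma> \<subseteq> {1..n} then (\<Prod>i\<in>\<sigma>. y i ^ e') * w \<sigma> + w' \<sigma> else 0)" for \<sigma>
  have "w'' \<sigma> \<in> I\<^sub>3" for \<sigma>
    using w(1)[of \<sigma>] w'(1)[of \<sigma>] assms(3,5) submod_0[OF assms(3)]
    by (auto simp: w''_def intro!: submod_add submod_mult seq_prod_closed)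
  moreover have "(\<Prod>i\<in>\<sigma>. y i ^ (e + e')) * z \<sigma> - koszul_diff y (\<lambda>_. t + (e + e')) w'' \<sigma> \<in> I\<^sub>1"
    if \<sigma>: "\<sigma> \<in> cech_index n p" for \<sigma>
  proof -
    have "koszul_diff y (\<lambda>_. t + (e + e')) w'' \<sigma> = koszul_diff y (\<lambda>_. t + e + e')
        (\<lambda>\<sigma>. (\<Prod>i\<in>\<sigma>. y i ^ e') * w \<sigma> + w' \<sigma>) \<sigma>"
      by (rule koszul_diff_cong) (use cech_index_subset[OF \<sigma>] in \<open>auto simp: w''_def\<close>)
    also have "\<dots> = (\<Prod>i\<in>\<sigma>. y i ^ e') * koszul_diff y (\<lambda>_. t + e) w \<sigma> +
        koszul_diff y (\<lambda>_. t + e + e') w' \<sigma>"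
      using koszul_diff_shift[OF cech_index_finite[OF \<sigma>], of y "\<lambda>_. t + e" "\<lambda>_. e'" w]
      by (simp add: koszul_diff_add)
    finally have "(\<Prod>i\<in>\<sigma>. y i ^ (e + e')) * z \<sigma> - koszul_diff y (\<lambda>_. t + (e + e')) w'' \<sigma> =
        (\<Prod>i\<in>\<sigma>. y i ^ e') * z' \<sigma> - koszul_diff y (\<lambda>_. t + e + e') w' \<sigma>"
      using \<sigma> by (simp add: z'_def power_add prod.distrib algebra_simps)
    then show ?thesis using w'(2)[OF \<sigma>] by simp
  qed
  ultimately show "\<exists>e w. (\<forall>\<sigma>. w \<sigma> \<in> I\<^sub>3) \<and> (\<forall>\<sigma>\<in>cech_index n p.
      (\<Prod>i\<in>\<sigma>. y i ^ e) * z \<sigma> - koszul_diff y (\<lambda>_. t + e) w \<sigma> \<in> I\<^sub>1)"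
    by blast
qed

text \<open>
  The Koszul complexes with the exponents \<open>s j\<close>, \<open>s j + 1\<close> and \<open>1\<close> at \<open>j\<close> form an exact triangle, so
  the map that raises \<open>s j\<close> is injective on cohomology in degree \<open>p\<close> once the third complex is exact in
  degree \<open>p - 1\<close>.  Explicitly, \<open>z\<close> and a cochain \<open>w\<close> that bounds its image combine to a cocycle \<open>\<eta>\<close> of
  the third complex, and a cochain \<open>v\<close> that bounds \<open>\<eta>\<close> turns \<open>w\<close> into a cochain that bounds \<open>z\<close>.
\<close>

lemma koszul_lift_step:
  assumes J: "submod J" and I: "submod I" "I \<subseteq> J" and j: "j \<in> {1..n}"
    and prev: "\<And>q. p = Suc q \<Longrightarrow> koszul_exact J I (s(j := 1)) q"
    and z: "\<And>\<sigma>. z \<sigma> \<in> J" "\<And>\<tau>. \<tau> \<in> cech_index n (Suc p) \<Longrightarrow> koszul_diff y s z \<tau> \<in> I"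
    and w: "\<And>\<sigma>. w \<sigma> \<in> J" "\<And>\<sigma>. \<sigma> \<in> cech_index n p \<Longrightarrow>
      (if j \<in> \<sigma> then y j else 1) * z \<sigma> - koszul_diff y (s(j := Suc (s j))) w \<sigma> \<in> I"
  shows "\<exists>w. (\<forall>\<sigma>. w \<sigma> \<in> J) \<and> (\<forall>\<sigma>\<in>cech_index n p. z \<sigma> - koszul_diff y s w \<sigma> \<in> I)"
proof (cases p)
  case 0
  then show ?thesis using w by (intro exI[of _ w]) (auto simp: cech_index_0)
next
  case (Suc q)
  define \<eta> where "\<eta> \<sigma> = (if j \<in> \<sigma> then w \<sigma> else
    y j ^ s j * w \<sigma> - koszul_sign j (insert j \<sigma>) * z (insert j \<sigma>))" for \<sigma>
  have \<eta>_closed: "\<eta> \<sigma> \<in> J" for \<sigma>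
    using w(1) z(1) J j
    by (auto simp: \<eta>_def intro!: submod_diff submod_mult power_closed seq_closed sign_closed)
  have \<eta>_cocycle: "koszul_diff y (s(j := 1)) \<eta> \<tau> \<in> I" if \<tau>: "\<tau> \<in> cech_index n (Suc q)" for \<tau>
  proof -
    note fin = cech_index_finite[OF \<tau>]
    have wI: "(if j \<in> \<tau> then y j else 1) * z \<tau> - koszul_diff y (s(j := Suc (s j))) w \<tau> \<in> I"
      using w(2) \<tau> Suc by blast
    show ?thesis
    proof (cases "j \<in> \<tau>")
      case True
      have "koszul_diff y (s(j := 1)) \<eta> \<tau> =
          koszul_diff y (s(j := Suc (s j))) w \<tau> - y j * z \<tau>"
        by (simp add: koszul_diff_remove[OF fin True] \<eta>_def True insert_absorb[OF True] algebra_simps)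
      also have "\<dots> = - (y j * z \<tau> - koszul_diff y (s(j := Suc (s j))) w \<tau>)" by simp
      also have "\<dots> \<in> I" by (rule submod_uminus[OF I(1)]) (use wI True in simp)
      finally show ?thesis .
    next
      case False
      let ?\<tau> = "insert j \<tau>"
      have \<tau>': "?\<tau> \<in> cech_index n (Suc p)" using cech_index_insert[OF \<tau> j False] Suc by simp
      have fin': "finite ?\<tau>" using fin by simp
      have 1: "?\<tau> - {j} = \<tau>" using False by auto
      have 2: "koszul_sign i \<tau> * koszul_sign j (?\<tau> - {i}) = - (koszul_sign i ?\<tau> * koszul_sign j ?\<tau> :: 'a)"
        if "i \<in> \<tau>" for i
        using koszul_sign_split[OF fin', of i j, where 'a = 'a] that False by (auto simp: 1)
      have 3: "koszul_sign i \<tau> * y i ^ (s(j := 1)) i * \<eta> (\<tau> - {i}) =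
          y j ^ s j * (koszul_sign i \<tau> * y i ^ s i * w (\<tau> - {i})) +
          koszul_sign j ?\<tau> * (koszul_sign i ?\<tau> * y i ^ s i * z (?\<tau> - {i}))" if i: "i \<in> \<tau>" for i
      proof -
        have "insert j (\<tau> - {i}) = ?\<tau> - {i}" "i \<noteq> j" using i False by auto
        then have "koszul_sign i \<tau> * y i ^ (s(j := 1)) i * \<eta> (\<tau> - {i}) =
          y j ^ s j * (koszul_sign i \<tau> * y i ^ s i * w (\<tau> - {i})) -
            (koszul_sign i \<tau> * koszul_sign j (?\<tau> - {i})) * (y i ^ s i * z (?\<tau> - {i}))"
          using False by (simp add: \<eta>_def algebra_simps)
        then show ?thesis by (simp add: 2[OF i] algebra_simps)
      qed
      have 4: "koszul_diff y (s(j := Suc (s j))) w \<tau> = koszul_diff y s w \<tau>"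
        by (rule koszul_diff_cong) (use False in auto)
      have "koszul_diff y (s(j := 1)) \<eta> \<tau> = y j ^ s j * koszul_diff y s w \<tau> +
          koszul_sign j ?\<tau> * (\<Sum>i\<in>\<tau>. koszul_sign i ?\<tau> * y i ^ s i * z (?\<tau> - {i}))"
        unfolding koszul_diff_def sum_distrib_left sum.distrib[symmetric] by (rule sum.cong) (use 3 in auto)
      also have "\<dots> = y j ^ s j * koszul_diff y s w \<tau> +
          koszul_sign j ?\<tau> * (koszul_diff y s z ?\<tau> - koszul_sign j ?\<tau> * y j ^ s j * z \<tau>)"
        using koszul_diff_remove[OF fin', of j y s z] 1 by simp
      also have "\<dots> = koszul_sign j ?\<tau> * koszul_diff y s z ?\<tau> -
          y j ^ s j * (z \<tau> - koszul_diff y s w \<tau>)"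
        by (simp add: algebra_simps)
      also have "\<dots> \<in> I"
      proof (rule submod_diff[OF I(1)])
        show "koszul_sign j ?\<tau> * koszul_diff y s z ?\<tau> \<in> I"
          by (rule submod_mult[OF I(1) sign_closed z(2)[OF \<tau>']])
        show "y j ^ s j * (z \<tau> - koszul_diff y s w \<tau>) \<in> I"
          using wI False by (intro submod_mult[OF I(1) power_closed[OF seq_closed[OF j]]]) (simp add: 4)
      qed
      finally show ?thesis .
    qed
  qed
  obtain v where v: "\<And>\<sigma>. v \<sigma> \<in> J"
    "\<And>\<sigma>. \<sigma> \<in> cech_index n q \<Longrightarrow> \<eta> \<sigma> - koszul_diff y (s(j := 1)) v \<sigma> \<in> I"
    by (rule koszul_exactD[OF prev[OF Suc], of \<eta>]) (use \<eta>_closed \<eta>_cocycle in auto)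
  define w' where "w' \<sigma> = (if j \<in> \<sigma> then koszul_sign j \<sigma> * v (\<sigma> - {j}) else w \<sigma>)" for \<sigma>
  have "w' \<sigma> \<in> J" for \<sigma>
    using v(1) w(1) J by (auto simp: w'_def intro!: submod_mult sign_closed)
  moreover have "z \<tau> - koszul_diff y s w' \<tau> \<in> I" if \<tau>: "\<tau> \<in> cech_index n p" for \<tau>
  proof (cases "j \<in> \<tau>")
    case False
    have "koszul_diff y (s(j := Suc (s j))) w \<tau> = koszul_diff y s w' \<tau>"
      by (rule koszul_diff_cong) (use False in \<open>auto simp: w'_def\<close>)
    then show ?thesis using w(2)[OF \<tau>] False by simp
  next
    case True
    note fin = cech_index_finite[OF \<tau>]
    let ?\<sigma> = "\<tau> - {j}"
    have \<sigma>: "?\<sigma> \<in> cech_index n q" using \<tau> True cech_index_remove Suc by blast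
    have 2: "koszul_sign i \<tau> * y i ^ s i * w' (\<tau> - {i}) =
        - koszul_sign j \<tau> * (koszul_sign i ?\<sigma> * y i ^ (s(j := 1)) i * v (?\<sigma> - {i}))" if i: "i \<in> ?\<sigma>" for i
    proof -
      have "koszul_sign i \<tau> * y i ^ s i * w' (\<tau> - {i}) =
          (koszul_sign i \<tau> * koszul_sign j (\<tau> - {i})) * (y i ^ s i * v (?\<sigma> - {i}))"
        using i True by (auto simp: w'_def algebra_simps Diff_insert[symmetric] insert_commute)
      also have "\<dots> = - (koszul_sign j \<tau> * koszul_sign i ?\<sigma>) * (y i ^ s i * v (?\<sigma> - {i}))"
        using koszul_sign_anticommute[OF fin, of i j, where 'a = 'a] i True by auto
      also have "\<dots> = - koszul_sign j \<tau> * (koszul_sign i ?\<sigma> * y i ^ (s(j := 1)) i * v (?\<sigma> - {i}))"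
        using i by (simp add: algebra_simps)
      finally show ?thesis .
    qed
    have "koszul_diff y s w' \<tau> = koszul_sign j \<tau> * y j ^ s j * w ?\<sigma> +
        (\<Sum>i\<in>?\<sigma>. koszul_sign i \<tau> * y i ^ s i * w' (\<tau> - {i}))"
      by (simp add: koszul_diff_remove[OF fin True] w'_def)
    also have "(\<Sum>i\<in>?\<sigma>. koszul_sign i \<tau> * y i ^ s i * w' (\<tau> - {i})) =
        - koszul_sign j \<tau> * koszul_diff y (s(j := 1)) v ?\<sigma>"
      unfolding koszul_diff_def sum_distrib_left by (rule sum.cong) (use 2 in auto)
    finally have "z \<tau> - koszul_diff y s w' \<tau> =
        - koszul_sign j \<tau> * (\<eta> ?\<sigma> - koszul_diff y (s(j := 1)) v ?\<sigma>)"
      by (simp add: \<eta>_def insert_absorb[OF True] algebra_simps)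
    also have "\<dots> \<in> I"
      by (rule submod_mult[OF I(1) submod_uminus[OF submod_A sign_closed] v(2)[OF \<sigma>]])
    finally show ?thesis .
  qed
  ultimately show ?thesis by blast
qed

text \<open>
  An arbitrary increase \<open>d\<close> of the exponents is a composition of such steps.
\<close>

lemma koszul_lift:
  assumes J: "submod J" and I: "submod I" "I \<subseteq> J"
    and prev: "\<And>q s. p = Suc q \<Longrightarrow> (\<And>i. i \<in> {1..n} \<Longrightarrow> 1 \<le> s i) \<Longrightarrow> koszul_exact J I s q"
    and s: "\<And>i. i \<in> {1..n} \<Longrightarrow> 1 \<le> s i"
    and z: "\<And>\<sigma>. z \<sigma> \<in> J" "\<And>\<tau>. \<tau> \<in> cech_index n (Suc p) \<Longrightarrow> koszul_diff y s z \<tau> \<in> I"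
    and w: "\<And>\<sigma>. w \<sigma> \<in> J" "\<And>\<sigma>. \<sigma> \<in> cech_index n p \<Longrightarrow>
      (\<Prod>i\<in>\<sigma>. y i ^ d i) * z \<sigma> - koszul_diff y (\<lambda>i. s i + d i) w \<sigma> \<in> I"
  shows "\<exists>w. (\<forall>\<sigma>. w \<sigma> \<in> J) \<and> (\<forall>\<sigma>\<in>cech_index n p. z \<sigma> - koszul_diff y s w \<sigma> \<in> I)"
  using s z w
proof (induction "\<Sum>i\<in>{1..n}. d i" arbitrary: s z w d rule: less_induct)
  case less
  show ?case
  proof (cases "\<exists>j\<in>{1..n}. d j \<noteq> 0")
    case False
    have "z \<sigma> - koszul_diff y s w \<sigma> \<in> I" if \<sigma>: "\<sigma> \<in> cech_index n p" for \<sigma>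
    proof -
      have d: "d i = 0" if "i \<in> \<sigma>" for i using False cech_index_subset[OF \<sigma>] that by auto
      then have "koszul_diff y (\<lambda>i. s i + d i) w \<sigma> = koszul_diff y s w \<sigma>"
        by (intro koszul_diff_cong) auto
      moreover have "(\<Prod>i\<in>\<sigma>. y i ^ d i) = 1" using d by simp
      ultimately show ?thesis using less.prems(5)[OF \<sigma>] by simp
    qed
    then show ?thesis using less.prems(4) by blast
  next
    case True
    then obtain j where j: "j \<in> {1..n}" "d j \<noteq> 0" by blast
    define d' where "d' = d(j := d j - 1)"
    define s' where "s' = s(j := Suc (s j))"
    define c where "c \<sigma> = (if j \<in> \<sigma> then y j else 1)" for \<sigma>
    have c: "c \<sigma> = (\<Prod>i\<in>\<sigma>. y i ^ (if i = j then 1 else 0))" if "finite \<sigma>" for \<sigma>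
      using that by (simp add: c_def if_distrib prod.delta cong: if_cong)
    have s'_eq: "s' = (\<lambda>i. s i + (if i = j then 1 else 0))" by (auto simp: s'_def)
    have sd: "(\<lambda>i. s' i + d' i) = (\<lambda>i. s i + d i)" using j by (auto simp: s'_def d'_def)
    have "(\<Sum>i\<in>{1..n}. d' i) < (\<Sum>i\<in>{1..n}. d i)"
      by (rule sum_strict_mono_ex1) (use j in \<open>auto simp: d'_def intro!: bexI[of _ j]\<close>)
    moreover have "1 \<le> s' i" if "i \<in> {1..n}" for i using less.prems(1)[OF that] by (simp add: s'_def)
    moreover have "c \<sigma> * z \<sigma> \<in> J" for \<sigma>
      using less.prems(2)[of \<sigma>] J j one_closed by (auto simp: c_def intro!: submod_mult seq_closed)
    moreover have "koszul_diff y s' (\<lambda>\<sigma>. c \<sigma> * z \<sigma>) \<tau> \<in> I" if \<tau>: "\<tau> \<in> cech_index n (Suc p)" for \<tau>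
    proof -
      note fin = cech_index_finite[OF \<tau>]
      have "koszul_diff y s' (\<lambda>\<sigma>. c \<sigma> * z \<sigma>) \<tau> = koszul_diff y s'
          (\<lambda>\<sigma>. (\<Prod>i\<in>\<sigma>. y i ^ (if i = j then 1 else 0)) * z \<sigma>) \<tau>"
        by (rule koszul_diff_cong) (auto simp: c fin)
      also have "\<dots> = (\<Prod>i\<in>\<tau>. y i ^ (if i = j then 1 else 0)) * koszul_diff y s z \<tau>"
        unfolding s'_eq by (rule koszul_diff_shift[OF fin])
      also have "\<dots> \<in> I"
        by (intro submod_mult[OF I(1)] seq_prod_closed cech_index_subset[OF \<tau>] less.prems(3)[OF \<tau>])
      finally show ?thesis .
    qed
    moreover note less.prems(4)
    moreover have "(\<Prod>i\<in>\<sigma>. y i ^ d' i) * (c \<sigma> * z \<sigma>) - koszul_diff y (\<lambda>i. s' i + d' i) w \<sigma> \<in> I"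
      if \<sigma>: "\<sigma> \<in> cech_index n p" for \<sigma>
    proof -
      note fin = cech_index_finite[OF \<sigma>]
      have "(\<Prod>i\<in>\<sigma>. y i ^ d' i) * c \<sigma> = (\<Prod>i\<in>\<sigma>. y i ^ (d' i + (if i = j then 1 else 0)))"
        unfolding c[OF fin] by (simp only: power_add prod.distrib)
      also have "\<dots> = (\<Prod>i\<in>\<sigma>. y i ^ d i)"
        by (rule prod.cong) (use j in \<open>auto simp: d'_def\<close>)
      finally show ?thesis using less.prems(5)[OF \<sigma>] by (simp add: sd mult.assoc[symmetric])
    qed
    ultimately have "\<exists>w'. (\<forall>\<sigma>. w' \<sigma> \<in> J) \<and>
        (\<forall>\<sigma>\<in>cech_index n p. c \<sigma> * z \<sigma> - koszul_diff y s' w' \<sigma> \<in> I)"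
      by (rule less.hyps[of d' s' "\<lambda>\<sigma>. c \<sigma> * z \<sigma>" w])
    then obtain w' where w': "\<And>\<sigma>. w' \<sigma> \<in> J"
      "\<And>\<sigma>. \<sigma> \<in> cech_index n p \<Longrightarrow> c \<sigma> * z \<sigma> - koszul_diff y s' w' \<sigma> \<in> I"
      by blast
    show ?thesis
    proof (rule koszul_lift_step[where w = w', OF J I j(1) _ less.prems(2,3) w'(1)])
      show "koszul_exact J I (s(j := 1)) q" if "p = Suc q" for q
        using prev[OF that] less.prems(1) by simp
    qed (use w'(2) in \<open>auto simp: c_def s'_def\<close>)
  qed
qed

text \<open>
  Depth sensitivity.  By induction on the degree, vanishing in the previous degree makes the maps that
  raise exponents injective on Koszul cohomology, which therefore embeds into its colimit, the local
  cohomology; and this is zero.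
\<close>

theorem koszul_exact_if_cech_exact:
  assumes J: "submod J" and I: "submod I" "I \<subseteq> J"
    and cech: "\<And>q. q < N \<Longrightarrow> cech_exact J I q"
    and "p < N" and s: "\<And>i. i \<in> {1..n} \<Longrightarrow> 1 \<le> s i"
  shows "koszul_exact J I s p"
proof -
  have step: "koszul_exact J I s p"
    if p: "p < N" and s: "\<And>i. i \<in> {1..n} \<Longrightarrow> 1 \<le> s i"
      and IH: "\<And>q s. p = Suc q \<Longrightarrow> (\<And>i. i \<in> {1..n} \<Longrightarrow> 1 \<le> s i) \<Longrightarrow> koszul_exact J I s q"
    for p and s :: "nat \<Rightarrow> nat"
    unfolding koszul_exact_def
  proof (intro allI impI)
    fix z assume z: "\<forall>\<sigma>. z \<sigma> \<in> J" "\<forall>\<tau>\<in>cech_index n (Suc p). koszul_diff y s z \<tau> \<in> I"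
    \<comment> \<open>a common upper bound of the exponents, for a \v{C}ech cochain with one denominator exponent\<close>
    define t where "t = (\<Sum>i\<in>{1..n}. s i)"
    have st: "s i \<le> t" if "i \<in> {1..n}" for i unfolding t_def by (rule member_le_sum) (use that in auto)
    define z' where "z' \<sigma> = (if \<sigma> \<subseteq> {1..n} then (\<Prod>i\<in>\<sigma>. y i ^ (t - s i)) * z \<sigma> else 0)" for \<sigma>
    have "z' \<sigma> \<in> J" for \<sigma>
      using z(1) J by (auto simp: z'_def intro!: submod_mult seq_prod_closed submod_0)
    moreover have "koszul_diff y (\<lambda>_. t) z' \<tau> \<in> I" if \<tau>: "\<tau> \<in> cech_index n (Suc p)" for \<tau>
    proof -
      note sub = cech_index_subset[OF \<tau>]
      have "koszul_diff y (\<lambda>_. t) z' \<tau> = koszul_diff y (\<lambda>i. s i + (t - s i))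
          (\<lambda>\<sigma>. (\<Prod>i\<in>\<sigma>. y i ^ (t - s i)) * z \<sigma>) \<tau>"
        by (rule koszul_diff_cong) (use sub st in \<open>auto simp: z'_def\<close>)
      also have "\<dots> = (\<Prod>i\<in>\<tau>. y i ^ (t - s i)) * koszul_diff y s z \<tau>"
        by (rule koszul_diff_shift[OF cech_index_finite[OF \<tau>]])
      also have "\<dots> \<in> I" using z(2) \<tau> sub I by (auto intro!: submod_mult seq_prod_closed)
      finally show ?thesis .
    qed
    ultimately obtain e w where w: "\<And>\<sigma>. w \<sigma> \<in> J" "\<And>\<sigma>. \<sigma> \<in> cech_index n p \<Longrightarrow>
        (\<Prod>i\<in>\<sigma>. y i ^ e) * z' \<sigma> - koszul_diff y (\<lambda>_. t + e) w \<sigma> \<in> I"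
      using cech_exactD[OF cech[OF p], of z' t] by metis
    show "\<exists>w. (\<forall>\<sigma>. w \<sigma> \<in> J) \<and> (\<forall>\<sigma>\<in>cech_index n p. z \<sigma> - koszul_diff y s w \<sigma> \<in> I)"
    proof (rule koszul_lift[where w = w and d = "\<lambda>i. t + e - s i", OF J I IH s _ _ w(1)])
      fix \<sigma> assume \<sigma>: "\<sigma> \<in> cech_index n p"
      note sub = cech_index_subset[OF \<sigma>]
      have "koszul_diff y (\<lambda>i. s i + (t + e - s i)) w \<sigma> = koszul_diff y (\<lambda>_. t + e) w \<sigma>"
        by (rule koszul_diff_cong) (use sub st in \<open>force+\<close>)
      moreover have "(\<Prod>i\<in>\<sigma>. y i ^ (t + e - s i)) = (\<Prod>i\<in>\<sigma>. y i ^ e) * (\<Prod>i\<in>\<sigma>. y i ^ (t - s i))"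
        unfolding prod.distrib[symmetric] power_add[symmetric]
      proof (rule prod.cong)
        fix i assume "i \<in> \<sigma>"
        then have "t + e - s i = e + (t - s i)" using sub st[of i] by auto
        then show "y i ^ (t + e - s i) = y i ^ (e + (t - s i))" by simp
      qed simp
      ultimately show "(\<Prod>i\<in>\<sigma>. y i ^ (t + e - s i)) * z \<sigma> -
          koszul_diff y (\<lambda>i. s i + (t + e - s i)) w \<sigma> \<in> I"
        using w(2)[OF \<sigma>] sub by (simp add: z'_def mult.assoc)
    qed (use z in auto)
  qed
  show ?thesis using \<open>p < N\<close> s
  proof (induction p arbitrary: s)
    case 0 show ?case by (rule step) (use 0 in auto)
  next
    case (Suc p)
    show ?case by (rule step) (use Suc in auto)
  qed
qed

end

context subring_sequence
begin

section \<open>Regular sequences and relations\<close>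

text \<open>
  Exactness in degree \<open>n - 1\<close> is the vanishing of \<open>Tor\<^sub>1(A/Q, A/I)\<close>, where \<open>Q\<close> is generated by the
  \<open>y j\<close>, and it yields \<open>I \<inter> Q = Q I\<close>.  The coefficients \<open>u\<close> form a cocycle modulo \<open>I\<close>; modulo \<open>I\<close> they are
  the coboundary of some \<open>w\<close>, and this part contributes \<open>d (d w) = 0\<close> to the sum.
\<close>

lemma koszul_exact_relation:
  assumes I: "submod I" "I \<subseteq> A" and n: "0 < n"
    and ex: "koszul_exact A I (\<lambda>_. 1) (n - 1)"
    and u: "\<And>j. j \<in> {1..n} \<Longrightarrow> u j \<in> A" "(\<Sum>j\<in>{1..n}. y j * u j) \<in> I"
  shows "\<exists>g. (\<forall>j. g j \<in> I) \<and> (\<Sum>j\<in>{1..n}. y j * u j) = (\<Sum>j\<in>{1..n}. y j * g j)"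
proof -
  define N where "N = {1..n}"
  have fin: "finite N" by (simp add: N_def)
  note u = u[folded N_def]
  define z where "z \<sigma> = (\<Sum>j\<in>N - \<sigma>. koszul_sign j N * u j)" for \<sigma>
  have z_eq: "z (N - {j}) = koszul_sign j N * u j" if "j \<in> N" for j
    unfolding z_def by (rule sum_complement[OF that])
  have z_closed: "z \<sigma> \<in> A" for \<sigma>
    unfolding z_def by (intro submod_sum[OF submod_A] mult_closed sign_closed u(1)) blast
  have "koszul_diff y (\<lambda>_. 1) z N = (\<Sum>j\<in>N. y j ^ 1 * u j)"
    unfolding z_def by (rule koszul_diff_complement)
  then have diff_z: "koszul_diff y (\<lambda>_. 1) z N \<in> I" using u(2) by simp
  have z_cocycle: "koszul_diff y (\<lambda>_. 1) z \<tau> \<in> I" if "\<tau> \<in> cech_index n (Suc (n - 1))" for \<tau>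
  proof -
    have "\<tau> = N" using that n cech_index_top[of n] by (simp add: N_def)
    then show ?thesis using diff_z by simp
  qed
  obtain w where w: "\<And>\<sigma>. w \<sigma> \<in> A"
    "\<And>\<sigma>. \<sigma> \<in> cech_index n (n - 1) \<Longrightarrow> z \<sigma> - koszul_diff y (\<lambda>_. 1) w \<sigma> \<in> I"
    by (rule koszul_exactD[OF ex, of z]) (use z_closed z_cocycle in auto)
  define g where "g j = (if j \<in> N then
    koszul_sign j N * (z (N - {j}) - koszul_diff y (\<lambda>_. 1) w (N - {j})) else 0)" for j
  have "g j \<in> I" for j
  proof (cases "j \<in> N")
    case True
    then have "N - {j} \<in> cech_index n (n - 1)" using n by (auto simp: cech_index_def N_def)
    then show ?thesis using submod_mult[OF I(1) sign_closed w(2)] True by (simp only: g_def if_True)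
  qed (auto simp: g_def submod_0[OF I(1)])
  moreover have "(\<Sum>j\<in>N. y j * g j) = (\<Sum>j\<in>N. y j * u j)"
  proof -
    have "(\<Sum>j\<in>N. y j * g j) = (\<Sum>j\<in>N. y j * u j -
        koszul_sign j N * y j ^ 1 * koszul_diff y (\<lambda>_. 1) w (N - {j}))"
    proof (rule sum.cong)
      fix j assume j: "j \<in> N"
      then have "g j = koszul_sign j N * (koszul_sign j N * u j - koszul_diff y (\<lambda>_. 1) w (N - {j}))"
        by (simp only: g_def if_True z_eq)
      then show "y j * g j = y j * u j - koszul_sign j N * y j ^ 1 * koszul_diff y (\<lambda>_. 1) w (N - {j})"
        by (simp add: right_diff_distrib mult.assoc mult.left_commute)
    qed simp
    also have "\<dots> = (\<Sum>j\<in>N. y j * u j) - koszul_diff y (\<lambda>_. 1) (koszul_diff y (\<lambda>_. 1) w) N"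
      by (simp add: sum_subtractf koszul_diff_def)
    finally show ?thesis by (simp add: koszul_diff_koszul_diff[OF fin])
  qed
  ultimately show ?thesis unfolding N_def by (intro exI[of _ g]) simp
qed

text \<open>
  The hypothesis says that the powers \<open>y j ^ s j\<close> form a regular sequence on \<open>A/I\<close> in every order, and
  the variables are adjoined one at a time.  The components of a cocycle at index sets without \<open>j\<close> form a
  cocycle for the smaller sequence; it is a coboundary, by induction below the top degree and by
  regularity of \<open>y j\<close> in the top degree.  Once these components are zero, the remaining ones form a
  cocycle for the smaller sequence in one degree less.
\<close>

lemma koszul_exact_if_regular:
  assumes I: "submod I" "I \<subseteq> A"
    and regular: "\<And>V j u g. V \<subseteq> {1..n} \<Longrightarrow> j \<in> {1..n} \<Longrightarrow> j \<notin> V \<Longrightarrow> u \<in> A \<Longrightarrow> (\<And>i. g i \<in> A) \<Longrightarrow>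
      y j ^ s j * u - (\<Sum>i\<in>V. y i ^ s i * g i) \<in> I \<Longrightarrow>
      \<exists>g'. (\<forall>i. g' i \<in> A) \<and> u - (\<Sum>i\<in>V. y i ^ s i * g' i) \<in> I"
    and p: "p < n"
  shows "koszul_exact A I s p"
proof -
  have main: "\<exists>w. (\<forall>\<sigma>. w \<sigma> \<in> A) \<and> (\<forall>\<sigma>. \<sigma> \<subseteq> V \<longrightarrow> card \<sigma> = p \<longrightarrow> z \<sigma> - koszul_diff y s w \<sigma> \<in> I)"
    if "finite V" "V \<subseteq> {1..n}" "p < card V" "\<And>\<sigma>. z \<sigma> \<in> A"
      "\<And>\<tau>. \<tau> \<subseteq> V \<Longrightarrow> card \<tau> = Suc p \<Longrightarrow> koszul_diff y s z \<tau> \<in> I" for V p z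
    using that
  proof (induction V arbitrary: p z rule: finite_induct)
    case empty then show ?case by simp
  next
    case (insert j V)
    let ?W = "insert j V"
    have V: "V \<subseteq> {1..n}" and j: "j \<in> {1..n}" using insert.prems(1) by auto
    have sub: "\<tau> \<subseteq> {1..n}" if "\<tau> \<subseteq> ?W" for \<tau> using that insert.prems(1) by auto
    have fin: "finite \<tau>" if "\<tau> \<subseteq> ?W" for \<tau> using that insert.hyps(1) by (auto intro: finite_subset)
    have "\<exists>w. (\<forall>\<sigma>. w \<sigma> \<in> A) \<and> (\<forall>\<sigma>. \<sigma> \<subseteq> V \<longrightarrow> card \<sigma> = p \<longrightarrow> z \<sigma> - koszul_diff y s w \<sigma> \<in> I)"
    proof (cases "p < card V")
      case True
      show ?thesis by (rule insert.IH[OF V True insert.prems(3)]) (use insert.prems(4) in auto)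
    next
      case False
      then have p: "p = card V" using insert.prems(2) insert.hyps by simp
      have "koszul_diff y s z ?W \<in> I" using insert.prems(4)[of ?W] insert.hyps p by simp
      then have "koszul_sign j ?W * y j ^ s j * z V +
          (\<Sum>i\<in>V. koszul_sign i ?W * y i ^ s i * z (?W - {i})) \<in> I"
        using koszul_diff_remove[of ?W j y s z] insert.hyps by simp
      then have "koszul_sign j ?W * (koszul_sign j ?W * y j ^ s j * z V +
          (\<Sum>i\<in>V. koszul_sign i ?W * y i ^ s i * z (?W - {i}))) \<in> I"
        by (rule submod_mult[OF I(1) sign_closed])
      then have "y j ^ s j * z V - (\<Sum>i\<in>V. y i ^ s i *
          (- (koszul_sign j ?W * (koszul_sign i ?W * z (?W - {i}))))) \<in> I"
        by (simp add: distrib_left sum_distrib_left sum_negf mult.assoc mult.left_commute)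
      then obtain g where g: "\<And>i. g i \<in> A" "z V - (\<Sum>i\<in>V. y i ^ s i * g i) \<in> I"
        using regular[OF V j insert.hyps(2) insert.prems(3),
            of "\<lambda>i. - (koszul_sign j ?W * (koszul_sign i ?W * z (?W - {i})))"]
          insert.prems(3) by (blast intro: submod_uminus[OF submod_A] mult_closed sign_closed)
      define w where "w \<sigma> = (\<Sum>i\<in>V - \<sigma>. koszul_sign i V * g i)" for \<sigma>
      have "w \<sigma> \<in> A" for \<sigma>
        unfolding w_def by (intro submod_sum[OF submod_A] mult_closed sign_closed g(1))
      moreover have "koszul_diff y s w V = (\<Sum>i\<in>V. y i ^ s i * g i)"
        unfolding w_def by (rule koszul_diff_complement)
      moreover have "\<sigma> = V" if "\<sigma> \<subseteq> V" "card \<sigma> = p" for \<sigma>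
        using that p insert.hyps(1) by (simp add: card_subset_eq)
      ultimately show ?thesis using g(2) by metis
    qed
    then obtain w where w: "\<And>\<sigma>. w \<sigma> \<in> A"
      "\<And>\<sigma>. \<sigma> \<subseteq> V \<Longrightarrow> card \<sigma> = p \<Longrightarrow> z \<sigma> - koszul_diff y s w \<sigma> \<in> I" by blast
    show ?case
    proof (cases p)
      case 0
      then have "z \<sigma> - koszul_diff y s w \<sigma> \<in> I" if "\<sigma> \<subseteq> ?W" "card \<sigma> = p" for \<sigma>
        using w(2)[of "{}"] that fin[OF that(1)] by simp
      then show ?thesis using w(1) by blast
    next
      case (Suc q)
      \<comment> \<open>the cocycle after the components without \<open>j\<close> have been moved into \<open>I\<close>\<close>
      define z1 where "z1 \<sigma> = (if \<sigma> \<subseteq> ?W then z \<sigma> - koszul_diff y s w \<sigma> else 0)" for \<sigma>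
      have z1_closed: "z1 \<sigma> \<in> A" for \<sigma>
        using insert.prems(3) koszul_diff_closed[OF submod_A, of \<sigma> w s] w(1) sub
        by (auto simp: z1_def intro: submod_diff[OF submod_A] submod_0[OF submod_A])
      have z1_V: "z1 \<sigma> \<in> I" if "\<sigma> \<subseteq> V" "card \<sigma> = p" for \<sigma>
        using w(2)[OF that] that by (auto simp: z1_def)
      have z1_diff: "koszul_diff y s z1 \<tau> \<in> I" if \<tau>: "\<tau> \<subseteq> ?W" "card \<tau> = Suc p" for \<tau>
      proof -
        have "koszul_diff y s z1 \<tau> = koszul_diff y s (\<lambda>\<sigma>. z \<sigma> - koszul_diff y s w \<sigma>) \<tau>"
          by (rule koszul_diff_cong) (use \<tau> in \<open>auto simp: z1_def\<close>)
        also have "\<dots> = koszul_diff y s z \<tau>"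
          by (simp add: koszul_diff_diff koszul_diff_koszul_diff[OF fin[OF \<tau>(1)]])
        finally show ?thesis using insert.prems(4)[OF \<tau>] by simp
      qed
      \<comment> \<open>its components with \<open>j\<close>, as a cochain for \<open>V\<close>\<close>
      define z2 where "z2 \<rho> = koszul_sign j (insert j \<rho>) * z1 (insert j \<rho>)" for \<rho>
      have z2_closed: "z2 \<rho> \<in> A" for \<rho> by (auto simp: z2_def intro: mult_closed sign_closed z1_closed)
      have z2_diff: "koszul_diff y s z2 \<rho> \<in> I" if \<rho>: "\<rho> \<subseteq> V" "card \<rho> = Suc q" for \<rho>
      proof -
        let ?\<tau> = "insert j \<rho>"
        have j\<rho>: "j \<notin> \<rho>" using \<rho> insert.hyps by auto
        have \<tau>: "?\<tau> \<subseteq> ?W" "card ?\<tau> = Suc p"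
          using \<rho> j\<rho> finite_subset[OF \<rho>(1) insert.hyps(1)] Suc by auto
        have finr: "finite \<rho>" and fint: "finite ?\<tau>" using fin[OF \<tau>(1)] by auto
        have 1: "?\<tau> - {j} = \<rho>" using j\<rho> by auto
        have "koszul_diff y s z2 \<rho> =
            - koszul_sign j ?\<tau> * (\<Sum>i\<in>\<rho>. koszul_sign i ?\<tau> * y i ^ s i * z1 (?\<tau> - {i}))"
          unfolding koszul_diff_def sum_distrib_left
        proof (rule sum.cong)
          fix i assume i: "i \<in> \<rho>"
          then have 2: "insert j (\<rho> - {i}) = ?\<tau> - {i}" "i \<noteq> j" using j\<rho> by auto
          have "koszul_sign i \<rho> * y i ^ s i * z2 (\<rho> - {i}) =
              (koszul_sign i (?\<tau> - {j}) * koszul_sign j (?\<tau> - {i})) * (y i ^ s i * z1 (?\<tau> - {i}))"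
            unfolding z2_def 2(1) 1 by (simp add: algebra_simps)
          also have "\<dots> = - koszul_sign j ?\<tau> * (koszul_sign i ?\<tau> * y i ^ s i * z1 (?\<tau> - {i}))"
            using koszul_sign_split[OF fint, of i j, where 'a = 'a] i 2(2) by (simp add: algebra_simps)
          finally show "koszul_sign i \<rho> * y i ^ s i * z2 (\<rho> - {i}) = \<dots>" .
        qed simp
        also have "(\<Sum>i\<in>\<rho>. koszul_sign i ?\<tau> * y i ^ s i * z1 (?\<tau> - {i})) =
            koszul_diff y s z1 ?\<tau> - koszul_sign j ?\<tau> * y j ^ s j * z1 \<rho>"
          using koszul_diff_remove[OF fint, of j y s z1] 1 by simp
        also have "- koszul_sign j ?\<tau> * \<dots> \<in> I"
        proof (rule submod_mult[OF I(1) submod_uminus[OF submod_A sign_closed] submod_diff[OF I(1)]])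
          show "koszul_diff y s z1 ?\<tau> \<in> I" by (rule z1_diff[OF \<tau>])
          have "z1 \<rho> \<in> I" using z1_V[OF \<rho>(1)] \<rho>(2) Suc by simp
          then show "koszul_sign j ?\<tau> * y j ^ s j * z1 \<rho> \<in> I"
            by (intro submod_mult[OF I(1)] mult_closed sign_closed power_closed seq_closed j)
        qed
        finally show ?thesis .
      qed
      have "q < card V" using insert.prems(2) insert.hyps Suc by simp
      then obtain v where v: "\<And>\<sigma>. v \<sigma> \<in> A"
        "\<And>\<sigma>. \<sigma> \<subseteq> V \<Longrightarrow> card \<sigma> = q \<Longrightarrow> z2 \<sigma> - koszul_diff y s v \<sigma> \<in> I"
        using insert.IH[OF V, of q z2] z2_closed z2_diff by metis
      define w' where "w' \<sigma> = (if j \<in> \<sigma> then w \<sigma> - koszul_sign j \<sigma> * v (\<sigma> - {j}) else w \<sigma>)" for \<sigma>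
      have "w' \<sigma> \<in> A" for \<sigma>
        by (auto simp: w'_def intro!: submod_diff[OF submod_A] mult_closed sign_closed w(1) v(1))
      moreover have "z \<tau> - koszul_diff y s w' \<tau> \<in> I" if \<tau>: "\<tau> \<subseteq> ?W" "card \<tau> = p" for \<tau>
      proof (cases "j \<in> \<tau>")
        case False
        then have "koszul_diff y s w' \<tau> = koszul_diff y s w \<tau>"
          by (intro koszul_diff_cong) (auto simp: w'_def)
        then show ?thesis using w(2)[of \<tau>] \<tau> False by auto
      next
        case True
        note fint = fin[OF \<tau>(1)]
        let ?\<rho> = "\<tau> - {j}"
        have \<rho>: "?\<rho> \<subseteq> V" "card ?\<rho> = q" using \<tau> True Suc fint by auto
        have 1: "koszul_sign i \<tau> * y i ^ s i * w' (\<tau> - {i}) = koszul_sign i \<tau> * y i ^ s i * w (\<tau> - {i}) +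
            koszul_sign j \<tau> * (koszul_sign i ?\<rho> * y i ^ s i * v (?\<rho> - {i}))" if i: "i \<in> ?\<rho>" for i
        proof -
          have "koszul_sign i \<tau> * y i ^ s i * w' (\<tau> - {i}) = koszul_sign i \<tau> * y i ^ s i * w (\<tau> - {i}) -
              (koszul_sign i \<tau> * koszul_sign j (\<tau> - {i})) * (y i ^ s i * v (?\<rho> - {i}))"
            using i True by (auto simp: w'_def algebra_simps Diff_insert[symmetric] insert_commute)
          moreover have "koszul_sign i \<tau> * koszul_sign j (\<tau> - {i}) =
              - (koszul_sign j \<tau> * koszul_sign i ?\<rho> :: 'a)"
            by (rule koszul_sign_anticommute[OF fint]) (use i True in auto)
          ultimately show ?thesis by (simp add: mult.assoc)
        qed
        have "koszul_diff y s w' \<tau> = koszul_sign j \<tau> * y j ^ s j * w ?\<rho> +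
            (\<Sum>i\<in>?\<rho>. koszul_sign i \<tau> * y i ^ s i * w' (\<tau> - {i}))"
          by (simp add: koszul_diff_remove[OF fint True] w'_def)
        also have "(\<Sum>i\<in>?\<rho>. koszul_sign i \<tau> * y i ^ s i * w' (\<tau> - {i})) =
            (\<Sum>i\<in>?\<rho>. koszul_sign i \<tau> * y i ^ s i * w (\<tau> - {i})) + koszul_sign j \<tau> * koszul_diff y s v ?\<rho>"
          unfolding koszul_diff_def sum_distrib_left sum.distrib[symmetric] by (rule sum.cong) (use 1 in auto)
        finally have "koszul_diff y s w' \<tau> = koszul_diff y s w \<tau> + koszul_sign j \<tau> * koszul_diff y s v ?\<rho>"
          by (simp add: koszul_diff_remove[OF fint True] add.assoc)
        then have "z \<tau> - koszul_diff y s w' \<tau> = koszul_sign j \<tau> * (z2 ?\<rho> - koszul_diff y s v ?\<rho>)"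
          using \<tau> by (simp add: z2_def z1_def insert_absorb[OF True] algebra_simps)
        then show ?thesis using submod_mult[OF I(1) sign_closed v(2)[OF \<rho>], of j \<tau>] by simp
      qed
      ultimately show ?thesis by blast
    qed
  qed
  show ?thesis
    unfolding koszul_exact_def
  proof (intro allI impI)
    fix z assume "\<forall>\<sigma>. z \<sigma> \<in> A" "\<forall>\<tau>\<in>cech_index n (Suc p). koszul_diff y s z \<tau> \<in> I"
    then have "\<exists>w. (\<forall>\<sigma>. w \<sigma> \<in> A) \<and> (\<forall>\<sigma>. \<sigma> \<subseteq> {1..n} \<longrightarrow> card \<sigma> = p \<longrightarrow> z \<sigma> - koszul_diff y s w \<sigma> \<in> I)"
      by (intro main) (use p in \<open>auto simp: cech_index_def\<close>)
    then show "\<exists>w. (\<forall>\<sigma>. w \<sigma> \<in> A) \<and> (\<forall>\<sigma>\<in>cech_index n p. z \<sigma> - koszul_diff y s w \<sigma> \<in> I)"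
      unfolding cech_index_def by blast
  qed
qed

text \<open>
  The long exact sequence of \<open>0 \<rightarrow> A \<rightarrow> A \<rightarrow> A/hA \<rightarrow> 0\<close>: a cocycle of \<open>A/hA\<close> has its differential in \<open>hA\<close>,
  and the quotient by \<open>h\<close> is a cocycle in the next degree.
\<close>

lemma koszul_exact_mod_nonzerodivisor:
  assumes h: "h \<in> A" "\<And>u. u \<in> A \<Longrightarrow> h * u = 0 \<Longrightarrow> u = 0"
    and ex: "koszul_exact A {0} s p" "koszul_exact A {0} s (Suc p)"
  shows "koszul_exact A ((*) h ` A) s p"
  unfolding koszul_exact_def
proof (intro allI impI)
  fix z assume z: "\<forall>\<sigma>. z \<sigma> \<in> A" "\<forall>\<tau>\<in>cech_index n (Suc p). koszul_diff y s z \<tau> \<in> (*) h ` A"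
  have "\<forall>\<tau>. \<exists>c. c \<in> A \<and> (\<tau> \<in> cech_index n (Suc p) \<longrightarrow> koszul_diff y s z \<tau> = h * c)"
    using z(2) one_closed by blast
  then obtain c where c: "\<And>\<tau>. c \<tau> \<in> A"
    "\<And>\<tau>. \<tau> \<in> cech_index n (Suc p) \<Longrightarrow> koszul_diff y s z \<tau> = h * c \<tau>" by metis
  have c_cocycle: "koszul_diff y s c \<rho> \<in> {0}" if \<rho>: "\<rho> \<in> cech_index n (Suc (Suc p))" for \<rho>
  proof -
    have "h * koszul_diff y s c \<rho> = koszul_diff y s (koszul_diff y s z) \<rho>"
      unfolding koszul_diff_mult[symmetric]
      by (rule koszul_diff_cong) (simp_all add: c(2)[OF cech_index_remove[OF \<rho>]])
    then have "h * koszul_diff y s c \<rho> = 0"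
      by (simp add: koszul_diff_koszul_diff[OF cech_index_finite[OF \<rho>]])
    then show ?thesis
      using h(2)[OF koszul_diff_closed[OF submod_A cech_index_subset[OF \<rho>] c(1)]] by simp
  qed
  obtain e where e: "\<And>\<sigma>. e \<sigma> \<in> A"
    "\<And>\<tau>. \<tau> \<in> cech_index n (Suc p) \<Longrightarrow> c \<tau> - koszul_diff y s e \<tau> \<in> {0}"
    by (rule koszul_exactD[OF ex(2), of c]) (use c(1) c_cocycle in auto)
  have z'_closed: "z \<sigma> - h * e \<sigma> \<in> A" for \<sigma>
    using z(1) e(1) h(1) by (auto intro: submod_diff[OF submod_A] mult_closed)
  have z'_cocycle: "koszul_diff y s (\<lambda>\<sigma>. z \<sigma> - h * e \<sigma>) \<tau> \<in> {0}" if \<tau>: "\<tau> \<in> cech_index n (Suc p)" for \<tau>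
    using e(2)[OF \<tau>] c(2)[OF \<tau>] by (simp add: koszul_diff_diff koszul_diff_mult)
  obtain w where w: "\<And>\<sigma>. w \<sigma> \<in> A"
    "\<And>\<sigma>. \<sigma> \<in> cech_index n p \<Longrightarrow> z \<sigma> - h * e \<sigma> - koszul_diff y s w \<sigma> \<in> {0}"
    by (rule koszul_exactD[OF ex(1), of "\<lambda>\<sigma>. z \<sigma> - h * e \<sigma>"]) (use z'_closed z'_cocycle in auto)
  have "z \<sigma> - koszul_diff y s w \<sigma> \<in> (*) h ` A" if "\<sigma> \<in> cech_index n p" for \<sigma>
    using w(2)[OF that] e(1)[of \<sigma>] by (intro image_eqI[of _ _ "e \<sigma>"]) (auto simp: algebra_simps)
  then show "\<exists>w. (\<forall>\<sigma>. w \<sigma> \<in> A) \<and> (\<forall>\<sigma>\<in>cech_index n p. z \<sigma> - koszul_diff y s w \<sigma> \<in> (*) h ` A)"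
    using w(1) by blast
qed

text \<open>Multiplication by \<open>h\<close> is an isomorphism from \<open>J/I\<close> onto \<open>hJ/hI\<close>.\<close>

lemma cech_exact_mult:
  assumes I: "submod I" "submod J" "I \<subseteq> J" "J \<subseteq> A"
    and h: "h \<in> A" "\<And>u. u \<in> A \<Longrightarrow> h * u = 0 \<Longrightarrow> u = 0"
  shows "cech_exact ((*) h ` J) ((*) h ` I) p \<longleftrightarrow> cech_exact J I p"
proof -
  have h_mem: "h * u \<in> (*) h ` I \<longleftrightarrow> u \<in> I" if "u \<in> J" for u
  proof
    assume "h * u \<in> (*) h ` I"
    then obtain v where v: "v \<in> I" "h * u = h * v" by blast
    then have "h * (u - v) = 0" by (simp add: algebra_simps)
    moreover have "u - v \<in> A" using that v(1) I by (blast intro: submod_diff[OF submod_A])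
    ultimately show "u \<in> I" using h(2) v(1) by fastforce
  qed blast
  have J_diff: "koszul_diff y s z \<tau> \<in> J" if "\<And>\<sigma>. z \<sigma> \<in> J" "\<tau> \<in> cech_index n q" for z \<tau> s q
    by (rule koszul_diff_closed[OF I(2) cech_index_subset[OF that(2)]]) (rule that)
  have J_term: "(\<Prod>i\<in>\<sigma>. y i ^ e) * z \<sigma> - koszul_diff y s w \<sigma> \<in> J"
    if "\<And>\<sigma>. z \<sigma> \<in> J" "\<And>\<sigma>. w \<sigma> \<in> J" "\<sigma> \<in> cech_index n q" for z w \<sigma> s q e
    by (rule submod_diff[OF I(2) submod_mult[OF I(2) seq_prod_closed[OF cech_index_subset[OF that(3)]]
          that(1)] J_diff[OF that(2,3)]])
  have h_term: "(\<Prod>i\<in>\<sigma>. y i ^ e) * (h * z \<sigma>) - koszul_diff y s (\<lambda>\<sigma>. h * w \<sigma>) \<sigma> =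
      h * ((\<Prod>i\<in>\<sigma>. y i ^ e) * z \<sigma> - koszul_diff y s w \<sigma>)" for e z s w \<sigma>
    by (simp add: koszul_diff_mult algebra_simps)
  show ?thesis
  proof
    assume ex: "cech_exact ((*) h ` J) ((*) h ` I) p"
    show "cech_exact J I p" unfolding cech_exact_def
    proof (intro allI impI)
      fix t z assume z: "\<forall>\<sigma>. z \<sigma> \<in> J" "\<forall>\<tau>\<in>cech_index n (Suc p). koszul_diff y (\<lambda>_. t) z \<tau> \<in> I"
      obtain e w where w: "\<And>\<sigma>. w \<sigma> \<in> (*) h ` J" "\<And>\<sigma>. \<sigma> \<in> cech_index n p \<Longrightarrow>
          (\<Prod>i\<in>\<sigma>. y i ^ e) * (h * z \<sigma>) - koszul_diff y (\<lambda>_. t + e) w \<sigma> \<in> (*) h ` I"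
        by (rule cech_exactD[OF ex, of "\<lambda>\<sigma>. h * z \<sigma>" t]) (use z in \<open>auto simp: koszul_diff_mult\<close>)
      have "\<forall>\<sigma>. \<exists>x. x \<in> J \<and> w \<sigma> = h * x" using w(1) by blast
      then obtain v where v: "\<And>\<sigma>. v \<sigma> \<in> J" "\<And>\<sigma>. w \<sigma> = h * v \<sigma>" by metis
      then have wv: "w = (\<lambda>\<sigma>. h * v \<sigma>)" by auto
      have "(\<Prod>i\<in>\<sigma>. y i ^ e) * z \<sigma> - koszul_diff y (\<lambda>_. t + e) v \<sigma> \<in> I"
        if \<sigma>: "\<sigma> \<in> cech_index n p" for \<sigma>
        using w(2)[OF \<sigma>] J_term[OF _ v(1) \<sigma>, of z] z(1) unfolding wv h_term by (simp add: h_mem)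
      then show "\<exists>e w. (\<forall>\<sigma>. w \<sigma> \<in> J) \<and> (\<forall>\<sigma>\<in>cech_index n p.
          (\<Prod>i\<in>\<sigma>. y i ^ e) * z \<sigma> - koszul_diff y (\<lambda>_. t + e) w \<sigma> \<in> I)"
        using v(1) by blast
    qed
  next
    assume ex: "cech_exact J I p"
    show "cech_exact ((*) h ` J) ((*) h ` I) p" unfolding cech_exact_def
    proof (intro allI impI)
      fix t z assume z: "\<forall>\<sigma>. z \<sigma> \<in> (*) h ` J"
        "\<forall>\<tau>\<in>cech_index n (Suc p). koszul_diff y (\<lambda>_. t) z \<tau> \<in> (*) h ` I"
      have "\<forall>\<sigma>. \<exists>x. x \<in> J \<and> z \<sigma> = h * x" using z(1) by blast
      then obtain x where x: "\<And>\<sigma>. x \<sigma> \<in> J" "\<And>\<sigma>. z \<sigma> = h * x \<sigma>" by metis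
      then have zx: "z = (\<lambda>\<sigma>. h * x \<sigma>)" by auto
      obtain e w where w: "\<And>\<sigma>. w \<sigma> \<in> J" "\<And>\<sigma>. \<sigma> \<in> cech_index n p \<Longrightarrow>
          (\<Prod>i\<in>\<sigma>. y i ^ e) * x \<sigma> - koszul_diff y (\<lambda>_. t + e) w \<sigma> \<in> I"
      proof (rule cech_exactD[OF ex, of x t])
        show "koszul_diff y (\<lambda>_. t) x \<tau> \<in> I" if "\<tau> \<in> cech_index n (Suc p)" for \<tau>
          using z(2)[rule_format, OF that] h_mem[OF J_diff[of x, OF x(1) that]]
          by (simp only: zx koszul_diff_mult)
      qed (use x(1) in auto)
      show "\<exists>e w. (\<forall>\<sigma>. w \<sigma> \<in> (*) h ` J) \<and> (\<forall>\<sigma>\<in>cech_index n p.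
          (\<Prod>i\<in>\<sigma>. y i ^ e) * z \<sigma> - koszul_diff y (\<lambda>_. t + e) w \<sigma> \<in> (*) h ` I)"
        by (rule exI[of _ e], rule exI[of _ "\<lambda>\<sigma>. h * w \<sigma>"]) (use w in \<open>auto simp: zx h_term\<close>)
    qed
  qed
qed

text \<open>In the top degree there is one component, and no cocycle condition.\<close>

lemma cech_exact_top_iff:
  assumes J: "submod J"
  shows "cech_exact J I n \<longleftrightarrow> (\<forall>t. \<forall>u\<in>J. \<exists>e g. (\<forall>j. g j \<in> J) \<and>
    (\<Prod>i\<in>{1..n}. y i ^ e) * u - (\<Sum>j\<in>{1..n}. y j ^ (t + e) * g j) \<in> I)"
proof
  assume ex: "cech_exact J I n"
  show "\<forall>t. \<forall>u\<in>J. \<exists>e g. (\<forall>j. g j \<in> J) \<and>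
      (\<Prod>i\<in>{1..n}. y i ^ e) * u - (\<Sum>j\<in>{1..n}. y j ^ (t + e) * g j) \<in> I"
  proof (intro allI ballI)
    fix t u assume u: "u \<in> J"
    obtain e w where w: "\<And>\<sigma>. w \<sigma> \<in> J" "\<And>\<sigma>. \<sigma> \<in> cech_index n n \<Longrightarrow>
        (\<Prod>i\<in>\<sigma>. y i ^ e) * u - koszul_diff y (\<lambda>_. t + e) w \<sigma> \<in> I"
      by (rule cech_exactD[OF ex, of "\<lambda>_. u" t]) (use u in \<open>auto simp: cech_index_above\<close>)
    define g where "g j = koszul_sign j {1..n} * w ({1..n} - {j})" for j
    have "koszul_diff y (\<lambda>_. t + e) w {1..n} = (\<Sum>j\<in>{1..n}. y j ^ (t + e) * g j)"
      unfolding koszul_diff_def g_def by (rule sum.cong) (simp_all only: ac_simps)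
    then have "(\<Prod>i\<in>{1..n}. y i ^ e) * u - (\<Sum>j\<in>{1..n}. y j ^ (t + e) * g j) \<in> I"
      using w(2)[of "{1..n}"] by (simp only: cech_index_top singletonI)
    moreover have "g j \<in> J" for j unfolding g_def by (rule submod_mult[OF J sign_closed w(1)])
    ultimately show "\<exists>e g. (\<forall>j. g j \<in> J) \<and>
        (\<Prod>i\<in>{1..n}. y i ^ e) * u - (\<Sum>j\<in>{1..n}. y j ^ (t + e) * g j) \<in> I"
      by (intro exI[of _ e] exI[of _ g]) simp
  qed
next
  assume top: "\<forall>t. \<forall>u\<in>J. \<exists>e g. (\<forall>j. g j \<in> J) \<and>
    (\<Prod>i\<in>{1..n}. y i ^ e) * u - (\<Sum>j\<in>{1..n}. y j ^ (t + e) * g j) \<in> I"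
  show "cech_exact J I n"
    unfolding cech_exact_def
  proof (intro allI impI)
    fix t and z :: "nat set \<Rightarrow> 'a" assume "\<forall>\<sigma>. z \<sigma> \<in> J"
    then obtain e g where g: "\<And>j. g j \<in> J"
      "(\<Prod>i\<in>{1..n}. y i ^ e) * z {1..n} - (\<Sum>j\<in>{1..n}. y j ^ (t + e) * g j) \<in> I"
      using top by blast
    define w where "w \<sigma> = (\<Sum>j\<in>{1..n} - \<sigma>. koszul_sign j {1..n} * g j)" for \<sigma>
    have "koszul_diff y (\<lambda>_. t + e) w {1..n} = (\<Sum>j\<in>{1..n}. y j ^ (t + e) * g j)"
      unfolding w_def by (rule koszul_diff_complement)
    moreover have "w \<sigma> \<in> J" for \<sigma>
      unfolding w_def by (intro submod_sum[OF J] submod_mult[OF J sign_closed g(1)])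
    ultimately show "\<exists>e w. (\<forall>\<sigma>. w \<sigma> \<in> J) \<and>
        (\<forall>\<sigma>\<in>cech_index n n. (\<Prod>i\<in>\<sigma>. y i ^ e) * z \<sigma> - koszul_diff y (\<lambda>_. t + e) w \<sigma> \<in> I)"
      using g(2) unfolding cech_index_top by (intro exI[of _ e] exI[of _ w]) simp
  qed
qed

lemma submod_multiples: "h \<in> A \<Longrightarrow> submod ((*) h ` A)"
  unfolding submod_def
proof (intro conjI ballI)
  show "0 \<in> (*) h ` A" using submod_0[OF submod_A] by (intro image_eqI[of _ _ 0]) auto
  fix u assume "u \<in> (*) h ` A"
  then obtain u' where u: "u = h * u'" "u' \<in> A" by blast
  show "u + v \<in> (*) h ` A" if "v \<in> (*) h ` A" for v
    using that u by (auto simp: distrib_left[symmetric] add_closed)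
  show "a * u \<in> (*) h ` A" if "a \<in> A" for a
    using that u by (intro image_eqI[of _ _ "a * u'"]) (auto simp: mult.left_commute mult_closed)
qed

lemma multiples_subset: "h \<in> A \<Longrightarrow> (*) h ` A \<subseteq> A"
  by (auto intro: mult_closed)

end

section \<open>Local cohomology of a subquotient\<close>

context subring_sequence
begin

abbreviation R :: "'a ring" where
  "R \<equiv> \<lparr>carrier = A, mult = (*), one = 1, zero = 0, add = (+)\<rparr>"

lemma cring_R: "cring R"
proof (intro cringI abelian_groupI comm_monoidI)
  fix u assume "u \<in> carrier R"
  then show "\<exists>v\<in>carrier R. v \<oplus>\<^bsub>R\<^esub> u = \<zero>\<^bsub>R\<^esub>"
    using submod_uminus[OF submod_A, of u] by (intro bexI[of _ "- u"]) auto
qed (use submod_0[OF submod_A] in \<open>auto simp: add_closed mult_closed one_closed algebra_simps\<close>)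

lemma nat_pow_R: "s [^]\<^bsub>R\<^esub> (k::nat) = s ^ k"
  by (induction k) (simp_all add: mult.commute)

lemma finprod_R: "\<sigma> \<subseteq> {1..n} \<Longrightarrow> (\<Otimes>\<^bsub>R\<^esub>j\<in>\<sigma>. y j) = (\<Prod>j\<in>\<sigma>. y j)"
proof (induction \<sigma> rule: infinite_finite_induct)
  interpret cring R by (rule cring_R)
  case (insert j \<sigma>)
  then have "(\<lambda>j. y j) \<in> \<sigma> \<rightarrow> carrier R" "y j \<in> carrier R" using seq_closed by auto
  then have "(\<Otimes>\<^bsub>R\<^esub>j\<in>insert j \<sigma>. y j) = y j \<otimes>\<^bsub>R\<^esub> (\<Otimes>\<^bsub>R\<^esub>j\<in>\<sigma>. y j)"
    using insert by (intro finprod_insert) auto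
  then show ?case using insert by simp
next
  interpret cring R by (rule cring_R)
  case empty show ?case by (subst finprod_empty) simp
next
  case (infinite \<sigma>) then show ?case by (simp add: finite_subset)
qed

lemma minus_one_R: "\<ominus>\<^bsub>R\<^esub> \<one>\<^bsub>R\<^esub> = - 1"
proof -
  interpret cring R by (rule cring_R)
  show ?thesis by (rule minus_equality) (use one_closed minus_one_closed in auto)
qed

end

text \<open>
  A presentation \<open>M \<cong> J/I\<close>.  The localizations and the \v{C}ech complex of \<open>M\<close> are computed with
  representatives in \<open>J\<close>.
\<close>

locale presented_module = subring_sequence A n y
  for A :: "'a::comm_ring_1 set" and n :: nat and y :: "nat \<Rightarrow> 'a" +
  fixes M :: "('a, 'b, 's) module_scheme" and \<pi> :: "'a \<Rightarrow> 'b" and J I :: "'a set"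
  assumes J: "submod J" and I: "submod I" "I \<subseteq> J"
    and pi_onto: "carrier M = \<pi> ` J"
    and pi_add: "u \<in> J \<Longrightarrow> v \<in> J \<Longrightarrow> \<pi> (u + v) = \<pi> u \<oplus>\<^bsub>M\<^esub> \<pi> v"
    and pi_smult: "a \<in> A \<Longrightarrow> u \<in> J \<Longrightarrow> \<pi> (a * u) = a \<odot>\<^bsub>M\<^esub> \<pi> u"
    and pi_zero: "\<pi> 0 = \<zero>\<^bsub>M\<^esub>"
    and pi_eq: "u \<in> J \<Longrightarrow> v \<in> J \<Longrightarrow> \<pi> u = \<pi> v \<longleftrightarrow> u - v \<in> I"
begin

lemma prod_seq_closed: "\<sigma> \<subseteq> {1..n} \<Longrightarrow> (\<Prod>j\<in>\<sigma>. y j) \<in> A"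
  by (intro prod_closed seq_closed) blast

lemma J_mult: "a \<in> A \<Longrightarrow> u \<in> J \<Longrightarrow> a * u \<in> J" by (rule submod_mult[OF J])
lemma J_add: "u \<in> J \<Longrightarrow> v \<in> J \<Longrightarrow> u + v \<in> J" by (rule submod_add[OF J])

text \<open>The fraction \<open>\<pi> u / s ^ k\<close>.\<close>

definition fr :: "'a \<Rightarrow> 'a \<Rightarrow> nat \<Rightarrow> ('b \<times> nat) set" where
  "fr s u k = frac R M s (\<pi> u) k"

lemma mem_frac_iff:
  assumes "s \<in> A" "u \<in> J" "v \<in> J"
  shows "(\<pi> v, l) \<in> fr s u k \<longleftrightarrow> (\<exists>t. s ^ (t + l) * u - s ^ (t + k) * v \<in> I)"
proof -
  have "s ^ i \<in> A" for i using assms(1) by (rule power_closed)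
  then have "s ^ i \<odot>\<^bsub>M\<^esub> \<pi> u = s ^ j \<odot>\<^bsub>M\<^esub> \<pi> v \<longleftrightarrow> s ^ i * u - s ^ j * v \<in> I" for i j
    using assms by (subst pi_eq [symmetric]) (auto simp: pi_smult J_mult)
  then show ?thesis using assms by (simp add: fr_def frac_def nat_pow_R pi_onto)
qed

lemma fr_cases:
  assumes "x \<in> fr s u k"
  obtains v l where "x = (\<pi> v, l)" "v \<in> J"
  using assms by (auto simp: fr_def frac_def pi_onto)

lemma fr_eq_iff:
  assumes s: "s \<in> A" and u: "u \<in> J" and v: "v \<in> J"
  shows "fr s u k = fr s v l \<longleftrightarrow> (\<exists>t. s ^ (t + l) * u - s ^ (t + k) * v \<in> I)"
proof
  assume "fr s u k = fr s v l"
  moreover have "(\<pi> v, l) \<in> fr s v l"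
    using submod_0[OF I(1)] by (subst mem_frac_iff[OF s v v]) simp
  ultimately have "(\<pi> v, l) \<in> fr s u k" by simp
  then show "\<exists>t. s ^ (t + l) * u - s ^ (t + k) * v \<in> I" by (simp add: mem_frac_iff[OF s u v])
next
  have sub: "fr s v l \<subseteq> fr s u k"
    if u: "u \<in> J" and v: "v \<in> J" and t: "s ^ (t + l) * u - s ^ (t + k) * v \<in> I" for u v k l t
  proof
    fix x assume x: "x \<in> fr s v l"
    then obtain w q where w: "x = (\<pi> w, q)" "w \<in> J" by (rule fr_cases)
    then obtain r where r: "s ^ (r + q) * v - s ^ (r + l) * w \<in> I"
      using x mem_frac_iff[OF s v w(2)] by blast
    have "s ^ (r + q) * (s ^ (t + l) * u - s ^ (t + k) * v) + s ^ (t + k) * (s ^ (r + q) * v - s ^ (r + l) * w) \<in> I"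
      by (intro submod_add[OF I(1)] submod_mult[OF I(1)] power_closed s t r)
    also have "s ^ (r + q) * (s ^ (t + l) * u - s ^ (t + k) * v) + s ^ (t + k) * (s ^ (r + q) * v - s ^ (r + l) * w) =
        s ^ (r + t + l + q) * u - s ^ (r + t + l + k) * w"
      by (simp add: algebra_simps power_add)
    finally show "x \<in> fr s u k" unfolding w(1) mem_frac_iff[OF s u w(2)] by blast
  qed
  assume "\<exists>t. s ^ (t + l) * u - s ^ (t + k) * v \<in> I"
  then obtain t where t: "s ^ (t + l) * u - s ^ (t + k) * v \<in> I" by blast
  then have "s ^ (t + k) * v - s ^ (t + l) * u \<in> I" using submod_uminus[OF I(1)] by fastforce
  with t show "fr s u k = fr s v l" using sub[OF u v] sub[OF v u] by blast
qed

lemma fr_self: "s \<in> A \<Longrightarrow> u \<in> J \<Longrightarrow> (\<pi> u, k) \<in> fr s u k"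
  using submod_0[OF I(1)] by (subst mem_frac_iff) auto

lemma fr_expand:
  assumes "s \<in> A" "u \<in> J"
  shows "fr s u k = fr s (s ^ t * u) (k + t)"
proof (subst fr_eq_iff)
  show "\<exists>ta. s ^ (ta + (k + t)) * u - s ^ (ta + k) * (s ^ t * u) \<in> I"
    using submod_0[OF I(1)] by (intro exI[of _ 0]) (simp add: power_add mult.assoc)
qed (use assms J_mult power_closed in auto)

text \<open>The operations on fractions are defined as unions over all representatives; this evaluates such a
  union at one representative.\<close>

lemma UN_frac:
  assumes "s \<in> A" "u \<in> J"
    and "\<And>v l. v \<in> J \<Longrightarrow> fr s u k = fr s v l \<Longrightarrow> G (\<pi> v) l = B"
  shows "(\<Union>(v, l)\<in>fr s u k. G v l) = B"
proof -
  have "G v l = B" if vl: "(v, l) \<in> fr s u k" for v l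
  proof -
    obtain v' where v': "v = \<pi> v'" "v' \<in> J" using fr_cases[OF vl] by blast
    then have "fr s u k = fr s v' l"
      using vl unfolding v' mem_frac_iff[OF assms(1,2) v'(2)] fr_eq_iff[OF assms(1,2) v'(2)] by simp
    then show ?thesis using assms(3) v' by simp
  qed
  then show ?thesis using fr_self[OF assms(1,2), of k] by auto
qed

abbreviation loc :: "'a \<Rightarrow> ('a, ('b \<times> nat) set) module" where
  "loc s \<equiv> localization R M s"

lemma carrier_loc: "carrier (loc s) = {fr s u k | u k. u \<in> J}"
  by (auto simp: localization_def fr_def pi_onto)

lemma zero_loc: "\<zero>\<^bsub>loc s\<^esub> = fr s 0 0"
  by (simp add: localization_def fr_def pi_zero)

lemma add_loc:
  assumes s: "s \<in> A" and u: "u \<in> J" and v: "v \<in> J"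
  shows "fr s u k \<oplus>\<^bsub>loc s\<^esub> fr s v l = fr s (s ^ l * u + s ^ k * v) (k + l)"
proof -
  note sk = power_closed[OF s]
  have "fr s u k \<oplus>\<^bsub>loc s\<^esub> fr s v l = (\<Union>(u', k')\<in>fr s u k. \<Union>(v', l')\<in>fr s v l.
      frac R M s (s ^ l' \<odot>\<^bsub>M\<^esub> u' \<oplus>\<^bsub>M\<^esub> s ^ k' \<odot>\<^bsub>M\<^esub> v') (k' + l'))"
    by (simp add: localization_def nat_pow_R)
  also have "\<dots> = fr s (s ^ l * u + s ^ k * v) (k + l)"
  proof (rule UN_frac[OF s u], rule UN_frac[OF s v])
    fix u' k' v' l' assume u': "u' \<in> J" "fr s u k = fr s u' k'" and v': "v' \<in> J" "fr s v l = fr s v' l'"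
    obtain t where t: "s ^ (t + k') * u - s ^ (t + k) * u' \<in> I" using u' fr_eq_iff[OF s u u'(1)] by blast
    obtain r where r: "s ^ (r + l') * v - s ^ (r + l) * v' \<in> I" using v' fr_eq_iff[OF s v v'(1)] by blast
    have in_J: "s ^ l' * u' + s ^ k' * v' \<in> J" "s ^ l * u + s ^ k * v \<in> J"
      using u v u' v' by (auto intro!: J_add J_mult sk)
    have "frac R M s (s ^ l' \<odot>\<^bsub>M\<^esub> \<pi> u' \<oplus>\<^bsub>M\<^esub> s ^ k' \<odot>\<^bsub>M\<^esub> \<pi> v') (k' + l') = fr s (s ^ l' * u' + s ^ k' * v') (k' + l')"
      using u' v' by (simp add: fr_def pi_add pi_smult J_mult sk)
    also have "\<dots> = fr s (s ^ l * u + s ^ k * v) (k + l)"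
    proof (rule sym, subst fr_eq_iff[OF s in_J(2,1)], rule exI[of _ "t + r"])
      have "s ^ (r + l' + l) * (s ^ (t + k') * u - s ^ (t + k) * u') +
          s ^ (t + k' + k) * (s ^ (r + l') * v - s ^ (r + l) * v') \<in> I"
        by (intro submod_add[OF I(1)] submod_mult[OF I(1) sk] t r)
      then show "s ^ (t + r + (k' + l')) * (s ^ l * u + s ^ k * v) -
          s ^ (t + r + (k + l)) * (s ^ l' * u' + s ^ k' * v') \<in> I"
        by (simp add: algebra_simps power_add)
    qed
    finally show "frac R M s (s ^ l' \<odot>\<^bsub>M\<^esub> \<pi> u' \<oplus>\<^bsub>M\<^esub> s ^ k' \<odot>\<^bsub>M\<^esub> \<pi> v') (k' + l') = \<dots>" .
  qed
  finally show ?thesis .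
qed

lemma add_loc_same:
  assumes s: "s \<in> A" and u: "u \<in> J" and v: "v \<in> J"
  shows "fr s u k \<oplus>\<^bsub>loc s\<^esub> fr s v k = fr s (u + v) k"
  unfolding add_loc[OF assms] fr_expand[OF s J_add[OF u v], of k k] by (simp add: distrib_left)

lemma smult_loc:
  assumes s: "s \<in> A" and a: "a \<in> A" and u: "u \<in> J"
  shows "a \<odot>\<^bsub>loc s\<^esub> fr s u k = fr s (a * u) k"
proof -
  have "a \<odot>\<^bsub>loc s\<^esub> fr s u k = (\<Union>(u', k')\<in>fr s u k. frac R M s (a \<odot>\<^bsub>M\<^esub> u') k')"
    by (simp add: localization_def)
  also have "\<dots> = fr s (a * u) k"
  proof (rule UN_frac[OF s u])
    fix v l assume v: "v \<in> J" "fr s u k = fr s v l"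
    then obtain t where t: "s ^ (t + l) * u - s ^ (t + k) * v \<in> I" using fr_eq_iff[OF s u v(1)] by blast
    have "frac R M s (a \<odot>\<^bsub>M\<^esub> \<pi> v) l = fr s (a * v) l" using a v by (simp add: fr_def pi_smult)
    also have "\<dots> = fr s (a * u) k"
      using submod_mult[OF I(1) a t] a u v
      by (intro sym[OF iffD2[OF fr_eq_iff[OF s]]] exI[of _ t]) (auto simp: algebra_simps J_mult)
    finally show "frac R M s (a \<odot>\<^bsub>M\<^esub> \<pi> v) l = fr s (a * u) k" .
  qed
  finally show ?thesis .
qed

lemma localization_map_fr:
  assumes s: "s \<in> A" and w: "w \<in> A" and u: "u \<in> J"
  shows "localization_map R M s w (fr s u k) = fr (s * w) (w ^ k * u) k"
proof -
  have "localization_map R M s w (fr s u k) = (\<Union>(u', k')\<in>fr s u k. frac R M (s * w) (w ^ k' \<odot>\<^bsub>M\<^esub> u') k')"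
    by (simp add: localization_map_def nat_pow_R)
  also have "\<dots> = fr (s * w) (w ^ k * u) k"
  proof (rule UN_frac[OF s u])
    fix v l assume v: "v \<in> J" "fr s u k = fr s v l"
    then obtain t where t: "s ^ (t + l) * u - s ^ (t + k) * v \<in> I" using fr_eq_iff[OF s u v(1)] by blast
    have "frac R M (s * w) (w ^ l \<odot>\<^bsub>M\<^esub> \<pi> v) l = fr (s * w) (w ^ l * v) l"
      using w v by (simp add: fr_def pi_smult power_closed)
    also have "\<dots> = fr (s * w) (w ^ k * u) k"
    proof (rule sym, rule iffD2[OF fr_eq_iff], goal_cases)
      case 4
      have "w ^ (t + l + k) * (s ^ (t + l) * u - s ^ (t + k) * v) \<in> I"
        by (intro submod_mult[OF I(1) power_closed[OF w]] t)
      then show ?case by (intro exI[of _ t]) (simp add: algebra_simps power_add power_mult_distrib)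
    qed (use s w u v in \<open>auto intro: J_mult power_closed mult_closed\<close>)
    finally show "frac R M (s * w) (w ^ l \<odot>\<^bsub>M\<^esub> \<pi> v) l = fr (s * w) (w ^ k * u) k" .
  qed
  finally show ?thesis .
qed

lemma abelian_monoid_loc:
  assumes s: "s \<in> A"
  shows "abelian_monoid (loc s)"
proof -
  note sk = power_closed[OF s]
  have cl: "s ^ l * u + s ^ k * v \<in> J" if "u \<in> J" "v \<in> J" for u v k l
    using that by (auto intro!: J_add J_mult sk)
  show ?thesis
  proof (rule abelian_monoidI)
    fix x z assume "x \<in> carrier (loc s)" "z \<in> carrier (loc s)"
    then obtain u k v l where u: "x = fr s u k" "u \<in> J" and v: "z = fr s v l" "v \<in> J"
      by (auto simp: carrier_loc)
    show "x \<oplus>\<^bsub>loc s\<^esub> z \<in> carrier (loc s)"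
      unfolding u(1) v(1) add_loc[OF s u(2) v(2)] carrier_loc using cl[OF u(2) v(2)] by blast
    show "x \<oplus>\<^bsub>loc s\<^esub> z = z \<oplus>\<^bsub>loc s\<^esub> x"
      unfolding u(1) v(1) add_loc[OF s u(2) v(2)] add_loc[OF s v(2) u(2)] by (simp add: add.commute)
  next
    show "\<zero>\<^bsub>loc s\<^esub> \<in> carrier (loc s)" unfolding zero_loc carrier_loc using submod_0[OF J] by blast
  next
    fix x z w assume "x \<in> carrier (loc s)" "z \<in> carrier (loc s)" "w \<in> carrier (loc s)"
    then obtain u k v l r q where u: "x = fr s u k" "u \<in> J" and v: "z = fr s v l" "v \<in> J"
      and r: "w = fr s r q" "r \<in> J"
      by (auto simp: carrier_loc)
    show "(x \<oplus>\<^bsub>loc s\<^esub> z) \<oplus>\<^bsub>loc s\<^esub> w = x \<oplus>\<^bsub>loc s\<^esub> (z \<oplus>\<^bsub>loc s\<^esub> w)"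
      unfolding u(1) v(1) r(1) add_loc[OF s u(2) v(2)] add_loc[OF s v(2) r(2)]
        add_loc[OF s cl[OF u(2) v(2)] r(2)] add_loc[OF s u(2) cl[OF v(2) r(2)]]
      by (simp add: algebra_simps power_add)
  next
    fix x assume "x \<in> carrier (loc s)"
    then obtain u k where u: "x = fr s u k" "u \<in> J" by (auto simp: carrier_loc)
    show "\<zero>\<^bsub>loc s\<^esub> \<oplus>\<^bsub>loc s\<^esub> x = x"
      unfolding u(1) zero_loc add_loc[OF s submod_0[OF J] u(2)] by simp
  qed
qed

lemma finsum_loc:
  assumes s: "s \<in> A" and g: "\<And>j. j \<in> B \<Longrightarrow> g j \<in> J" and "finite B"
  shows "(\<Oplus>\<^bsub>loc s\<^esub>j\<in>B. fr s (g j) k) = fr s (\<Sum>j\<in>B. g j) k"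
  using \<open>finite B\<close> g
proof (induction B rule: finite_induct)
  interpret abelian_monoid "loc s" by (rule abelian_monoid_loc[OF s])
  {
    case empty
    have "fr s 0 0 = fr s 0 k"
      using fr_expand[OF s submod_0[OF J], of 0 k] by simp
    then show ?case by (simp add: zero_loc)
  next
    case (insert i B)
    have "(\<Oplus>\<^bsub>loc s\<^esub>j\<in>insert i B. fr s (g j) k) = fr s (g i) k \<oplus>\<^bsub>loc s\<^esub> (\<Oplus>\<^bsub>loc s\<^esub>j\<in>B. fr s (g j) k)"
      by (rule finsum_insert) (use insert in \<open>auto simp: carrier_loc\<close>)
    also have "\<dots> = fr s (g i) k \<oplus>\<^bsub>loc s\<^esub> fr s (\<Sum>j\<in>B. g j) k"
      using insert by simp
    also have "\<dots> = fr s (\<Sum>j\<in>insert i B. g j) k"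
      using insert by (subst add_loc_same[OF s]) (auto intro: submod_sum[OF J])
    finally show ?case .
  }
qed

text \<open>The \v{C}ech cochain with components \<open>u \<sigma> / (\<Prod>j\<in>\<sigma>. y j) ^ k\<close>.\<close>

definition cochain :: "nat \<Rightarrow> (nat set \<Rightarrow> 'a) \<Rightarrow> nat \<Rightarrow> nat set \<Rightarrow> ('b \<times> nat) set" where
  "cochain p u k = (\<lambda>\<sigma>\<in>cech_index n p. fr (\<Prod>j\<in>\<sigma>. y j) (u \<sigma>) k)"

lemma cech_loc_eq: "\<sigma> \<in> cech_index n p \<Longrightarrow> cech_loc R y M \<sigma> = loc (\<Prod>j\<in>\<sigma>. y j)"
  unfolding cech_loc_def by (subst finprod_R[OF cech_index_subset]) auto

lemma index_prod_closed: "\<sigma> \<in> cech_index n p \<Longrightarrow> (\<Prod>j\<in>\<sigma>. y j) \<in> A"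
  by (intro prod_seq_closed cech_index_subset)

abbreviation cochains :: "nat \<Rightarrow> ('a, nat set \<Rightarrow> ('b \<times> nat) set) module" where
  "cochains p \<equiv> cech_cochains R n y M p"

lemma cochain_eq_iff:
  assumes "\<And>\<sigma>. \<sigma> \<in> cech_index n p \<Longrightarrow> u \<sigma> \<in> J" "\<And>\<sigma>. \<sigma> \<in> cech_index n p \<Longrightarrow> v \<sigma> \<in> J"
  shows "cochain p u k = cochain p v l \<longleftrightarrow> (\<forall>\<sigma>\<in>cech_index n p. \<exists>t.
    (\<Prod>j\<in>\<sigma>. y j) ^ (t + l) * u \<sigma> - (\<Prod>j\<in>\<sigma>. y j) ^ (t + k) * v \<sigma> \<in> I)"
proof -
  have "cochain p u k = cochain p v l \<longleftrightarrow>
      (\<forall>\<sigma>\<in>cech_index n p. fr (\<Prod>j\<in>\<sigma>. y j) (u \<sigma>) k = fr (\<Prod>j\<in>\<sigma>. y j) (v \<sigma>) l)"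
    by (auto simp: cochain_def fun_eq_iff restrict_def)
  then show ?thesis using assms by (simp add: fr_eq_iff index_prod_closed)
qed

lemma carrier_cochains:
  "carrier (cochains p) = {cochain p u k | u k. \<forall>\<sigma>. u \<sigma> \<in> J}"
proof (intro equalityI subsetI)
  fix c assume "c \<in> carrier (cochains p)"
  then have c: "c \<in> (\<Pi>\<^sub>E \<sigma>\<in>cech_index n p. carrier (loc (\<Prod>j\<in>\<sigma>. y j)))"
    by (simp add: cech_cochains_def cech_loc_eq cong: PiE_cong)
  have "\<forall>\<sigma>. \<exists>u k. u \<in> J \<and> (\<sigma> \<in> cech_index n p \<longrightarrow> c \<sigma> = fr (\<Prod>j\<in>\<sigma>. y j) u k)"
    using c submod_0[OF J] by (fastforce simp: carrier_loc PiE_iff)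
  then obtain u k where uk: "\<And>\<sigma>. u \<sigma> \<in> J"
    "\<And>\<sigma>. \<sigma> \<in> cech_index n p \<Longrightarrow> c \<sigma> = fr (\<Prod>j\<in>\<sigma>. y j) (u \<sigma>) (k \<sigma>)" by metis
  define K where "K = (\<Sum>\<sigma>\<in>cech_index n p. k \<sigma>)"
  define u' where "u' \<sigma> = (if \<sigma> \<in> cech_index n p then (\<Prod>j\<in>\<sigma>. y j) ^ (K - k \<sigma>) * u \<sigma> else 0)" for \<sigma>
  have "u' \<sigma> \<in> J" for \<sigma>
    by (auto simp: u'_def submod_0[OF J] intro!: J_mult power_closed index_prod_closed uk(1))
  moreover have "c = cochain p u' K"
  proof
    fix \<sigma>
    show "c \<sigma> = cochain p u' K \<sigma>"
    proof (cases "\<sigma> \<in> cech_index n p")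
      case True
      have "k \<sigma> \<le> K" unfolding K_def by (rule member_le_sum) (use True in auto)
      then show ?thesis
        using fr_expand[OF index_prod_closed[OF True] uk(1), of \<sigma> "k \<sigma>" "K - k \<sigma>"] uk(2)[OF True] True
        by (simp add: cochain_def u'_def)
    next
      case False then show ?thesis by (simp add: cochain_def PiE_arb[OF c False])
    qed
  qed
  ultimately show "c \<in> {cochain p u k | u k. \<forall>\<sigma>. u \<sigma> \<in> J}"
    by (intro CollectI exI[of _ u'] exI[of _ K]) simp
next
  fix c assume "c \<in> {cochain p u k | u k. \<forall>\<sigma>. u \<sigma> \<in> J}"
  then show "c \<in> carrier (cochains p)"
    by (auto simp: cech_cochains_def cochain_def cech_loc_eq carrier_loc) blast
qed

lemma zero_cochains: "\<zero>\<^bsub>cochains p\<^esub> = cochain p (\<lambda>_. 0) 0"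
  by (auto simp: cech_cochains_def cochain_def cech_loc_eq zero_loc intro!: restrict_ext)

lemma add_cochains:
  assumes "\<And>\<sigma>. \<sigma> \<in> cech_index n p \<Longrightarrow> u \<sigma> \<in> J" "\<And>\<sigma>. \<sigma> \<in> cech_index n p \<Longrightarrow> v \<sigma> \<in> J"
  shows "cochain p u k \<oplus>\<^bsub>cochains p\<^esub> cochain p v k = cochain p (\<lambda>\<sigma>. u \<sigma> + v \<sigma>) k"
  by (auto simp: cech_cochains_def cochain_def cech_loc_eq add_loc_same index_prod_closed assms
      intro!: restrict_ext)

lemma cochain_expand:
  assumes "\<And>\<sigma>. \<sigma> \<in> cech_index n p \<Longrightarrow> u \<sigma> \<in> J"
  shows "cochain p u k = cochain p (\<lambda>\<sigma>. (\<Prod>j\<in>\<sigma>. y j) ^ t * u \<sigma>) (k + t)"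
  unfolding cochain_def by (intro restrict_ext fr_expand index_prod_closed assms)

lemma diff_closed:
  assumes "\<And>\<sigma>. u \<sigma> \<in> J" "\<sigma> \<subseteq> {1..n}"
  shows "koszul_diff y s u \<sigma> \<in> J"
  by (rule koszul_diff_closed[OF J assms(2)]) (rule assms(1))

lemma cech_diff_cochain:
  assumes u: "\<And>\<sigma>. u \<sigma> \<in> J"
  shows "cech_diff R n y M p (cochain p u k) = cochain (Suc p) (koszul_diff y (\<lambda>_. k) u) k"
  unfolding cech_diff_def cochain_def
proof (rule restrict_ext)
  fix \<tau> assume \<tau>: "\<tau> \<in> cech_index n (Suc p)"
  let ?t = "\<Prod>j\<in>\<tau>. y j"
  interpret abelian_monoid "loc ?t" by (rule abelian_monoid_loc[OF index_prod_closed[OF \<tau>]])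
  define g where "g j = koszul_sign j \<tau> * y j ^ k * u (\<tau> - {j})" for j
  have yj: "y j \<in> A" if "j \<in> \<tau>" for j using cech_index_subset[OF \<tau>] that by (intro seq_closed) blast
  have g: "g j \<in> J" if "j \<in> \<tau>" for j
    unfolding g_def by (intro J_mult mult_closed sign_closed power_closed yj that u)
  have eq: "((\<ominus>\<^bsub>R\<^esub> \<one>\<^bsub>R\<^esub>) [^]\<^bsub>R\<^esub> card {i\<in>\<tau>. i < j}) \<odot>\<^bsub>loc ?t\<^esub>
      localization_map R M (\<Otimes>\<^bsub>R\<^esub>i\<in>\<tau> - {j}. y i) (y j)
        ((\<lambda>\<sigma>\<in>cech_index n p. fr (\<Prod>j\<in>\<sigma>. y j) (u \<sigma>) k) (\<tau> - {j})) = fr ?t (g j) k"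
    if j: "j \<in> \<tau>" for j
  proof -
    note \<sigma> = cech_index_remove[OF \<tau> j]
    have prod: "(\<Prod>i\<in>\<tau> - {j}. y i) * y j = ?t"
      using cech_index_finite[OF \<tau>] j by (simp add: prod.remove mult.commute)
    have "localization_map R M (\<Prod>i\<in>\<tau> - {j}. y i) (y j) (fr (\<Prod>i\<in>\<tau> - {j}. y i) (u (\<tau> - {j})) k) =
        fr ?t (y j ^ k * u (\<tau> - {j})) k"
      using localization_map_fr[OF index_prod_closed[OF \<sigma>] yj[OF j] u, of "\<tau> - {j}" k] by (simp only: prod)
    moreover have "koszul_sign j \<tau> \<odot>\<^bsub>loc ?t\<^esub> fr ?t (y j ^ k * u (\<tau> - {j})) k = fr ?t (g j) k"
      unfolding g_def
      by (subst smult_loc) (auto simp: mult.assoc intro: index_prod_closed[OF \<tau>] sign_closed J_mult power_closed yj j u)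
    ultimately show ?thesis
      using \<sigma> unfolding minus_one_R nat_pow_R finprod_R[OF cech_index_subset[OF \<sigma>]] koszul_sign_def
      by simp
  qed
  have "(\<Oplus>\<^bsub>cech_loc R y M \<tau>\<^esub>j\<in>\<tau>. ((\<ominus>\<^bsub>R\<^esub> \<one>\<^bsub>R\<^esub>) [^]\<^bsub>R\<^esub> card {i\<in>\<tau>. i < j}) \<odot>\<^bsub>cech_loc R y M \<tau>\<^esub>
      localization_map R M (\<Otimes>\<^bsub>R\<^esub>i\<in>\<tau> - {j}. y i) (y j)
        ((\<lambda>\<sigma>\<in>cech_index n p. fr (\<Prod>j\<in>\<sigma>. y j) (u \<sigma>) k) (\<tau> - {j}))) =
      (\<Oplus>\<^bsub>loc ?t\<^esub>j\<in>\<tau>. fr ?t (g j) k)"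
    unfolding cech_loc_eq[OF \<tau>]
    by (rule finsum_cong') (use eq g in \<open>auto simp: carrier_loc\<close>)
  also have "\<dots> = fr ?t (koszul_diff y (\<lambda>_. k) u \<tau>) k"
    unfolding koszul_diff_def
    by (subst finsum_loc[OF index_prod_closed[OF \<tau>] g cech_index_finite[OF \<tau>]]) (simp_all add: g_def)
  finally show "(\<Oplus>\<^bsub>cech_loc R y M \<tau>\<^esub>j\<in>\<tau>. ((\<ominus>\<^bsub>R\<^esub> \<one>\<^bsub>R\<^esub>) [^]\<^bsub>R\<^esub> card {i\<in>\<tau>. i < j}) \<odot>\<^bsub>cech_loc R y M \<tau>\<^esub>
      localization_map R M (\<Otimes>\<^bsub>R\<^esub>i\<in>\<tau> - {j}. y i) (y j)
        ((\<lambda>\<sigma>\<in>cech_index n p. fr (\<Prod>j\<in>\<sigma>. y j) (u \<sigma>) k) (\<tau> - {j}))) =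
      fr ?t (koszul_diff y (\<lambda>_. k) u \<tau>) k" .
qed

text \<open>Numerators after the denominators have been multiplied by \<open>(\<Prod>j\<in>\<sigma>. y j) ^ t\<close>.  The value \<open>0\<close> at the
  sets that do not occur as indices ensures that all values lie in \<open>J\<close>.\<close>

definition shift :: "nat \<Rightarrow> (nat set \<Rightarrow> 'a) \<Rightarrow> nat set \<Rightarrow> 'a" where
  "shift t u \<sigma> = (if \<sigma> \<subseteq> {1..n} then (\<Prod>j\<in>\<sigma>. y j) ^ t * u \<sigma> else 0)"

lemma shift_closed: "(\<And>\<sigma>. u \<sigma> \<in> J) \<Longrightarrow> shift t u \<sigma> \<in> J"
  by (simp add: shift_def submod_0[OF J] J_mult power_closed prod_seq_closed)

lemma shift_index: "\<sigma> \<in> cech_index n p \<Longrightarrow> shift t u \<sigma> = (\<Prod>j\<in>\<sigma>. y j) ^ t * u \<sigma>"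
  by (simp add: shift_def cech_index_def)

lemma koszul_diff_const_shift:
  assumes "\<sigma> \<in> cech_index n p"
  shows "koszul_diff y (\<lambda>_. k + t) (shift t u) \<sigma> = (\<Prod>j\<in>\<sigma>. y j) ^ t * koszul_diff y (\<lambda>_. k) u \<sigma>"
proof -
  have "koszul_diff y (\<lambda>_. k + t) (shift t u) \<sigma> =
      koszul_diff y (\<lambda>_. k + t) (\<lambda>\<sigma>. (\<Prod>j\<in>\<sigma>. y j ^ t) * u \<sigma>) \<sigma>"
    using cech_index_subset[OF assms]
    by (intro koszul_diff_cong) (auto simp: shift_def prod_power_distrib)
  then show ?thesis
    using koszul_diff_shift[OF cech_index_finite[OF assms], of y "\<lambda>_. k" "\<lambda>_. t" u]
    by (simp add: prod_power_distrib)
qed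

lemma index_diff_closed: "(\<And>\<sigma>. u \<sigma> \<in> J) \<Longrightarrow> \<sigma> \<in> cech_index n p \<Longrightarrow> koszul_diff y s u \<sigma> \<in> J"
  by (rule diff_closed[OF _ cech_index_subset])

lemma cocycle_iff:
  assumes u: "\<And>\<sigma>. u \<sigma> \<in> J"
  shows "cochain p u k \<in> cech_cocycles R n y M p \<longleftrightarrow>
    (\<forall>\<tau>\<in>cech_index n (Suc p). \<exists>t. (\<Prod>j\<in>\<tau>. y j) ^ t * koszul_diff y (\<lambda>_. k) u \<tau> \<in> I)"
proof -
  have "cochain p u k \<in> carrier (cochains p)" using u by (auto simp: carrier_cochains)
  then have "cochain p u k \<in> cech_cocycles R n y M p \<longleftrightarrow>
      cochain (Suc p) (koszul_diff y (\<lambda>_. k) u) k = cochain (Suc p) (\<lambda>_. 0) 0"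
    by (simp add: cech_cocycles_def cech_diff_cochain[OF u] zero_cochains)
  also have "\<dots> \<longleftrightarrow> (\<forall>\<tau>\<in>cech_index n (Suc p). \<exists>t. (\<Prod>j\<in>\<tau>. y j) ^ t * koszul_diff y (\<lambda>_. k) u \<tau> \<in> I)"
    by (subst cochain_eq_iff) (auto simp: submod_0[OF J] index_diff_closed[of u] u)
  finally show ?thesis .
qed

lemma coboundaries_eq:
  "cech_coboundaries R n y M p = {cochain p (koszul_diff y (\<lambda>_. k) w) k | w k. \<forall>\<sigma>. w \<sigma> \<in> J}"
proof (cases p)
  case 0
  have "cochain 0 (koszul_diff y (\<lambda>_. k) w) k = cochain 0 (\<lambda>_. 0) 0" for w k
    by (subst cochain_eq_iff) (auto simp: cech_index_0 submod_0[OF J] submod_0[OF I(1)])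
  then show ?thesis using 0 submod_0[OF J] by (auto simp: zero_cochains)
next
  case (Suc q)
  then have "cech_coboundaries R n y M p =
      {cech_diff R n y M q (cochain q w k) | w k. \<forall>\<sigma>. w \<sigma> \<in> J}"
    by (auto simp: carrier_cochains)
  also have "\<dots> = {cochain p (koszul_diff y (\<lambda>_. k) w) k | w k. \<forall>\<sigma>. w \<sigma> \<in> J}"
    using cech_diff_cochain Suc by (intro Collect_cong) metis
  finally show ?thesis .
qed

lemma coboundary_expand:
  assumes w: "\<And>\<sigma>. w \<sigma> \<in> J"
  shows "cochain p (koszul_diff y (\<lambda>_. k) w) k =
    cochain p (koszul_diff y (\<lambda>_. k + t) (shift t w)) (k + t)"
proof -
  have "cochain p (koszul_diff y (\<lambda>_. k) w) k =
      cochain p (\<lambda>\<sigma>. (\<Prod>j\<in>\<sigma>. y j) ^ t * koszul_diff y (\<lambda>_. k) w \<sigma>) (k + t)"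
    by (rule cochain_expand) (rule index_diff_closed[OF w])
  also have "\<dots> = cochain p (koszul_diff y (\<lambda>_. k + t) (shift t w)) (k + t)"
    by (auto simp: cochain_def koszul_diff_const_shift intro!: restrict_ext)
  finally show ?thesis .
qed

lemma coboundary_iff:
  assumes u: "\<And>\<sigma>. u \<sigma> \<in> J"
  shows "cochain p u k \<in> cech_coboundaries R n y M p \<longleftrightarrow>
    (\<exists>w e. (\<forall>\<sigma>. w \<sigma> \<in> J) \<and> (\<forall>\<sigma>\<in>cech_index n p. \<exists>t.
      (\<Prod>j\<in>\<sigma>. y j) ^ (t + e) * u \<sigma> - (\<Prod>j\<in>\<sigma>. y j) ^ (t + k) * koszul_diff y (\<lambda>_. e) w \<sigma> \<in> I))"
proof -
  have *: "cochain p u k = cochain p (koszul_diff y (\<lambda>_. e) w) e \<longleftrightarrow> (\<forall>\<sigma>\<in>cech_index n p. \<exists>t.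
      (\<Prod>j\<in>\<sigma>. y j) ^ (t + e) * u \<sigma> - (\<Prod>j\<in>\<sigma>. y j) ^ (t + k) * koszul_diff y (\<lambda>_. e) w \<sigma> \<in> I)"
    if "\<forall>\<sigma>. w \<sigma> \<in> J" for w e
    by (rule cochain_eq_iff) (use u that index_diff_closed[of w] in auto)
  show ?thesis
    unfolding coboundaries_eq mem_Collect_eq
  proof (intro iffI; elim exE conjE)
    fix w e assume "cochain p u k = cochain p (koszul_diff y (\<lambda>_. e) w) e" "\<forall>\<sigma>. w \<sigma> \<in> J"
    then show "\<exists>w e. (\<forall>\<sigma>. w \<sigma> \<in> J) \<and> (\<forall>\<sigma>\<in>cech_index n p. \<exists>t.
      (\<Prod>j\<in>\<sigma>. y j) ^ (t + e) * u \<sigma> - (\<Prod>j\<in>\<sigma>. y j) ^ (t + k) * koszul_diff y (\<lambda>_. e) w \<sigma> \<in> I)"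
      using *[of w e] by (intro exI[of _ w] exI[of _ e]) simp
  next
    fix w e assume w: "\<forall>\<sigma>. w \<sigma> \<in> J" "\<forall>\<sigma>\<in>cech_index n p. \<exists>t.
      (\<Prod>j\<in>\<sigma>. y j) ^ (t + e) * u \<sigma> - (\<Prod>j\<in>\<sigma>. y j) ^ (t + k) * koszul_diff y (\<lambda>_. e) w \<sigma> \<in> I"
    then show "\<exists>w e. cochain p u k = cochain p (koszul_diff y (\<lambda>_. e) w) e \<and> (\<forall>\<sigma>. w \<sigma> \<in> J)"
      using *[of w e] by (intro exI[of _ w] exI[of _ e]) simp
  qed
qed

lemma uniform_exponent:
  assumes "\<And>\<tau>. \<tau> \<in> cech_index n p \<Longrightarrow> \<exists>t. (\<Prod>j\<in>\<tau>. y j) ^ t * c \<tau> \<in> I"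
  shows "\<exists>t. \<forall>\<tau>\<in>cech_index n p. (\<Prod>j\<in>\<tau>. y j) ^ t * c \<tau> \<in> I"
proof -
  obtain t where t: "\<And>\<tau>. \<tau> \<in> cech_index n p \<Longrightarrow> (\<Prod>j\<in>\<tau>. y j) ^ t \<tau> * c \<tau> \<in> I" using assms by metis
  define T where "T = (\<Sum>\<tau>\<in>cech_index n p. t \<tau>)"
  have "(\<Prod>j\<in>\<tau>. y j) ^ T * c \<tau> \<in> I" if \<tau>: "\<tau> \<in> cech_index n p" for \<tau>
  proof -
    have "t \<tau> \<le> T" unfolding T_def by (rule member_le_sum) (use \<tau> in auto)
    then have "(\<Prod>j\<in>\<tau>. y j) ^ T * c \<tau> = (\<Prod>j\<in>\<tau>. y j) ^ (T - t \<tau>) * ((\<Prod>j\<in>\<tau>. y j) ^ t \<tau> * c \<tau>)"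
      by (simp add: mult.assoc[symmetric] power_add[symmetric])
    then show ?thesis
      using submod_mult[OF I(1) power_closed[OF index_prod_closed[OF \<tau>]] t[OF \<tau>]] by simp
  qed
  then show ?thesis by blast
qed

text \<open>
  Clearing denominators: with a common denominator the \v{C}ech differential is the Koszul differential
  of the numerators, and equations between fractions hold for the numerators after multiplication by a
  further power.
\<close>

lemma cocycles_subset_coboundaries_iff:
  "cech_cocycles R n y M p \<subseteq> cech_coboundaries R n y M p \<longleftrightarrow> cech_exact J I p"
proof
  assume sub: "cech_cocycles R n y M p \<subseteq> cech_coboundaries R n y M p"
  show "cech_exact J I p"
    unfolding cech_exact_def
  proof (intro allI impI)
    fix t z assume z: "\<forall>\<sigma>. z \<sigma> \<in> J" "\<forall>\<tau>\<in>cech_index n (Suc p). koszul_diff y (\<lambda>_. t) z \<tau> \<in> I"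
    have "cochain p z t \<in> cech_cocycles R n y M p"
    proof (subst cocycle_iff)
      show "\<forall>\<tau>\<in>cech_index n (Suc p). \<exists>r. (\<Prod>j\<in>\<tau>. y j) ^ r * koszul_diff y (\<lambda>_. t) z \<tau> \<in> I"
        using z(2) by (intro ballI exI[of _ 0]) simp
    qed (use z in auto)
    then have "cochain p z t \<in> cech_coboundaries R n y M p" using sub by blast
    then obtain w e where w: "\<forall>\<sigma>. w \<sigma> \<in> J" and ex: "\<forall>\<sigma>\<in>cech_index n p. \<exists>r.
        (\<Prod>j\<in>\<sigma>. y j) ^ (r + e) * z \<sigma> - (\<Prod>j\<in>\<sigma>. y j) ^ (r + t) * koszul_diff y (\<lambda>_. e) w \<sigma> \<in> I"
      using coboundary_iff[of z p t] z(1) by auto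
    define c where "c \<sigma> = (\<Prod>j\<in>\<sigma>. y j) ^ e * z \<sigma> - (\<Prod>j\<in>\<sigma>. y j) ^ t * koszul_diff y (\<lambda>_. e) w \<sigma>" for \<sigma>
    have "\<exists>r. (\<Prod>j\<in>\<sigma>. y j) ^ r * c \<sigma> \<in> I" if "\<sigma> \<in> cech_index n p" for \<sigma>
      using ex[rule_format, OF that] by (simp add: c_def right_diff_distrib mult.assoc[symmetric] power_add)
    then obtain r where r: "\<And>\<sigma>. \<sigma> \<in> cech_index n p \<Longrightarrow> (\<Prod>j\<in>\<sigma>. y j) ^ r * c \<sigma> \<in> I"
      using uniform_exponent[of p c] by blast
    have "(\<Prod>j\<in>\<sigma>. y j ^ (r + e)) * z \<sigma> - koszul_diff y (\<lambda>_. t + (r + e)) (shift (r + t) w) \<sigma> \<in> I"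
      if \<sigma>: "\<sigma> \<in> cech_index n p" for \<sigma>
    proof -
      have "koszul_diff y (\<lambda>_. t + (r + e)) (shift (r + t) w) \<sigma> =
          (\<Prod>j\<in>\<sigma>. y j) ^ (r + t) * koszul_diff y (\<lambda>_. e) w \<sigma>"
        using koszul_diff_const_shift[OF \<sigma>, of e "r + t" w] by (simp add: add.commute add.left_commute)
      moreover have "(\<Prod>j\<in>\<sigma>. y j ^ (r + e)) = (\<Prod>j\<in>\<sigma>. y j) ^ r * (\<Prod>j\<in>\<sigma>. y j) ^ e"
        by (simp only: prod_power_distrib power_add prod.distrib)
      ultimately show ?thesis
        using r[OF \<sigma>] by (simp add: c_def power_add right_diff_distrib mult.assoc)
    qed
    moreover have "shift (r + t) w \<sigma> \<in> J" for \<sigma> using w by (intro shift_closed) auto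
    ultimately show "\<exists>e w. (\<forall>\<sigma>. w \<sigma> \<in> J) \<and> (\<forall>\<sigma>\<in>cech_index n p.
        (\<Prod>i\<in>\<sigma>. y i ^ e) * z \<sigma> - koszul_diff y (\<lambda>_. t + e) w \<sigma> \<in> I)"
      by (intro exI[of _ "r + e"] exI[of _ "shift (r + t) w"]) simp
  qed
next
  assume ex: "cech_exact J I p"
  show "cech_cocycles R n y M p \<subseteq> cech_coboundaries R n y M p"
  proof
    fix c assume c: "c \<in> cech_cocycles R n y M p"
    then have "c \<in> carrier (cochains p)" by (simp add: cech_cocycles_def)
    then obtain u k where u: "c = cochain p u k" "\<And>\<sigma>. u \<sigma> \<in> J" by (auto simp: carrier_cochains)
    obtain t where t: "\<And>\<tau>. \<tau> \<in> cech_index n (Suc p) \<Longrightarrow>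
        (\<Prod>j\<in>\<tau>. y j) ^ t * koszul_diff y (\<lambda>_. k) u \<tau> \<in> I"
      using uniform_exponent[of "Suc p" "koszul_diff y (\<lambda>_. k) u"] c u by (auto simp: cocycle_iff)
    obtain e w where w: "\<And>\<sigma>. w \<sigma> \<in> J" "\<And>\<sigma>. \<sigma> \<in> cech_index n p \<Longrightarrow>
        (\<Prod>i\<in>\<sigma>. y i ^ e) * shift t u \<sigma> - koszul_diff y (\<lambda>_. k + t + e) w \<sigma> \<in> I"
      by (rule cech_exactD[OF ex, of "shift t u" "k + t"])
        (use t u shift_closed in \<open>auto simp: koszul_diff_const_shift\<close>)
    have "(\<Prod>j\<in>\<sigma>. y j) ^ (0 + (k + t + e)) * u \<sigma> -
        (\<Prod>j\<in>\<sigma>. y j) ^ (0 + k) * koszul_diff y (\<lambda>_. k + t + e) w \<sigma> \<in> I" if \<sigma>: "\<sigma> \<in> cech_index n p" for \<sigma>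
    proof -
      have "(\<Prod>j\<in>\<sigma>. y j) ^ k * ((\<Prod>i\<in>\<sigma>. y i ^ e) * shift t u \<sigma> - koszul_diff y (\<lambda>_. k + t + e) w \<sigma>) \<in> I"
        by (rule submod_mult[OF I(1) power_closed[OF index_prod_closed[OF \<sigma>]] w(2)[OF \<sigma>]])
      then show ?thesis
        by (simp add: shift_index[OF \<sigma>] prod_power_distrib[symmetric] power_add right_diff_distrib ac_simps)
    qed
    then show "c \<in> cech_coboundaries R n y M p"
      unfolding u(1) coboundary_iff[OF u(2)] using w(1) by blast
  qed
qed

lemma coboundaries_translate:
  assumes "c \<in> cech_coboundaries R n y M p"
  shows "(\<lambda>b. b \<oplus>\<^bsub>cochains p\<^esub> c) ` cech_coboundaries R n y M p = cech_coboundaries R n y M p"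
proof -
  obtain w k where c: "c = cochain p (koszul_diff y (\<lambda>_. k) w) k" "\<And>\<sigma>. w \<sigma> \<in> J"
    using assms unfolding coboundaries_eq by blast
  have common: "\<exists>v w' l. (\<forall>\<sigma>. v \<sigma> \<in> J) \<and> (\<forall>\<sigma>. w' \<sigma> \<in> J) \<and> c = cochain p (koszul_diff y (\<lambda>_. l) w') l \<and>
      b = cochain p (koszul_diff y (\<lambda>_. l) v) l" if "b \<in> cech_coboundaries R n y M p" for b
  proof -
    obtain v l where b: "b = cochain p (koszul_diff y (\<lambda>_. l) v) l" "\<And>\<sigma>. v \<sigma> \<in> J"
      using \<open>b \<in> _\<close> unfolding coboundaries_eq by blast
    show ?thesis
      using coboundary_expand[of w p k l, OF c(2)] coboundary_expand[of v p l k, OF b(2)] b c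
        shift_closed[of w l] shift_closed[of v k]
      by (intro exI[of _ "shift k v"] exI[of _ "shift l w"] exI[of _ "k + l"]) (simp add: add.commute)
  qed
  have add: "cochain p (koszul_diff y (\<lambda>_. l) v) l \<oplus>\<^bsub>cochains p\<^esub> cochain p (koszul_diff y (\<lambda>_. l) w) l =
      cochain p (koszul_diff y (\<lambda>_. l) (\<lambda>\<sigma>. v \<sigma> + w \<sigma>)) l"
    if "\<And>\<sigma>. v \<sigma> \<in> J" "\<And>\<sigma>. w \<sigma> \<in> J" for v w l
    using that by (subst add_cochains) (auto simp: index_diff_closed koszul_diff_add cochain_def)
  show ?thesis
  proof (intro equalityI subsetI)
    fix x assume "x \<in> (\<lambda>b. b \<oplus>\<^bsub>cochains p\<^esub> c) ` cech_coboundaries R n y M p"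
    then obtain b where b: "b \<in> cech_coboundaries R n y M p" "x = b \<oplus>\<^bsub>cochains p\<^esub> c" by blast
    obtain v w' l where v: "\<And>\<sigma>. v \<sigma> \<in> J" "\<And>\<sigma>. w' \<sigma> \<in> J" "c = cochain p (koszul_diff y (\<lambda>_. l) w') l"
      "b = cochain p (koszul_diff y (\<lambda>_. l) v) l" using common[OF b(1)] by blast
    have "x = cochain p (koszul_diff y (\<lambda>_. l) (\<lambda>\<sigma>. v \<sigma> + w' \<sigma>)) l"
      unfolding b(2) v(3,4) by (rule add[OF v(1,2)])
    then show "x \<in> cech_coboundaries R n y M p"
      unfolding coboundaries_eq using v(1,2) J_add by (intro CollectI exI conjI allI) auto
  next
    fix b assume "b \<in> cech_coboundaries R n y M p"
    then obtain v w' l where v: "\<And>\<sigma>. v \<sigma> \<in> J" "\<And>\<sigma>. w' \<sigma> \<in> J" "c = cochain p (koszul_diff y (\<lambda>_. l) w') l"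
      "b = cochain p (koszul_diff y (\<lambda>_. l) v) l" using common by blast
    have d: "v \<sigma> - w' \<sigma> \<in> J" for \<sigma> by (rule submod_diff[OF J v(1,2)])
    have "b = cochain p (koszul_diff y (\<lambda>_. l) (\<lambda>\<sigma>. v \<sigma> - w' \<sigma>)) l \<oplus>\<^bsub>cochains p\<^esub> c"
      unfolding v(3,4) by (subst add) (use d v(2) in auto)
    moreover have "cochain p (koszul_diff y (\<lambda>_. l) (\<lambda>\<sigma>. v \<sigma> - w' \<sigma>)) l \<in> cech_coboundaries R n y M p"
      unfolding coboundaries_eq using d by (intro CollectI exI conjI allI) auto
    ultimately show "b \<in> (\<lambda>b. b \<oplus>\<^bsub>cochains p\<^esub> c) ` cech_coboundaries R n y M p" by blast
  qed
qed

theorem local_cohomology_zero_iff: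
  "carrier (local_cohomology R n y M p) = {\<zero>\<^bsub>local_cohomology R n y M p\<^esub>} \<longleftrightarrow> cech_exact J I p"
proof -
  let ?Z = "cech_cocycles R n y M p" and ?B = "cech_coboundaries R n y M p"
  have carrier: "carrier (local_cohomology R n y M p) = (\<lambda>c. (\<lambda>b. b \<oplus>\<^bsub>cochains p\<^esub> c) ` ?B) ` ?Z"
    by (auto simp: local_cohomology_def quotient_module_def A_RCOSETS_def RCOSETS_def r_coset_def)
  have zero: "\<zero>\<^bsub>local_cohomology R n y M p\<^esub> = ?B"
    by (simp add: local_cohomology_def quotient_module_def)
  have zero_Z: "cochain p (\<lambda>_. 0) 0 \<in> ?Z"
    using submod_0[OF J] submod_0[OF I(1)] by (subst cocycle_iff) (auto simp: koszul_diff_def)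
  have zero_B: "cochain p (\<lambda>_. 0) 0 \<in> ?B"
    using submod_0[OF J] submod_0[OF I(1)]
    by (subst coboundary_iff) (auto simp: koszul_diff_def intro!: exI[of _ "\<lambda>_. 0"])
  have "carrier (local_cohomology R n y M p) = {\<zero>\<^bsub>local_cohomology R n y M p\<^esub>} \<longleftrightarrow> ?Z \<subseteq> ?B"
    unfolding carrier zero
  proof
    assume eq: "(\<lambda>c. (\<lambda>b. b \<oplus>\<^bsub>cochains p\<^esub> c) ` ?B) ` ?Z = {?B}"
    show "?Z \<subseteq> ?B"
    proof
      fix c assume c: "c \<in> ?Z"
      then obtain u k where u: "c = cochain p u k" "\<And>\<sigma>. u \<sigma> \<in> J"
        by (auto simp: cech_cocycles_def carrier_cochains)
      have "cochain p (\<lambda>_. 0) 0 = cochain p (\<lambda>_. 0) k"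
        using submod_0[OF J] submod_0[OF I(1)] by (subst cochain_eq_iff) auto
      then have "cochain p (\<lambda>_. 0) 0 \<oplus>\<^bsub>cochains p\<^esub> c = c"
        using u submod_0[OF J] by (simp add: add_cochains)
      then have "c \<in> (\<lambda>b. b \<oplus>\<^bsub>cochains p\<^esub> c) ` ?B" using zero_B by (metis image_eqI)
      moreover have "(\<lambda>b. b \<oplus>\<^bsub>cochains p\<^esub> c) ` ?B \<in> {?B}"
        unfolding eq[symmetric] using c by (rule imageI)
      ultimately show "c \<in> ?B" by simp
    qed
  next
    assume "?Z \<subseteq> ?B"
    then show "(\<lambda>c. (\<lambda>b. b \<oplus>\<^bsub>cochains p\<^esub> c) ` ?B) ` ?Z = {?B}"
      using coboundaries_translate zero_Z by blast
  qed
  then show ?thesis by (simp only: cocycles_subset_coboundaries_iff)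
qed

end

section \<open>Linear extension of maps on monomials\<close>

abbreviation "lookup \<equiv> Poly_Mapping.lookup"
abbreviation "keys \<equiv> Poly_Mapping.keys"
abbreviation "single \<equiv> Poly_Mapping.single"

text \<open>A linear order of the variables makes the monomials an ordered monoid.  Hence the polynomials have no
  zero divisors, and they have leading monomials.\<close>

instantiation var :: linorder
begin

definition var_key :: "var \<Rightarrow> nat" where
  "var_key v = (case v of X i \<Rightarrow> 2 * i | Y j \<Rightarrow> 2 * j + 1)"

definition less_eq_var :: "var \<Rightarrow> var \<Rightarrow> bool" where "u \<le> v \<longleftrightarrow> var_key u \<le> var_key v"
definition less_var :: "var \<Rightarrow> var \<Rightarrow> bool" where "u < v \<longleftrightarrow> var_key u < var_key v"

instance
proof
  have "inj var_key"
    by (rule injI) (auto simp: var_key_def split: var.splits, presburger+)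
  then show "u \<le> v \<Longrightarrow> v \<le> u \<Longrightarrow> u = v" for u v :: var
    by (auto simp: less_eq_var_def dest: injD)
qed (auto simp: less_eq_var_def less_var_def)

end

type_synonym monom = "var \<Rightarrow>\<^sub>0 nat"

abbreviation mono_poly :: "monom \<Rightarrow> 'k::field bipoly" where
  "mono_poly t \<equiv> single t 1"

abbreviation const_poly :: "'k \<Rightarrow> 'k::field bipoly" where
  "const_poly c \<equiv> single 0 c"

text \<open>
  The \<open>K\<close>-linear extension of a map \<open>\<phi>\<close> on monomials.  All operators on polynomials below have this form,
  so that their identities need to be checked on monomials only.
\<close>

definition lin_ext :: "(monom \<Rightarrow> 'k::field bipoly) \<Rightarrow> 'k bipoly \<Rightarrow> 'k bipoly" where
  "lin_ext \<phi> u = (\<Sum>t\<in>keys u. const_poly (lookup u t) * \<phi> t)"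

lemma lin_ext_superset:
  assumes "finite B" "keys u \<subseteq> B"
  shows "lin_ext \<phi> u = (\<Sum>t\<in>B. const_poly (lookup u t) * \<phi> t)"
  unfolding lin_ext_def
  by (rule sum.mono_neutral_left) (use assms in \<open>auto simp: in_keys_iff\<close>)

lemma lin_ext_add: "lin_ext \<phi> (u + v) = lin_ext \<phi> u + lin_ext \<phi> v"
proof -
  let ?B = "keys u \<union> keys v"
  have "keys (u + v) \<subseteq> ?B" by (rule Poly_Mapping.keys_add)
  then show ?thesis
    by (simp add: lin_ext_superset[of ?B] lookup_add single_add distrib_right sum.distrib)
qed

lemma lin_ext_0 [simp]: "lin_ext \<phi> 0 = 0" by (simp add: lin_ext_def)

lemma lin_ext_sum: "lin_ext \<phi> (sum g B) = (\<Sum>i\<in>B. lin_ext \<phi> (g i))"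
  by (induction B rule: infinite_finite_induct) (simp_all add: lin_ext_add)

lemma lin_ext_single [simp]: "lin_ext \<phi> (single t c) = const_poly c * \<phi> t"
  by (subst lin_ext_superset[of "{t}"]) auto

lemma lin_ext_diff: "lin_ext \<phi> (u - v) = lin_ext \<phi> u - lin_ext \<phi> v"
  using lin_ext_add[of \<phi> "u - v" v] by simp

lemma lin_ext_cong:
  "(\<And>t. t \<in> keys u \<Longrightarrow> \<phi> t = \<psi> t) \<Longrightarrow> lin_ext \<phi> u = lin_ext \<psi> u"
  by (simp add: lin_ext_def)

lemma sum_monomials: "(\<Sum>t\<in>keys u. single t (lookup u t)) = u"
proof (rule poly_mapping_eqI)
  fix s
  show "lookup (\<Sum>t\<in>keys u. single t (lookup u t)) s = lookup u s"
    by (simp add: lookup_sum lookup_single when_def in_keys_iff)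
qed

lemma const_mult_mono [simp]: "const_poly c * mono_poly t = single t c"
  by (simp add: mult_single)

lemma lin_ext_mono [simp]: "lin_ext mono_poly u = u"
  by (simp add: lin_ext_def sum_monomials)

lemma lin_ext_lin_ext: "lin_ext \<phi> (lin_ext \<psi> u) = lin_ext (\<lambda>t. lin_ext \<phi> (\<psi> t)) u"
proof -
  have "lin_ext \<phi> (const_poly c * v) = const_poly c * lin_ext \<phi> v" for c v
  proof -
    have "const_poly c * v = (\<Sum>t\<in>keys v. single t (c * lookup v t))"
      by (subst sum_monomials[of v, symmetric]) (simp add: sum_distrib_left mult_single)
    then show ?thesis
      by (simp add: lin_ext_sum lin_ext_def[of \<phi> v] sum_distrib_left mult.assoc[symmetric] mult_single)
  qed
  then show ?thesis by (simp add: lin_ext_def[of \<psi>] lin_ext_sum) (simp add: lin_ext_def)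
qed

lemma lin_ext_mult:
  assumes "\<And>s t. s \<in> keys u \<Longrightarrow> t \<in> keys v \<Longrightarrow> \<phi> (s + t) = \<phi>\<^sub>1 s * \<phi>\<^sub>2 t"
  shows "lin_ext \<phi> (u * v) = lin_ext \<phi>\<^sub>1 u * lin_ext \<phi>\<^sub>2 v"
proof -
  have "u * v = (\<Sum>s\<in>keys u. \<Sum>t\<in>keys v.
      single (s + t) (lookup u s * lookup v t))"
    by (subst sum_monomials[of u, symmetric], subst sum_monomials[of v, symmetric])
      (simp add: sum_product mult_single)
  then have "lin_ext \<phi> (u * v) = (\<Sum>s\<in>keys u. \<Sum>t\<in>keys v.
      const_poly (lookup u s * lookup v t) * \<phi> (s + t))"
    by (simp add: lin_ext_sum)
  also have "\<dots> = (\<Sum>s\<in>keys u. \<Sum>t\<in>keys v.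
      (const_poly (lookup u s) * \<phi>\<^sub>1 s) * (const_poly (lookup v t) * \<phi>\<^sub>2 t))"
  proof (intro sum.cong refl)
    fix s t assume "s \<in> keys u" "t \<in> keys v"
    then have "const_poly (lookup u s * lookup v t) * \<phi> (s + t) =
        (const_poly (lookup u s) * const_poly (lookup v t)) * (\<phi>\<^sub>1 s * \<phi>\<^sub>2 t)"
      using assms by (simp add: mult_single)
    then show "const_poly (lookup u s * lookup v t) * \<phi> (s + t) =
        (const_poly (lookup u s) * \<phi>\<^sub>1 s) * (const_poly (lookup v t) * \<phi>\<^sub>2 t)"
      by (simp only: ac_simps)
  qed
  finally show ?thesis by (simp add: lin_ext_def sum_product)
qed

lemma lookup_mono_mult: "lookup (mono_poly s * u) (s + t) = lookup u t"
proof -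
  have "mono_poly s * u = (\<Sum>r\<in>keys u. single (s + r) (lookup u r))"
    by (subst sum_monomials[of u, symmetric]) (simp add: sum_distrib_left mult_single)
  then show ?thesis by (simp add: lookup_sum lookup_single when_def in_keys_iff)
qed

lemma lookup_mult_keys:
  "lookup (u * v) t = (\<Sum>s\<in>keys u. \<Sum>r\<in>keys v.
    if s + r = t then lookup u s * lookup v r else 0)"
proof -
  have "u * v = (\<Sum>s\<in>keys u. \<Sum>t\<in>keys v.
      single (s + t) (lookup u s * lookup v t))"
    by (subst sum_monomials[of u, symmetric], subst sum_monomials[of v, symmetric])
      (simp add: sum_product mult_single)
  then show ?thesis by (simp add: lookup_sum lookup_single when_def)
qed

lemma lookup_const_mult: "lookup (const_poly c * u) t = c * lookup u t"
proof -
  have "const_poly c * u = (\<Sum>s\<in>keys u. single s (c * lookup u s))"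
    by (subst sum_monomials[of u, symmetric]) (simp add: sum_distrib_left mult_single)
  then show ?thesis by (simp add: lookup_sum lookup_single when_def in_keys_iff)
qed

lemma keys_lin_ext:
  assumes "s \<in> keys (lin_ext \<phi> u)"
  shows "\<exists>t\<in>keys u. s \<in> keys (\<phi> t)"
proof -
  have "s \<in> (\<Union>t\<in>keys u. keys (const_poly (lookup u t) * \<phi> t))"
    using assms keys_sum[of "\<lambda>t. const_poly (lookup u t) * \<phi> t" "keys u"] unfolding lin_ext_def by blast
  then obtain t where t: "t \<in> keys u" "s \<in> keys (const_poly (lookup u t) * \<phi> t)" by blast
  then have "lookup (\<phi> t) s \<noteq> 0" by (auto simp: in_keys_iff lookup_const_mult)
  then show ?thesis using t(1) by (auto simp: in_keys_iff)
qed

section \<open>Bidegrees\<close>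

definition x_part :: "monom \<Rightarrow> monom" where
  "x_part t = Poly_Mapping.mapp (\<lambda>v k. case v of X i \<Rightarrow> k | Y j \<Rightarrow> 0) t"

definition y_part :: "monom \<Rightarrow> monom" where
  "y_part t = Poly_Mapping.mapp (\<lambda>v k. case v of X i \<Rightarrow> 0 | Y j \<Rightarrow> k) t"

lemma lookup_x_part: "lookup (x_part t) v = (case v of X i \<Rightarrow> lookup t v | Y j \<Rightarrow> 0)"
  by (auto simp: x_part_def lookup_mapp when_def in_keys_iff split: var.splits)

lemma lookup_y_part: "lookup (y_part t) v = (case v of X i \<Rightarrow> 0 | Y j \<Rightarrow> lookup t v)"
  by (auto simp: y_part_def lookup_mapp when_def in_keys_iff split: var.splits)

lemma x_part_add: "x_part (s + t) = x_part s + x_part t"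
  by (rule poly_mapping_eqI) (auto simp: lookup_x_part lookup_add split: var.splits)
lemma y_part_add: "y_part (s + t) = y_part s + y_part t"
  by (rule poly_mapping_eqI) (auto simp: lookup_y_part lookup_add split: var.splits)
lemma x_part_add_y_part: "x_part t + y_part t = t"
  by (rule poly_mapping_eqI) (auto simp: lookup_y_part lookup_x_part lookup_add split: var.splits)
lemma x_part_0 [simp]: "x_part 0 = 0" and y_part_0 [simp]: "y_part 0 = 0"
  by (auto intro!: poly_mapping_eqI simp: lookup_y_part lookup_x_part split: var.splits)
lemma x_part_x_part [simp]: "x_part (x_part t) = x_part t"
  and y_part_y_part [simp]: "y_part (y_part t) = y_part t"
  and x_part_y_part [simp]: "x_part (y_part t) = 0"
  and y_part_x_part [simp]: "y_part (x_part t) = 0"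
  by (auto intro!: poly_mapping_eqI simp: lookup_y_part lookup_x_part split: var.splits)

lemma xdeg_superset:
  assumes "finite B" "keys t \<subseteq> B"
  shows "xdeg t = (\<Sum>v\<in>B. case v of X i \<Rightarrow> lookup t v | Y j \<Rightarrow> 0)"
  unfolding xdeg_def
proof (rule sum.mono_neutral_left[OF assms])
  show "\<forall>v\<in>B - keys t. (case v of X i \<Rightarrow> lookup t v | Y j \<Rightarrow> 0) = 0"
    by (auto simp: in_keys_iff split: var.split)
qed

lemma ydeg_superset:
  assumes "finite B" "keys t \<subseteq> B"
  shows "ydeg t = (\<Sum>v\<in>B. case v of X i \<Rightarrow> 0 | Y j \<Rightarrow> lookup t v)"
  unfolding ydeg_def
proof (rule sum.mono_neutral_left[OF assms])
  show "\<forall>v\<in>B - keys t. (case v of X i \<Rightarrow> 0 | Y j \<Rightarrow> lookup t v) = 0"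
    by (auto simp: in_keys_iff split: var.split)
qed

lemma xdeg_add: "xdeg (s + t) = xdeg s + xdeg t"
proof -
  let ?B = "keys s \<union> keys t"
  have "keys (s + t) \<subseteq> ?B" by (rule Poly_Mapping.keys_add)
  then show ?thesis
    by (simp add: xdeg_superset[of ?B] sum.distrib[symmetric] lookup_add)
      (auto intro!: sum.cong simp: lookup_add split: var.splits)
qed

lemma ydeg_add: "ydeg (s + t) = ydeg s + ydeg t"
proof -
  let ?B = "keys s \<union> keys t"
  have "keys (s + t) \<subseteq> ?B" by (rule Poly_Mapping.keys_add)
  then show ?thesis
    by (simp add: ydeg_superset[of ?B] sum.distrib[symmetric] lookup_add)
      (auto intro!: sum.cong simp: lookup_add split: var.splits)
qed

lemma xdeg_0 [simp]: "xdeg 0 = 0" and ydeg_0 [simp]: "ydeg 0 = 0"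
  by (simp_all add: xdeg_def ydeg_def)

lemma xdeg_eq_0_iff: "xdeg t = 0 \<longleftrightarrow> x_part t = 0"
proof
  assume "xdeg t = 0"
  then show "x_part t = 0"
    by (intro poly_mapping_eqI) (force simp: xdeg_def lookup_x_part in_keys_iff split: var.splits)
next
  assume "x_part t = 0"
  then have "lookup t (X i) = 0" for i using lookup_x_part[of t "X i"] by simp
  then show "xdeg t = 0" by (auto simp: xdeg_def split: var.splits)
qed

lemma ydeg_eq_0_iff: "ydeg t = 0 \<longleftrightarrow> y_part t = 0"
proof
  assume "ydeg t = 0"
  then show "y_part t = 0"
    by (intro poly_mapping_eqI) (force simp: ydeg_def lookup_y_part in_keys_iff split: var.splits)
next
  assume "y_part t = 0"
  then have "lookup t (Y i) = 0" for i using lookup_y_part[of t "Y i"] by simp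
  then show "ydeg t = 0" by (auto simp: ydeg_def split: var.splits)
qed

lemma xdeg_x_part [simp]: "xdeg (x_part t) = xdeg t"
  using xdeg_add[of "x_part t" "y_part t"] xdeg_eq_0_iff[of "y_part t"] by (simp add: x_part_add_y_part)
lemma ydeg_y_part [simp]: "ydeg (y_part t) = ydeg t"
  using ydeg_add[of "x_part t" "y_part t"] ydeg_eq_0_iff[of "x_part t"] by (simp add: x_part_add_y_part)
lemma xdeg_y_part [simp]: "xdeg (y_part t) = 0" by (simp add: xdeg_eq_0_iff)
lemma ydeg_x_part [simp]: "ydeg (x_part t) = 0" by (simp add: ydeg_eq_0_iff)

lemma xdeg_single_Y [simp]: "xdeg (single (Y j) k) = 0"
  by (simp add: xdeg_def)
lemma ydeg_single_Y [simp]: "ydeg (single (Y j) k) = k"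
  by (simp add: ydeg_def)
lemma x_part_single_Y [simp]: "x_part (single (Y j) k) = 0"
  by (simp add: xdeg_eq_0_iff[symmetric])
lemma y_part_single_Y [simp]: "y_part (single (Y j) k) = single (Y j) k"
  using x_part_add_y_part[of "single (Y j) k"] by simp

lemma lookup_le_ydeg: "lookup t (Y j) \<le> ydeg t"
proof (cases "Y j \<in> keys t")
  case True
  then show ?thesis
    using member_le_sum[of "Y j" "keys t" "\<lambda>v. case v of X i \<Rightarrow> 0 | Y j \<Rightarrow> lookup t v"]
    by (simp add: ydeg_def)
next
  case False then show ?thesis by (simp add: in_keys_iff)
qed

definition vars :: "nat \<Rightarrow> nat \<Rightarrow> var set" where
  "vars m n = X ` {1..m} \<union> Y ` {1..n}"

abbreviation bipolys :: "nat \<Rightarrow> nat \<Rightarrow> 'k::field bipoly set" where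
  "bipolys m n \<equiv> carrier (bipoly_ring m n)"

lemma mem_bipolys: "g \<in> bipolys m n \<longleftrightarrow> (\<forall>t\<in>keys g. keys t \<subseteq> vars m n)"
  by (simp add: bipoly_ring_def vars_def)

lemma bipoly_ring_eq:
  "bipoly_ring m n = \<lparr>carrier = bipolys m n, mult = (*), one = 1, zero = 0, add = (+)\<rparr>"
  by (simp add: bipoly_ring_def)

lemma bipolys_add: "u \<in> bipolys m n \<Longrightarrow> v \<in> bipolys m n \<Longrightarrow> u + v \<in> bipolys m n"
  using Poly_Mapping.keys_add[of u v] by (auto simp: mem_bipolys)

lemma keys_monom_add: "keys (s + t) = keys s \<union> keys (t :: monom)"
  by (auto simp: in_keys_iff lookup_add)

lemma bipolys_mult: "u \<in> bipolys m n \<Longrightarrow> v \<in> bipolys m n \<Longrightarrow> u * v \<in> bipolys m n"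
  using keys_mult[of u v] by (fastforce simp: mem_bipolys keys_monom_add)

lemma bipolys_single: "keys t \<subseteq> vars m n \<Longrightarrow> single t c \<in> bipolys m n"
  by (simp add: mem_bipolys)

lemma indet_power: "indet v ^ k = mono_poly (single v k)"
proof (induction k)
  case (Suc k)
  then show ?case by (simp add: indet_def mult_single single_add[symmetric])
qed simp

interpretation bipoly: subring_sequence "bipolys m n" n "\<lambda>j. indet (Y j)" for m n
proof
  show "1 \<in> bipolys m n" by (simp add: mem_bipolys)
  show "- 1 \<in> bipolys m n"
    using bipolys_single[of 0 m n "- 1"] by (simp add: single_uminus)
  show "indet (Y j) \<in> bipolys m n" if "j \<in> {1..n}" for j
    using that by (auto simp: indet_def vars_def intro!: bipolys_single)
qed (auto intro: bipolys_add bipolys_mult)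

lemma bipolys_sum: "(\<And>i. i \<in> B \<Longrightarrow> g i \<in> bipolys m n) \<Longrightarrow> sum g B \<in> bipolys m n"
  by (rule bipoly.submod_sum[OF bipoly.submod_A])

lemma bipolys_0 [simp]: "0 \<in> bipolys m n" by (simp add: mem_bipolys)

lemma lin_ext_closed:
  assumes "u \<in> bipolys m n" "\<And>t. keys t \<subseteq> vars m n \<Longrightarrow> \<phi> t \<in> bipolys m n"
  shows "lin_ext \<phi> u \<in> bipolys m n"
  unfolding lin_ext_def
  by (intro bipolys_sum bipolys_mult bipolys_single assms(2)) (use assms(1) in \<open>auto simp: mem_bipolys\<close>)

section \<open>Division by variables and coefficients\<close>

text \<open>The quotient of the division by \<open>Y j\<close>; the terms without \<open>Y j\<close> form the remainder.\<close>

definition div_Y :: "nat \<Rightarrow> 'k::field bipoly \<Rightarrow> 'k bipoly" where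
  "div_Y j = lin_ext (\<lambda>t. if lookup t (Y j) = 0 then 0 else mono_poly (t - single (Y j) 1))"

lemma monom_minus_add: "lookup t v \<noteq> 0 \<Longrightarrow> (t - single v 1) + single v 1 = (t :: monom)"
  by (rule poly_mapping_eqI) (auto simp: lookup_add lookup_minus lookup_single when_def)

lemma monom_add_minus: "lookup t v \<noteq> 0 \<Longrightarrow> (s + t) - single v 1 = s + (t - single v (1::nat) :: monom)"
  by (rule poly_mapping_eqI) (auto simp: lookup_add lookup_minus lookup_single when_def)

lemma div_Y_indet: "div_Y j (indet (Y j) * u) = u"
proof -
  have "div_Y j (indet (Y j) * u) = lin_ext (\<lambda>_. 1) (indet (Y j)) * lin_ext mono_poly u"
    unfolding div_Y_def indet_def by (rule lin_ext_mult) (simp add: lookup_add)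
  then show ?thesis unfolding indet_def by simp
qed

lemma div_Y_mult:
  assumes "\<And>s. s \<in> keys g \<Longrightarrow> lookup s (Y j) = 0"
  shows "div_Y j (g * u) = g * div_Y j u"
proof -
  have "div_Y j (g * u) = lin_ext mono_poly g * div_Y j u"
    unfolding div_Y_def
    by (rule lin_ext_mult) (use assms in \<open>auto simp: lookup_add mult_single monom_add_minus simp del: One_nat_def\<close>)
  then show ?thesis by simp
qed

lemma div_Y_indet_other: "i \<noteq> j \<Longrightarrow> div_Y j (indet (Y i) ^ k * u) = indet (Y i) ^ k * div_Y j u"
  by (rule div_Y_mult) (simp add: indet_power lookup_single)

lemma div_Y_closed: "u \<in> bipolys m n \<Longrightarrow> div_Y j u \<in> bipolys m n"
  unfolding div_Y_def
  by (rule lin_ext_closed) (auto intro!: bipolys_single simp: in_keys_iff lookup_minus)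

lemma div_Y_sum: "div_Y j (sum g B) = (\<Sum>i\<in>B. div_Y j (g i))"
  and div_Y_diff: "div_Y j (u - v) = div_Y j u - div_Y j v"
  and div_Y_add: "div_Y j (u + v) = div_Y j u + div_Y j v"
  by (simp_all add: div_Y_def lin_ext_sum lin_ext_diff lin_ext_add)

lemma div_Y_power_indet: "(div_Y j ^^ k) (indet (Y j) ^ k * u) = u"
  by (induction k arbitrary: u) (simp_all add: div_Y_indet mult.assoc funpow_Suc_right del: funpow.simps)

lemma div_Y_power_mult:
  assumes "\<And>s. s \<in> keys g \<Longrightarrow> lookup s (Y j) = 0"
  shows "(div_Y j ^^ k) (g * u) = g * (div_Y j ^^ k) u"
  by (induction k) (simp_all add: div_Y_mult[OF assms])

lemma div_Y_power_indet_other: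
  "i \<noteq> j \<Longrightarrow> (div_Y j ^^ k) (indet (Y i) ^ l * u) = indet (Y i) ^ l * (div_Y j ^^ k) u"
  by (rule div_Y_power_mult) (simp add: indet_power lookup_single)

lemma div_Y_power_sum: "(div_Y j ^^ k) (sum h B) = (\<Sum>i\<in>B. (div_Y j ^^ k) (h i))"
  by (induction k) (simp_all add: div_Y_sum)

lemma div_Y_power_diff: "(div_Y j ^^ k) (u - v) = (div_Y j ^^ k) u - (div_Y j ^^ k) v"
  by (induction k) (simp_all add: div_Y_diff)

lemma div_Y_power_closed: "u \<in> bipolys m n \<Longrightarrow> (div_Y j ^^ k) u \<in> bipolys m n"
  by (induction k) (simp_all add: div_Y_closed)

lemma indet_closed: "j \<in> {1..n} \<Longrightarrow> indet (Y j) \<in> bipolys m n"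
  by (rule bipoly.seq_closed)

lemma lookup_lin_ext_partial:
  assumes "\<And>t. t \<in> keys u \<Longrightarrow> D t \<and> \<rho> t = r \<longleftrightarrow> t = t\<^sub>0"
  shows "lookup (lin_ext (\<lambda>t. if D t then mono_poly (\<rho> t) else 0) u) r = lookup u t\<^sub>0"
proof -
  have "lookup (lin_ext (\<lambda>t. if D t then mono_poly (\<rho> t) else 0) u) r =
      (\<Sum>t\<in>keys u. if t = t\<^sub>0 then lookup u t else 0)"
    unfolding lin_ext_def lookup_sum
    by (rule sum.cong) (use assms in \<open>auto simp: lookup_single when_def\<close>)
  then show ?thesis by (simp add: in_keys_iff)
qed

lemma lookup_div_Y: "lookup (div_Y j u) t = lookup u (t + single (Y j) 1)"
proof -
  have "div_Y j u = lin_ext (\<lambda>t. if lookup t (Y j) \<noteq> 0 then mono_poly (t - single (Y j) 1) else 0) u"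
    unfolding div_Y_def by (rule lin_ext_cong) auto
  also have "lookup \<dots> t = lookup u (t + single (Y j) 1)"
  proof (rule lookup_lin_ext_partial)
    fix s :: monom
    show "lookup s (Y j) \<noteq> 0 \<and> s - single (Y j) 1 = t \<longleftrightarrow> s = t + single (Y j) 1"
      using monom_minus_add[of s "Y j"] by (auto simp: lookup_add simp del: One_nat_def)
  qed
  finally show ?thesis .
qed

definition hom_comp :: "int \<times> int \<Rightarrow> 'k::field bipoly \<Rightarrow> 'k bipoly" where
  "hom_comp d = lin_ext (\<lambda>t. if (int (xdeg t), int (ydeg t)) = d then mono_poly t else 0)"

text \<open>The polynomial in the \<open>Y j\<close> by which the monomial \<open>\<delta>\<close> in the \<open>X i\<close> is multiplied in a polynomial;
  \<open>y_coeff\<close> has the roles of the variables exchanged.\<close>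

definition x_coeff :: "monom \<Rightarrow> 'k::field bipoly \<Rightarrow> 'k bipoly" where
  "x_coeff \<delta> = lin_ext (\<lambda>t. if x_part t = \<delta> then mono_poly (y_part t) else 0)"

definition y_coeff :: "monom \<Rightarrow> 'k::field bipoly \<Rightarrow> 'k bipoly" where
  "y_coeff \<beta> = lin_ext (\<lambda>t. if y_part t = \<beta> then mono_poly (x_part t) else 0)"

lemma hom_comp_closed: "u \<in> bipolys m n \<Longrightarrow> hom_comp d u \<in> bipolys m n"
  unfolding hom_comp_def by (rule lin_ext_closed) (auto intro: bipolys_single)

lemma lookup_hom_comp: "lookup (hom_comp d u) t = (if (int (xdeg t), int (ydeg t)) = d then lookup u t else 0)"
proof (cases "(int (xdeg t), int (ydeg t)) = d")
  case True
  then show ?thesis unfolding hom_comp_def by (subst lookup_lin_ext_partial[where t\<^sub>0 = t]) auto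
next
  case False
  then show ?thesis
    by (auto simp: hom_comp_def lin_ext_def lookup_sum lookup_single when_def intro!: sum.neutral)
qed

lemma hom_comp_mem: "u \<in> bipolys m n \<Longrightarrow> hom_comp d u \<in> bipoly_comp m n d"
  unfolding bipoly_comp_def by (auto simp: hom_comp_closed in_keys_iff lookup_hom_comp split: if_splits)

lemma hom_comp_id: "u \<in> bipoly_comp m n d \<Longrightarrow> hom_comp d u = u"
  by (rule poly_mapping_eqI) (auto simp: lookup_hom_comp bipoly_comp_def in_keys_iff)

lemma hom_comp_other: "u \<in> bipoly_comp m n d \<Longrightarrow> d' \<noteq> d \<Longrightarrow> hom_comp d' u = 0"
  by (rule poly_mapping_eqI) (auto simp: lookup_hom_comp bipoly_comp_def in_keys_iff)

lemma hom_comp_sum: "hom_comp d (sum g B) = (\<Sum>i\<in>B. hom_comp d (g i))"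
  and hom_comp_add: "hom_comp d (u + v) = hom_comp d u + hom_comp d v"
  by (simp_all add: hom_comp_def lin_ext_sum lin_ext_add)

lemma hom_comp_mult:
  assumes "\<And>t. t \<in> keys h \<Longrightarrow> xdeg t = p \<and> ydeg t = q"
  shows "hom_comp (i, k) (h * u) = h * hom_comp (i - int p, k - int q) u"
proof -
  have "hom_comp (i, k) (h * u) = lin_ext mono_poly h * hom_comp (i - int p, k - int q) u"
    unfolding hom_comp_def
  proof (rule lin_ext_mult)
    fix s t assume "s \<in> keys h"
    then have "(int (xdeg (s + t)), int (ydeg (s + t))) = (i, k) \<longleftrightarrow>
        (int (xdeg t), int (ydeg t)) = (i - int p, k - int q)"
      using assms[of s] by (auto simp: xdeg_add ydeg_add)
    then show "(if (int (xdeg (s + t)), int (ydeg (s + t))) = (i, k) then mono_poly (s + t) else 0) =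
        mono_poly s * (if (int (xdeg t), int (ydeg t)) = (i - int p, k - int q) then mono_poly t else 0)"
      by (simp only:) (simp add: mult_single)
  qed
  then show ?thesis by simp
qed

lemma lookup_x_coeff:
  assumes "x_part \<delta> = \<delta>" "y_part \<alpha> = \<alpha>"
  shows "lookup (x_coeff \<delta> u) \<alpha> = lookup u (\<delta> + \<alpha>)"
  unfolding x_coeff_def
proof (rule lookup_lin_ext_partial)
  fix t
  have "x_part \<alpha> = 0" "y_part \<delta> = 0" using x_part_y_part[of \<alpha>] y_part_x_part[of \<delta>] assms by simp_all
  then show "x_part t = \<delta> \<and> y_part t = \<alpha> \<longleftrightarrow> t = \<delta> + \<alpha>"
    using x_part_add_y_part[of t] assms by (auto simp: x_part_add y_part_add)
qed

lemma x_coeff_y_coeff: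
  assumes "x_part \<delta> = \<delta>" "y_part \<beta> = \<beta>"
  shows "x_coeff \<delta> (y_coeff \<beta> u) = const_poly (lookup u (\<delta> + \<beta>))"
proof -
  have *: "x_part \<beta> = 0" "y_part \<delta> = 0" using x_part_y_part[of \<beta>] y_part_x_part[of \<delta>] assms by simp_all
  have "x_coeff \<delta> (y_coeff \<beta> u) = lin_ext (\<lambda>t. if t = \<delta> + \<beta> then 1 else 0) u"
    unfolding x_coeff_def y_coeff_def lin_ext_lin_ext
  proof (rule lin_ext_cong)
    fix t
    have "y_part t = \<beta> \<and> x_part t = \<delta> \<longleftrightarrow> t = \<delta> + \<beta>"
      using x_part_add_y_part[of t] assms * by (auto simp: x_part_add y_part_add)
    then show "lin_ext (\<lambda>t. if x_part t = \<delta> then mono_poly (y_part t) else 0)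
        (if y_part t = \<beta> then mono_poly (x_part t) else 0) = (if t = \<delta> + \<beta> then 1 else 0)"
      by (auto simp: *)
  qed
  also have "\<dots> = (\<Sum>t\<in>keys u. if t = \<delta> + \<beta> then const_poly (lookup u t) else 0)"
    unfolding lin_ext_def by (rule sum.cong) auto
  finally show ?thesis by (simp add: in_keys_iff)
qed

lemma x_coeff_sum: "x_coeff \<delta> (sum g B) = (\<Sum>i\<in>B. x_coeff \<delta> (g i))"
  and x_coeff_diff: "x_coeff \<delta> (u - v) = x_coeff \<delta> u - x_coeff \<delta> v"
  by (simp_all add: x_coeff_def lin_ext_sum lin_ext_diff)

lemma x_coeff_mult_Y:
  assumes "x_part s = 0"
  shows "x_coeff \<delta> (mono_poly s * u) = mono_poly s * x_coeff \<delta> u"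
proof -
  have "y_part s = s" using x_part_add_y_part[of s] assms by simp
  then have "x_coeff \<delta> (mono_poly s * u) = lin_ext mono_poly (mono_poly s) * x_coeff \<delta> u"
    unfolding x_coeff_def
    by (intro lin_ext_mult) (auto simp: x_part_add y_part_add assms mult_single)
  then show ?thesis by simp
qed

text \<open>A term of \<open>f * v\<close> that has the same \<open>X\<close>-degree as all terms of \<open>f\<close> comes from a term of \<open>v\<close> without
  any \<open>X i\<close>.\<close>

lemma x_coeff_mult_lowest:
  assumes "\<And>t. t \<in> keys f \<Longrightarrow> xdeg t = a" "xdeg \<delta> = a"
  shows "x_coeff \<delta> (f * v) = x_coeff \<delta> f * x_coeff 0 v"
  unfolding x_coeff_def
proof (rule lin_ext_mult)
  fix s t assume "s \<in> keys f"
  then have "xdeg s = xdeg \<delta>" using assms by simp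
  then have "x_part (s + t) = \<delta> \<longleftrightarrow> x_part s = \<delta> \<and> x_part t = 0"
    unfolding x_part_add
    by (metis add_cancel_left_right add.right_neutral xdeg_add xdeg_eq_0_iff xdeg_x_part)
  then show "(if x_part (s + t) = \<delta> then mono_poly (y_part (s + t)) else 0) =
      (if x_part s = \<delta> then mono_poly (y_part s) else 0) * (if x_part t = 0 then mono_poly (y_part t) else 0)"
    by (auto simp: y_part_add mult_single)
qed

lemma lookup_power_indet_mult:
  assumes "lookup s (Y j) < k"
  shows "lookup (indet (Y j) ^ k * w) s = 0"
proof (rule ccontr)
  assume "lookup (indet (Y j) ^ k * w) s \<noteq> 0"
  then have "s \<in> keys (mono_poly (single (Y j) k) * w)"
    by (simp add: in_keys_iff indet_power)
  then obtain r where "s = single (Y j) k + r"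
    using keys_mult[of "mono_poly (single (Y j) k)" w] by auto
  then show False using assms by (simp add: lookup_add)
qed

definition y_monom :: "nat \<Rightarrow> (nat \<Rightarrow> nat) \<Rightarrow> monom" where
  "y_monom n e = (\<Sum>j\<in>{1..n}. single (Y j) (e j))"

lemma lookup_y_monom_Y [simp]: "lookup (y_monom n e) (Y j) = (if j \<in> {1..n} then e j else 0)"
  by (simp add: y_monom_def lookup_sum lookup_single when_def del: atLeastAtMost_iff)
lemma lookup_y_monom_X [simp]: "lookup (y_monom n e) (X i) = 0"
  by (simp add: y_monom_def lookup_sum lookup_single)

lemma x_part_y_monom [simp]: "x_part (y_monom n e) = 0"
  by (rule poly_mapping_eqI) (auto simp: lookup_x_part split: var.split)
lemma y_part_y_monom [simp]: "y_part (y_monom n e) = y_monom n e"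
  using x_part_add_y_part[of "y_monom n e"] by simp

lemma keys_y_monom: "keys (y_monom n e) \<subseteq> vars m n"
proof
  fix v assume "v \<in> keys (y_monom n e)"
  then show "v \<in> vars m n" by (cases v) (auto simp: in_keys_iff vars_def split: if_splits)
qed

lemma ydeg_sum: "ydeg (sum g B) = (\<Sum>i\<in>B. ydeg (g i))"
  by (induction B rule: infinite_finite_induct) (simp_all add: ydeg_add)

lemma ydeg_y_monom: "ydeg (y_monom n e) = (\<Sum>j\<in>{1..n}. e j)"
  by (simp add: y_monom_def ydeg_sum)

lemma prod_mono_poly: "(\<Prod>i\<in>B. mono_poly (g i)) = mono_poly (\<Sum>i\<in>B. g i)"
  by (induction B rule: infinite_finite_induct) (simp_all add: mult_single)

lemma prod_indet: "(\<Prod>j\<in>{1..n}. indet (Y j) ^ e) = mono_poly (y_monom n (\<lambda>_. e))"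
  by (simp add: indet_power prod_mono_poly y_monom_def)

lemma lookup_outside: "keys t \<subseteq> vars m n \<Longrightarrow> j \<notin> {1..n} \<Longrightarrow> lookup t (Y j) = 0"
  by (auto simp: vars_def in_keys_iff)

lemma y_only_X: "y_part t = t \<Longrightarrow> lookup t (X i) = 0"
  by (metis lookup_y_part var.simps(5))

section \<open>Local cohomology of principal quotients\<close>

text \<open>
  If \<open>h\<close> only involves the variables \<open>X i\<close>, then \<open>S/hS = (K[X]/hK[X])[Y]\<close>, and the \<open>Y j\<close> form a
  regular sequence: division by \<open>Y j\<close> commutes with \<open>h\<close> and with the other variables.
\<close>

lemma koszul_exact_no_Y:
  assumes h: "h \<in> bipolys m n" "\<And>t. t \<in> keys h \<Longrightarrow> y_part t = 0" and p: "p < n"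
  shows "bipoly.koszul_exact n (bipolys m n) ((*) h ` bipolys m n) s p"
proof (rule bipoly.koszul_exact_if_regular[OF bipoly.submod_multiples[OF h(1)] bipoly.multiples_subset[OF h(1)] _ p])
  fix V j u g
  assume j: "j \<notin> V" and u: "u \<in> bipolys m n" and g: "\<And>i. g i \<in> bipolys m n"
    and "indet (Y j) ^ s j * u - (\<Sum>i\<in>V. indet (Y i) ^ s i * g i) \<in> (*) h ` bipolys m n"
  then obtain v where v: "v \<in> bipolys m n"
    "indet (Y j) ^ s j * u - (\<Sum>i\<in>V. indet (Y i) ^ s i * g i) = h * v" by blast
  have hY: "lookup t (Y j) = 0" if "t \<in> keys h" for t
    using h(2)[OF that] lookup_y_part[of t "Y j"] by simp
  let ?q = "div_Y j ^^ s j"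
  have "u - (\<Sum>i\<in>V. indet (Y i) ^ s i * ?q (g i)) =
      ?q (indet (Y j) ^ s j * u - (\<Sum>i\<in>V. indet (Y i) ^ s i * g i))"
    unfolding div_Y_power_diff div_Y_power_sum div_Y_power_indet
    by (intro arg_cong2[of _ _ _ _ minus] sum.cong refl) (use j in \<open>metis div_Y_power_indet_other\<close>)
  also have "\<dots> = h * ?q v" unfolding v(2) by (rule div_Y_power_mult) (rule hY)
  finally have "u - (\<Sum>i\<in>V. indet (Y i) ^ s i * ?q (g i)) \<in> (*) h ` bipolys m n"
    using div_Y_power_closed[OF v(1)] by blast
  then show "\<exists>g'. (\<forall>i. g' i \<in> bipolys m n) \<and>
      u - (\<Sum>i\<in>V. indet (Y i) ^ s i * g' i) \<in> (*) h ` bipolys m n"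
    using div_Y_power_closed[OF g] by (intro exI[of _ "\<lambda>i. ?q (g i)"]) simp
qed

text \<open>
  The class of \<open>1 / (Y 1 \<cdots> Y n)\<close> is not zero: if all \<open>X i\<close> are set to \<open>0\<close>, then \<open>fS\<close> vanishes, and
  \<open>(Y 1 \<cdots> Y n) ^ e\<close> does not lie in the ideal generated by the \<open>Y j ^ (1 + e)\<close>.
\<close>

lemma not_cech_exact_top:
  assumes f: "f \<in> bipolys m n" "\<And>t. t \<in> keys f \<Longrightarrow> xdeg t \<noteq> 0"
  shows "\<not> bipoly.cech_exact n (bipolys m n) ((*) f ` bipolys m n) n"
proof
  assume "bipoly.cech_exact n (bipolys m n) ((*) f ` bipolys m n) n"
  moreover have "1 \<in> bipolys m n" by (rule bipoly.one_closed)
  ultimately obtain e g where "(\<Prod>j\<in>{1..n}. indet (Y j) ^ e) * 1 -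
      (\<Sum>j\<in>{1..n}. indet (Y j) ^ (1 + e) * g j) \<in> (*) f ` bipolys m n"
    unfolding bipoly.cech_exact_top_iff[OF bipoly.submod_A] by blast
  then obtain v where v: "mono_poly (y_monom n (\<lambda>_. e)) -
      (\<Sum>j\<in>{1..n}. indet (Y j) ^ (1 + e) * g j) = f * v"
    unfolding prod_indet by auto
  let ?s = "y_monom n (\<lambda>_. e)"
  have "lookup (\<Sum>j\<in>{1..n}. indet (Y j) ^ (1 + e) * g j) ?s = 0"
    unfolding lookup_sum by (intro sum.neutral ballI lookup_power_indet_mult) simp
  moreover have "lookup (f * v) ?s = 0"
  proof (rule ccontr)
    assume "lookup (f * v) ?s \<noteq> 0"
    then have "?s \<in> keys (f * v)" by (simp add: in_keys_iff)
    then obtain t r where "t \<in> keys f" "?s = t + r" using keys_mult[of f v] by blast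
    then have "xdeg ?s = xdeg t + xdeg r" by (simp add: xdeg_add)
    moreover have "xdeg ?s = 0" by (simp add: xdeg_eq_0_iff)
    ultimately show False using f(2)[OF \<open>t \<in> keys f\<close>] by simp
  qed
  ultimately show False using arg_cong[OF v, of "\<lambda>u. lookup u ?s"] by (simp add: lookup_minus)
qed

text \<open>The top local cohomology of \<open>S/hS\<close> is the colimit of the quotients of \<open>S\<close> by these ideals.\<close>

definition top_ideal :: "nat \<Rightarrow> nat \<Rightarrow> 'k::field bipoly \<Rightarrow> nat \<Rightarrow> 'k bipoly set" where
  "top_ideal m n h k = {(\<Sum>j\<in>{1..n}. indet (Y j) ^ k * g j) + h * v | g v.
     (\<forall>j. g j \<in> bipolys m n) \<and> v \<in> bipolys m n}"

lemma submod_top_ideal: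
  fixes h :: "'k::field bipoly"
  shows "bipoly.submod m n (top_ideal m n h k)"
  unfolding bipoly.submod_def
proof (intro conjI ballI)
  show "0 \<in> top_ideal m n h k"
    unfolding top_ideal_def by (intro CollectI exI[of _ "\<lambda>_. 0"] exI[of _ 0]) simp
next
  fix u w assume "u \<in> top_ideal m n h k" "w \<in> top_ideal m n h k"
  then obtain g v g' v' where "u = (\<Sum>j\<in>{1..n}. indet (Y j) ^ k * g j) + h * v"
    "w = (\<Sum>j\<in>{1..n}. indet (Y j) ^ k * g' j) + h * v'" and
    "\<And>j. g j \<in> bipolys m n" "v \<in> bipolys m n" "\<And>j. g' j \<in> bipolys m n" "v' \<in> bipolys m n"
    unfolding top_ideal_def by blast
  then show "u + w \<in> top_ideal m n h k"
    unfolding top_ideal_def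
    by (intro CollectI exI[of _ "\<lambda>j. g j + g' j"] exI[of _ "v + v'"])
      (simp add: bipolys_add distrib_left sum.distrib)
next
  fix c u :: "'k bipoly"
  assume "u \<in> top_ideal m n h k" and c: "c \<in> bipolys m n"
  then obtain g v where "u = (\<Sum>j\<in>{1..n}. indet (Y j) ^ k * g j) + h * v" and
    "\<And>j. g j \<in> bipolys m n" "v \<in> bipolys m n"
    unfolding top_ideal_def by blast
  then show "c * u \<in> top_ideal m n h k"
    unfolding top_ideal_def using c
    by (intro CollectI exI[of _ "\<lambda>j. c * g j"] exI[of _ "c * v"])
      (simp add: bipolys_mult distrib_left sum_distrib_left ac_simps)
qed

lemma multiple_in_top_ideal: "v \<in> bipolys m n \<Longrightarrow> h * v \<in> top_ideal m n h k"
  unfolding top_ideal_def by (intro CollectI exI[of _ "\<lambda>_. 0"] exI[of _ v]) simp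

lemma power_in_top_ideal:
  assumes "keys s \<subseteq> vars m n" "j \<in> {1..n}" "k \<le> lookup s (Y j)"
  shows "mono_poly s \<in> top_ideal m n h k"
proof -
  define r where "r = s - single (Y j) k"
  have s: "s = single (Y j) k + r"
    unfolding r_def by (rule poly_mapping_eqI) (use assms(3) in \<open>auto simp: lookup_add lookup_minus lookup_single when_def\<close>)
  then have "keys r \<subseteq> vars m n" using assms(1) by (auto simp: keys_monom_add)
  moreover have "mono_poly s = (\<Sum>i\<in>{1..n}. indet (Y i) ^ k * (if i = j then mono_poly r else 0)) + h * 0"
    using assms(2) by (simp add: if_distrib[of "\<lambda>u. _ * u"] sum.delta indet_power mult_single s[symmetric] cong: if_cong)
  ultimately show ?thesis
    unfolding top_ideal_def
    by (intro CollectI exI[of _ "\<lambda>i. if i = j then mono_poly r else 0"] exI[of _ 0]) (auto intro: bipolys_single)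
qed

lemma finite_monoms: "finite {\<beta>. y_part \<beta> = \<beta> \<and> keys \<beta> \<subseteq> vars m n \<and> ydeg \<beta> = c}"
proof (rule finite_imageD)
  have "finite (vars m n)" by (simp add: vars_def)
  then have "finite {f. \<forall>v. (v \<in> vars m n \<longrightarrow> f v \<in> {..c}) \<and> (v \<notin> vars m n \<longrightarrow> f v = 0)}"
    by (rule finite_set_of_finite_funs) simp
  moreover have "lookup ` {\<beta>. y_part \<beta> = \<beta> \<and> keys \<beta> \<subseteq> vars m n \<and> ydeg \<beta> = c} \<subseteq>
      {f. \<forall>v. (v \<in> vars m n \<longrightarrow> f v \<in> {..c}) \<and> (v \<notin> vars m n \<longrightarrow> f v = 0)}"
  proof (intro subsetI CollectI allI)
    fix f v assume "f \<in> lookup ` {\<beta>. y_part \<beta> = \<beta> \<and> keys \<beta> \<subseteq> vars m n \<and> ydeg \<beta> = c}"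
    then obtain \<beta> where \<beta>: "f = lookup \<beta>" "y_part \<beta> = \<beta>" "keys \<beta> \<subseteq> vars m n" "ydeg \<beta> = c" by blast
    have "lookup \<beta> v \<le> c"
      using y_only_X[OF \<beta>(2)] lookup_le_ydeg[of \<beta>] \<beta>(4) by (cases v) auto
    then show "(v \<in> vars m n \<longrightarrow> f v \<in> {..c}) \<and> (v \<notin> vars m n \<longrightarrow> f v = 0)"
      using \<beta> by (auto simp: in_keys_iff)
  qed
  ultimately show "finite (lookup ` {\<beta>. y_part \<beta> = \<beta> \<and> keys \<beta> \<subseteq> vars m n \<and> ydeg \<beta> = c})"
    by (rule finite_subset[rotated])
  show "inj_on lookup {\<beta>. y_part \<beta> = \<beta> \<and> keys \<beta> \<subseteq> vars m n \<and> ydeg \<beta> = c}"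
    unfolding inj_on_def poly_mapping_eq_iff by blast
qed

lemma bipoly_comp_keys:
  "h \<in> bipoly_comp m n (int a, int b) \<Longrightarrow> t \<in> keys h \<Longrightarrow> xdeg t = a \<and> ydeg t = b \<and> keys t \<subseteq> vars m n"
  by (auto simp: bipoly_comp_def mem_bipolys)

lemma xdeg_0_y_only: "xdeg t = 0 \<Longrightarrow> y_part t = t"
  using x_part_add_y_part[of t] by (simp add: xdeg_eq_0_iff)

text \<open>
  The monomial with exponents \<open>k - 1 - \<beta>\<close> stands for the inverse monomial \<open>1 / Y\<^sup>1\<^sup>+\<^sup>\<beta>\<close> with denominator
  exponent \<open>k\<close>.  Multiplication by \<open>h\<close> is triangular on inverse monomials: if \<open>\<alpha>\<close> is the leading monomial of
  \<open>h\<close>, then \<open>h / Y\<^sup>1\<^sup>+\<^sup>\<beta>\<^sup>+\<^sup>\<alpha>\<close> is a non-zero multiple of \<open>1 / Y\<^sup>1\<^sup>+\<^sup>\<beta>\<close> plus multiples of \<open>1 / Y\<^sup>1\<^sup>+\<^sup>\<beta>\<^sup>'\<close>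
  with \<open>\<beta>' > \<beta>\<close> of the same degree, and these are finitely many.  The bound on \<open>k\<close> makes all exponents that
  occur representable.
\<close>

lemma complement_in_top_ideal:
  assumes h: "h \<in> bipoly_comp m n (0, int b)" "h \<noteq> 0" and k: "c + b < k"
    and \<beta>: "y_part \<beta> = \<beta>" "keys \<beta> \<subseteq> vars m n" "ydeg \<beta> = c"
  shows "mono_poly (y_monom n (\<lambda>j. k - 1 - lookup \<beta> (Y j))) \<in> top_ideal m n h k"
  using \<beta>
proof (induction "card {\<beta>'. y_part \<beta>' = \<beta>' \<and> keys \<beta>' \<subseteq> vars m n \<and> ydeg \<beta>' = c \<and> \<beta> < \<beta>'}"
    arbitrary: \<beta> rule: less_induct)
  case less
  note \<beta> = less.prems
  have h': "xdeg t = 0 \<and> ydeg t = b \<and> keys t \<subseteq> vars m n" if "t \<in> keys h" for t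
    using bipoly_comp_keys[of h m n 0 b] h that by simp
  define \<alpha> where "\<alpha> = Max (keys h)"
  have \<alpha>: "\<alpha> \<in> keys h" unfolding \<alpha>_def using h(2) by (intro Max_in) auto
  have max: "\<gamma> < \<alpha>" if "\<gamma> \<in> keys h" "\<gamma> \<noteq> \<alpha>" for \<gamma>
    unfolding \<alpha>_def by (intro le_neq_trans Max_ge) (use that in \<open>auto simp: \<alpha>_def\<close>)
  have le: "lookup \<beta> (Y j) + lookup \<alpha> (Y j) < k" for j
    using lookup_le_ydeg[of \<beta> j] lookup_le_ydeg[of \<alpha> j] \<beta>(3) h'[OF \<alpha>] k by simp
  define \<mu> where "\<mu> = y_monom n (\<lambda>j. k - 1 - lookup \<beta> (Y j) - lookup \<alpha> (Y j))"
  have keys_\<mu>: "keys \<mu> \<subseteq> vars m n" unfolding \<mu>_def by (rule keys_y_monom)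
  have smaller: "single (\<gamma> + \<mu>) (lookup h \<gamma>) \<in> top_ideal m n h k"
    if \<gamma>: "\<gamma> \<in> keys h" "\<gamma> \<noteq> \<alpha>" for \<gamma>
  proof -
    have keys: "keys (\<gamma> + \<mu>) \<subseteq> vars m n" using h'[OF \<gamma>(1)] keys_\<mu> by (simp add: keys_monom_add)
    have \<gamma>_y: "y_part \<gamma> = \<gamma>" using h'[OF \<gamma>(1)] xdeg_0_y_only by blast
    have "mono_poly (\<gamma> + \<mu>) \<in> top_ideal m n h k"
    proof (cases "\<exists>j\<in>{1..n}. k \<le> lookup (\<gamma> + \<mu>) (Y j)")
      case True then show ?thesis using power_in_top_ideal[OF keys] by blast
    next
      case False
      define \<beta>' where "\<beta>' = y_monom n (\<lambda>j. k - 1 - lookup (\<gamma> + \<mu>) (Y j))"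
      have small: "lookup (\<gamma> + \<mu>) (Y j) < k" if "j \<in> {1..n}" for j using False that by force
      have sum: "\<beta>' + \<gamma> = \<beta> + \<alpha>"
      proof (rule poly_mapping_eqI)
        fix v
        show "lookup (\<beta>' + \<gamma>) v = lookup (\<beta> + \<alpha>) v"
        proof (cases v)
          case (X i)
          then show ?thesis
            using y_only_X[OF \<gamma>_y] y_only_X[OF \<beta>(1)] y_only_X[of \<alpha>] xdeg_0_y_only[of \<alpha>] h'[OF \<alpha>]
            by (simp add: lookup_add \<beta>'_def)
        next
          case (Y j)
          show ?thesis
          proof (cases "j \<in> {1..n}")
            case True
            then show ?thesis using small[OF True] le[of j] Y by (simp add: lookup_add \<beta>'_def \<mu>_def)
          next
            case False
            have "lookup \<gamma> (Y j) = 0" "lookup \<alpha> (Y j) = 0" "lookup \<beta> (Y j) = 0"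
              using lookup_outside[OF _ False, where m = m] h'[OF \<gamma>(1)] h'[OF \<alpha>] \<beta>(2) by blast+
            then show ?thesis using False Y by (auto simp: lookup_add \<beta>'_def)
          qed
        qed
      qed
      have \<beta>': "y_part \<beta>' = \<beta>'" "keys \<beta>' \<subseteq> vars m n" by (simp_all add: \<beta>'_def keys_y_monom)
      have deg: "ydeg \<beta>' = c"
        using arg_cong[OF sum, of ydeg] h'[OF \<gamma>(1)] h'[OF \<alpha>] \<beta>(3) by (simp add: ydeg_add)
      have "\<beta> < \<beta>'"
      proof (rule ccontr)
        assume "\<not> \<beta> < \<beta>'"
        then have "\<beta>' + \<gamma> < \<beta> + \<alpha>" using max[OF \<gamma>] by (intro add_le_less_mono) auto
        then show False using sum by simp
      qed
      then have "{\<beta>''. y_part \<beta>'' = \<beta>'' \<and> keys \<beta>'' \<subseteq> vars m n \<and> ydeg \<beta>'' = c \<and> \<beta>' < \<beta>''} \<subset>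
          {\<beta>''. y_part \<beta>'' = \<beta>'' \<and> keys \<beta>'' \<subseteq> vars m n \<and> ydeg \<beta>'' = c \<and> \<beta> < \<beta>''}"
        using \<beta>' deg by (auto intro: less_trans)
      moreover have "finite {\<beta>''. y_part \<beta>'' = \<beta>'' \<and> keys \<beta>'' \<subseteq> vars m n \<and> ydeg \<beta>'' = c \<and> \<beta> < \<beta>''}"
        by (rule finite_subset[OF _ finite_monoms[of m n c]]) auto
      ultimately have "mono_poly (y_monom n (\<lambda>j. k - 1 - lookup \<beta>' (Y j))) \<in> top_ideal m n h k"
        using \<beta>' deg by (intro less.hyps psubset_card_mono)
      moreover have "y_monom n (\<lambda>j. k - 1 - lookup \<beta>' (Y j)) = \<gamma> + \<mu>"
      proof (rule poly_mapping_eqI)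
        fix v
        show "lookup (y_monom n (\<lambda>j. k - 1 - lookup \<beta>' (Y j))) v = lookup (\<gamma> + \<mu>) v"
        proof (cases v)
          case (X i) then show ?thesis using y_only_X[OF \<gamma>_y] by (simp add: lookup_add \<mu>_def)
        next
          case (Y j)
          show ?thesis
          proof (cases "j \<in> {1..n}")
            case True then show ?thesis using small[OF True] Y by (simp add: \<beta>'_def)
          next
            case False then show ?thesis using lookup_outside[OF keys False] Y by auto
          qed
        qed
      qed
      ultimately show ?thesis by simp
    qed
    then have "const_poly (lookup h \<gamma>) * mono_poly (\<gamma> + \<mu>) \<in> top_ideal m n h k"
      by (intro bipoly.submod_mult[OF submod_top_ideal] bipolys_single) simp_all
    then show ?thesis by simp
  qed
  have "h * mono_poly \<mu> = (\<Sum>\<gamma>\<in>keys h. single (\<gamma> + \<mu>) (lookup h \<gamma>))"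
    by (subst sum_monomials[of h, symmetric]) (simp add: sum_distrib_right mult_single)
  also have "\<dots> = single (\<alpha> + \<mu>) (lookup h \<alpha>) +
      (\<Sum>\<gamma>\<in>keys h - {\<alpha>}. single (\<gamma> + \<mu>) (lookup h \<gamma>))"
    by (rule sum.remove) (use \<alpha> in auto)
  finally have "single (\<alpha> + \<mu>) (lookup h \<alpha>) = h * mono_poly \<mu> -
      (\<Sum>\<gamma>\<in>keys h - {\<alpha>}. single (\<gamma> + \<mu>) (lookup h \<gamma>))" by simp
  also have "\<dots> \<in> top_ideal m n h k"
    by (intro bipoly.submod_diff[OF submod_top_ideal] bipoly.submod_sum[OF submod_top_ideal]
        multiple_in_top_ideal bipolys_single keys_\<mu> smaller) auto
  finally have "const_poly (inverse (lookup h \<alpha>)) * single (\<alpha> + \<mu>) (lookup h \<alpha>) \<in> top_ideal m n h k"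
    by (intro bipoly.submod_mult[OF submod_top_ideal] bipolys_single) simp_all
  moreover have "\<alpha> + \<mu> = y_monom n (\<lambda>j. k - 1 - lookup \<beta> (Y j))"
  proof (rule poly_mapping_eqI)
    fix v
    show "lookup (\<alpha> + \<mu>) v = lookup (y_monom n (\<lambda>j. k - 1 - lookup \<beta> (Y j))) v"
    proof (cases v)
      case (X i)
      then show ?thesis using y_only_X[of \<alpha>] xdeg_0_y_only[of \<alpha>] h'[OF \<alpha>] by (simp add: lookup_add \<mu>_def)
    next
      case (Y j)
      show ?thesis
      proof (cases "j \<in> {1..n}")
        case True then show ?thesis using le[of j] Y by (simp add: lookup_add \<mu>_def)
      next
        case False
        then show ?thesis using lookup_outside[OF _ False, of \<alpha> m] h'[OF \<alpha>] Y by (auto simp: lookup_add \<mu>_def)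
      qed
    qed
  qed
  ultimately show ?case using \<alpha> by (simp add: mult_single in_keys_iff)
qed

text \<open>
  By triangularity, \<open>h\<close> acts surjectively on the top local cohomology of \<open>S\<close>.
\<close>

lemma cech_exact_top_no_X:
  fixes h :: "'k::field bipoly"
  assumes h: "h \<in> bipoly_comp m n (0, int b)" "h \<noteq> 0"
  shows "bipoly.cech_exact n (bipolys m n) ((*) h ` bipolys m n) n"
  unfolding bipoly.cech_exact_top_iff[OF bipoly.submod_A]
proof (intro allI ballI)
  fix t and u :: "'k bipoly"
  assume u: "u \<in> bipolys m n"
  \<comment> \<open>A monomial \<open>\<beta>\<close> in the \<open>Y j\<close> with all exponents below \<open>t\<close> has degree at most \<open>n * t\<close>.\<close>
  define e where "e = Suc (n * t + b)"
  note I = submod_top_ideal[of m n h "t + e"]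
  have mono: "mono_poly (y_monom n (\<lambda>_. e)) * mono_poly s \<in> top_ideal m n h (t + e)"
    if s: "keys s \<subseteq> vars m n" for s
  proof (cases "\<exists>j\<in>{1..n}. t \<le> lookup s (Y j)")
    case True
    then obtain j where j: "j \<in> {1..n}" "t \<le> lookup s (Y j)" by blast
    have "mono_poly (y_monom n (\<lambda>_. e) + s) \<in> top_ideal m n h (t + e)"
      by (rule power_in_top_ideal[OF _ j(1)])
        (use j s keys_y_monom[of n "\<lambda>_. e" m] in \<open>auto simp: keys_monom_add lookup_add\<close>)
    then show ?thesis by (simp add: mult_single)
  next
    case False
    then have small: "lookup s (Y j) < t" if "j \<in> {1..n}" for j using that by force
    define \<beta> where "\<beta> = y_monom n (\<lambda>j. t - 1 - lookup s (Y j))"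
    have "ydeg \<beta> \<le> (\<Sum>j\<in>{1..n}. t)" unfolding \<beta>_def ydeg_y_monom by (rule sum_mono) simp
    then have "ydeg \<beta> + b < t + e" by (simp add: e_def)
    then have "mono_poly (y_monom n (\<lambda>j. t + e - 1 - lookup \<beta> (Y j))) \<in> top_ideal m n h (t + e)"
      by (intro complement_in_top_ideal[OF h]) (auto simp: \<beta>_def keys_y_monom)
    then have "mono_poly (x_part s) * mono_poly (y_monom n (\<lambda>j. t + e - 1 - lookup \<beta> (Y j))) \<in> top_ideal m n h (t + e)"
    proof (intro bipoly.submod_mult[OF I] bipolys_single)
      show "keys (x_part s) \<subseteq> vars m n"
        using s x_part_add_y_part[of s] keys_monom_add[of "x_part s" "y_part s"] by auto
    qed
    moreover have "x_part s + y_monom n (\<lambda>j. t + e - 1 - lookup \<beta> (Y j)) = y_monom n (\<lambda>_. e) + s"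
    proof (rule poly_mapping_eqI)
      fix v
      show "lookup (x_part s + y_monom n (\<lambda>j. t + e - 1 - lookup \<beta> (Y j))) v = lookup (y_monom n (\<lambda>_. e) + s) v"
      proof (cases v)
        case (X i) then show ?thesis by (simp add: lookup_add lookup_x_part)
      next
        case (Y j)
        show ?thesis
        proof (cases "j \<in> {1..n}")
          case True
          then show ?thesis using small[OF True] Y by (simp add: lookup_add lookup_x_part \<beta>_def)
        next
          case False
          then show ?thesis using lookup_outside[OF s False] Y by (auto simp: lookup_add lookup_x_part)
        qed
      qed
    qed
    ultimately show ?thesis by (simp add: mult_single)
  qed
  have "mono_poly (y_monom n (\<lambda>_. e)) * u =
      (\<Sum>s\<in>keys u. const_poly (lookup u s) * (mono_poly (y_monom n (\<lambda>_. e)) * mono_poly s))"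
    by (subst sum_monomials[of u, symmetric]) (simp add: sum_distrib_left mult_single)
  also have "\<dots> \<in> top_ideal m n h (t + e)"
  proof (rule bipoly.submod_sum[OF I])
    fix s assume s: "s \<in> keys u"
    show "const_poly (lookup u s) * (mono_poly (y_monom n (\<lambda>_. e)) * mono_poly s) \<in> top_ideal m n h (t + e)"
      by (rule bipoly.submod_mult[OF I bipolys_single mono]) (use u s in \<open>auto simp: mem_bipolys\<close>)
  qed
  finally obtain g v where "mono_poly (y_monom n (\<lambda>_. e)) * u =
      (\<Sum>j\<in>{1..n}. indet (Y j) ^ (t + e) * g j) + h * v" "\<And>j. g j \<in> bipolys m n" "v \<in> bipolys m n"
    unfolding top_ideal_def by blast
  then show "\<exists>e g. (\<forall>j. g j \<in> bipolys m n) \<and>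
      (\<Prod>i\<in>{1..n}. indet (Y i) ^ e) * u - (\<Sum>j\<in>{1..n}. indet (Y j) ^ (t + e) * g j) \<in> (*) h ` bipolys m n"
    unfolding prod_indet by (intro exI[of _ e] exI[of _ g]) auto
qed

lemma keys_monom_minus: "keys (s - t :: monom) \<subseteq> keys s"
  by (auto simp: in_keys_iff lookup_minus)

lemma sum_indet_of_no_constant:
  assumes u: "u \<in> bipolys m n" "\<And>t. t \<in> keys u \<Longrightarrow> ydeg t \<noteq> 0"
  shows "\<exists>v. (\<forall>j. v j \<in> bipolys m n) \<and> u = (\<Sum>j\<in>{1..n}. indet (Y j) * v j)"
proof -
  have "\<exists>j\<in>{1..n}. lookup t (Y j) \<noteq> 0" if t: "t \<in> keys u" for t
  proof (rule ccontr)
    assume none: "\<not> ?thesis"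
    have "keys t \<subseteq> vars m n" using t u(1) by (simp add: mem_bipolys)
    then have "lookup t (Y j) = 0" for j using none lookup_outside[of t m n j] by blast
    then have "y_part t = 0"
      by (intro poly_mapping_eqI) (auto simp: lookup_y_part split: var.split)
    then show False using u(2)[OF t] by (simp add: ydeg_eq_0_iff)
  qed
  then obtain j where j: "\<And>t. t \<in> keys u \<Longrightarrow> j t \<in> {1..n}" "\<And>t. t \<in> keys u \<Longrightarrow> lookup t (Y (j t)) \<noteq> 0"
    by metis
  define q where "q t = single (t - single (Y (j t)) 1) (lookup u t)" for t
  define v where "v i = (\<Sum>t\<in>{t\<in>keys u. j t = i}. q t)" for i
  have "q t \<in> bipolys m n" if "t \<in> keys u" for t
    unfolding q_def
  proof (rule bipolys_single)
    show "keys (t - single (Y (j t)) 1) \<subseteq> vars m n"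
      using u(1) that keys_monom_minus[of t] unfolding mem_bipolys by blast
  qed
  then have v: "v i \<in> bipolys m n" for i unfolding v_def by (intro bipolys_sum) auto
  have term_eq: "indet (Y (j t)) * q t = single t (lookup u t)" if "t \<in> keys u" for t
    using monom_minus_add[OF j(2)[OF that]]
    by (simp add: q_def indet_def mult_single add.commute del: One_nat_def)
  have "(\<Sum>i\<in>{1..n}. indet (Y i) * v i) = (\<Sum>i\<in>{1..n}. \<Sum>t\<in>{t\<in>keys u. j t = i}. single t (lookup u t))"
    unfolding v_def sum_distrib_left by (intro sum.cong refl) (use term_eq in auto)
  also have "\<dots> = (\<Sum>t\<in>keys u. single t (lookup u t))"
    by (rule sum.group) (use j(1) in auto)
  also have "\<dots> = u" by (rule sum_monomials)
  finally show ?thesis using v by (intro exI[of _ v]) simp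
qed

lemma koszul_exact_polynomial_ring:
  assumes "p < n"
  shows "bipoly.koszul_exact n (bipolys m n) {0::'k::field bipoly} s p"
proof -
  have "(*) 0 ` bipolys m n = {0::'k bipoly}" using bipolys_0 by (auto intro!: image_eqI[of _ _ 0])
  then show ?thesis using koszul_exact_no_Y[of "0::'k bipoly" m n p s] assms by simp
qed

text \<open>The regular sequence of the \<open>Y j\<close> leaves only the top degree, where \<open>1 / (Y 1 \<cdots> Y n)\<close> survives.\<close>

lemma cech_exact_no_Y_iff:
  assumes h: "h \<in> bipoly_comp m n (int a, 0)" and a: "a \<noteq> 0"
  shows "bipoly.cech_exact n (bipolys m n) ((*) h ` bipolys m n) p \<longleftrightarrow> p \<noteq> n"
proof -
  have hS: "h \<in> bipolys m n" using h by (simp add: bipoly_comp_def)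
  have keys: "xdeg t = a" "ydeg t = 0" if "t \<in> keys h" for t
    using bipoly_comp_keys[of h m n a 0] h that by auto
  consider "p < n" | "p = n" | "n < p" by linarith
  then show ?thesis
  proof cases
    case 1
    have "bipoly.koszul_exact n (bipolys m n) ((*) h ` bipolys m n) s p" for s
      by (rule koszul_exact_no_Y[OF hS _ 1]) (use keys in \<open>simp add: ydeg_eq_0_iff\<close>)
    then show ?thesis using 1 bipoly.cech_exact_if_koszul_exact by blast
  next
    case 2 then show ?thesis using not_cech_exact_top[OF hS] keys a by blast
  next
    case 3 then show ?thesis using bipoly.cech_exact_above[OF 3 bipoly.submod_A] by simp
  qed
qed

text \<open>
  The exact sequence of multiplication by \<open>h\<close> on \<open>S\<close> leaves the degrees \<open>n - 1\<close> and \<open>n\<close>, and surjectivity of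
  \<open>h\<close> on the top local cohomology of \<open>S\<close> removes \<open>n\<close>.  If degree \<open>n - 1\<close> vanished as well, then
  \<open>hS \<inter> Q = hQ\<close> by depth sensitivity; but \<open>h\<close> lies in \<open>Q\<close> and not in \<open>hQ\<close>.
\<close>

lemma cech_exact_no_X_iff:
  fixes h :: "'k::field bipoly"
  assumes h: "h \<in> bipoly_comp m n (0, int b)" "h \<noteq> 0" and b: "b \<noteq> 0"
  shows "bipoly.cech_exact n (bipolys m n) ((*) h ` bipolys m n) p \<longleftrightarrow> Suc p \<noteq> n" and "n \<noteq> 0"
proof -
  have hS: "h \<in> bipolys m n" using h by (simp add: bipoly_comp_def)
  have keys: "xdeg t = 0" "ydeg t = b" if "t \<in> keys h" for t
    using bipoly_comp_keys[of h m n 0 b] h that by auto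
  note sub = bipoly.submod_multiples[OF hS] bipoly.multiples_subset[OF hS]
  obtain u where u: "\<And>j. u j \<in> bipolys m n" "h = (\<Sum>j\<in>{1..n}. indet (Y j) * u j)"
    using sum_indet_of_no_constant[OF hS] keys b by metis
  show n: "n \<noteq> 0"
  proof
    assume "n = 0"
    then show False using u(2) h(2) by simp
  qed
  have below: "bipoly.cech_exact n (bipolys m n) ((*) h ` bipolys m n) p" if "Suc p < n" for p
  proof (rule bipoly.cech_exact_if_koszul_exact)
    fix t
    show "bipoly.koszul_exact n (bipolys m n) ((*) h ` bipolys m n) (\<lambda>_. t) p"
    proof (rule bipoly.koszul_exact_mod_nonzerodivisor[OF hS])
      show "bipoly.koszul_exact n (bipolys m n) {0} (\<lambda>_. t) p"
        by (rule koszul_exact_polynomial_ring) (use that in simp)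
      show "bipoly.koszul_exact n (bipolys m n) {0} (\<lambda>_. t) (Suc p)"
        by (rule koszul_exact_polynomial_ring) (rule that)
    qed (use h(2) in simp)
  qed
  have critical: "\<not> bipoly.cech_exact n (bipolys m n) ((*) h ` bipolys m n) (n - 1)"
  proof
    assume "bipoly.cech_exact n (bipolys m n) ((*) h ` bipolys m n) (n - 1)"
    then have all: "bipoly.cech_exact n (bipolys m n) ((*) h ` bipolys m n) q" if "q < n" for q
      using below[of q] that by (cases "Suc q = n") auto
    have ex: "bipoly.koszul_exact n (bipolys m n) ((*) h ` bipolys m n) (\<lambda>_. 1) (n - 1)"
      by (rule bipoly.koszul_exact_if_cech_exact[OF bipoly.submod_A sub all]) (use n in auto)
    have "h \<in> (*) h ` bipolys m n"
      using bipoly.one_closed by (intro image_eqI[of _ _ 1]) auto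
    then have "\<exists>g. (\<forall>j. g j \<in> (*) h ` bipolys m n) \<and>
        (\<Sum>j\<in>{1..n}. indet (Y j) * u j) = (\<Sum>j\<in>{1..n}. indet (Y j) * g j)"
      by (intro bipoly.koszul_exact_relation[OF sub _ ex u(1)]) (use n u(2) in auto)
    then obtain g where g: "\<And>j. g j \<in> (*) h ` bipolys m n"
      "(\<Sum>j\<in>{1..n}. indet (Y j) * u j) = (\<Sum>j\<in>{1..n}. indet (Y j) * g j)" by blast
    have h_eq: "h = (\<Sum>j\<in>{1..n}. indet (Y j) * g j)" using u(2) g(2) by (rule trans)
    have "\<forall>j. \<exists>v. v \<in> bipolys m n \<and> g j = h * v" using g(1) by blast
    then obtain v where v: "\<And>j. g j = h * v j" by metis
    have "h * (1 - (\<Sum>j\<in>{1..n}. indet (Y j) * v j)) = 0"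
      using h_eq by (simp add: v right_diff_distrib sum_distrib_left mult.left_commute)
    then have "1 = (\<Sum>j\<in>{1..n}. indet (Y j) ^ 1 * v j)" using h(2) by simp
    moreover have "lookup (\<Sum>j\<in>{1..n}. indet (Y j) ^ 1 * v j) 0 = 0"
      unfolding lookup_sum by (intro sum.neutral ballI lookup_power_indet_mult) simp
    ultimately have "lookup (1 :: 'k bipoly) 0 = 0" by (simp only:)
    then show False by simp
  qed
  consider "Suc p < n" | "Suc p = n" | "p = n" | "n < p" by linarith
  then show "bipoly.cech_exact n (bipolys m n) ((*) h ` bipolys m n) p \<longleftrightarrow> Suc p \<noteq> n"
  proof cases
    case 1 then show ?thesis using below by simp
  next
    case 2 then show ?thesis using critical by force
  next
    case 3 then show ?thesis using cech_exact_top_no_X[OF h] by simp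
  next
    case 4 then show ?thesis using bipoly.cech_exact_above[OF 4 bipoly.submod_A] by simp
  qed
qed

section \<open>Coefficients of the equation\<close>

text \<open>
  Depth \<open>n\<close> of \<open>S/I\<close> enters through the assumption \<open>tor\<close>, which says \<open>I \<inter> Q = Q I\<close>.  Hence a
  bihomogeneous \<open>u \<in> I\<close> of positive \<open>Y\<close>-degree is a combination of the \<open>Y j\<close> with coefficients in \<open>I\<close>,
  bihomogeneous of \<open>Y\<close>-degree one less, and one can argue by induction on the \<open>Y\<close>-degree.  An ideal
  that is closed under these divisions is extended from \<open>K[X]\<close>.
\<close>

lemma div_Y_mem_graded_ideal:
  assumes I: "bipoly.submod m n I" "I \<subseteq> bipolys m n"
    and graded: "\<And>u d. u \<in> I \<Longrightarrow> hom_comp d u \<in> I"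
    and tor: "\<And>u. (\<And>j. j \<in> {1..n} \<Longrightarrow> u j \<in> bipolys m n) \<Longrightarrow> (\<Sum>j\<in>{1..n}. indet (Y j) * u j) \<in> I \<Longrightarrow>
      \<exists>g. (\<forall>j. g j \<in> I) \<and> (\<Sum>j\<in>{1..n}. indet (Y j) * u j) = (\<Sum>j\<in>{1..n}. indet (Y j) * g j)"
    and i: "i \<in> {1..n}"
  shows "u \<in> I \<Longrightarrow> u \<in> bipoly_comp m n (int a, int c) \<Longrightarrow> div_Y i u \<in> I"
proof (induction c arbitrary: u)
  case 0
  have "div_Y i u = 0"
  proof (rule poly_mapping_eqI)
    fix t
    have "t + single (Y i) 1 \<notin> keys u"
      using bipoly_comp_keys[OF 0(2)] ydeg_add[of t "single (Y i) 1"] by auto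
    then show "lookup (div_Y i u) t = lookup 0 t" by (simp add: lookup_div_Y in_keys_iff del: One_nat_def)
  qed
  then show ?case using bipoly.submod_0[OF I(1)] by simp
next
  case (Suc c)
  have u: "u \<in> bipolys m n" using Suc.prems I by blast
  obtain v where v: "\<And>j. v j \<in> bipolys m n" "u = (\<Sum>j\<in>{1..n}. indet (Y j) * v j)"
    using sum_indet_of_no_constant[OF u] bipoly_comp_keys[OF Suc.prems(2)] by fastforce
  obtain g where g: "\<And>j. g j \<in> I" "u = (\<Sum>j\<in>{1..n}. indet (Y j) * g j)"
    using tor[of v] v Suc.prems(1) by auto
  define g' where "g' j = hom_comp (int a, int c) (g j)" for j
  have g': "g' j \<in> I" "g' j \<in> bipoly_comp m n (int a, int c)" for j
    using graded[OF g(1)] hom_comp_mem[of "g j"] g(1)[of j] I(2) by (auto simp: g'_def)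
  have "u = hom_comp (int a, int (Suc c)) u" using hom_comp_id[OF Suc.prems(2)] by simp
  also have "\<dots> = (\<Sum>j\<in>{1..n}. hom_comp (int a, int (Suc c)) (indet (Y j) * g j))"
    by (subst g(2)) (rule hom_comp_sum)
  also have "\<dots> = (\<Sum>j\<in>{1..n}. indet (Y j) * g' j)"
  proof (rule sum.cong)
    fix j
    have "hom_comp (int a, int (Suc c)) (indet (Y j) * g j) =
        indet (Y j) * hom_comp (int a - int 0, int (Suc c) - int 1) (g j)"
      by (rule hom_comp_mult) (simp add: indet_def)
    then show "hom_comp (int a, int (Suc c)) (indet (Y j) * g j) = indet (Y j) * g' j"
      by (simp add: g'_def)
  qed simp
  finally have "div_Y i u = (\<Sum>j\<in>{1..n}. div_Y i (indet (Y j) * g' j))" by (simp add: div_Y_sum)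
  also have "\<dots> \<in> I"
  proof (rule bipoly.submod_sum[OF I(1)])
    fix j assume j: "j \<in> {1..n}"
    show "div_Y i (indet (Y j) * g' j) \<in> I"
    proof (cases "j = i")
      case True then show ?thesis using g'(1) by (simp add: div_Y_indet)
    next
      case False
      then have "div_Y i (indet (Y j) * g' j) = indet (Y j) * div_Y i (g' j)"
        using div_Y_indet_other[of j i 1] by simp
      then show ?thesis using Suc.IH[OF g'] by (simp add: bipoly.submod_mult[OF I(1) indet_closed[OF j]])
    qed
  qed
  finally show ?case .
qed

lemma y_coeff_step:
  assumes "y_part \<beta> = \<beta>" "lookup \<beta> (Y j) \<noteq> 0"
  shows "y_coeff \<beta> u = y_coeff (\<beta> - single (Y j) 1) (div_Y j u)"
  unfolding y_coeff_def div_Y_def lin_ext_lin_ext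
proof (rule lin_ext_cong)
  fix t
  let ?e = "single (Y j) 1"
  show "(if y_part t = \<beta> then mono_poly (x_part t) else 0) =
      lin_ext (\<lambda>t. if y_part t = \<beta> - ?e then mono_poly (x_part t) else 0)
        (if lookup t (Y j) = 0 then 0 else mono_poly (t - ?e))"
  proof (cases "lookup t (Y j) = 0")
    case True
    then have "y_part t \<noteq> \<beta>" using assms lookup_y_part[of t "Y j"] by auto
    then show ?thesis using True by simp
  next
    case False
    note t = monom_minus_add[OF False]
    have "y_part t = y_part (t - ?e) + ?e" "x_part t = x_part (t - ?e)"
      using y_part_add[of "t - ?e" ?e] x_part_add[of "t - ?e" ?e]
      unfolding t y_part_single_Y x_part_single_Y by simp_all
    moreover have "\<beta> = (\<beta> - ?e) + ?e" using monom_minus_add[OF assms(2)] by simp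
    ultimately have "y_part t = \<beta> \<longleftrightarrow> y_part (t - ?e) = \<beta> - ?e" "x_part t = x_part (t - ?e)"
      by (metis add_right_cancel)+
    then show ?thesis using False by (simp del: One_nat_def)
  qed
qed

text \<open>
  The \<open>K[X]\<close>-coefficient of \<open>Y\<^sup>\<beta>\<close> in a polynomial of \<open>Y\<close>-degree \<open>ydeg \<beta>\<close> is obtained by iterated
  division.
\<close>

lemma y_coeff_mem:
  assumes I: "bipoly.submod m n I" "I \<subseteq> bipolys m n"
    and div: "\<And>i u c. i \<in> {1..n} \<Longrightarrow> u \<in> I \<Longrightarrow> u \<in> bipoly_comp m n (int a, int c) \<Longrightarrow> div_Y i u \<in> I"
  shows "u \<in> I \<Longrightarrow> u \<in> bipoly_comp m n (int a, int c) \<Longrightarrow> y_part \<beta> = \<beta> \<Longrightarrow> keys \<beta> \<subseteq> vars m n \<Longrightarrow>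
    ydeg \<beta> = c \<Longrightarrow> y_coeff \<beta> u \<in> I"
proof (induction c arbitrary: u \<beta>)
  case 0
  then have "\<beta> = 0" by (simp add: ydeg_eq_0_iff)
  have "y_coeff \<beta> u = lin_ext mono_poly u"
    unfolding y_coeff_def
  proof (rule lin_ext_cong)
    fix t assume "t \<in> keys u"
    then have "y_part t = 0" using bipoly_comp_keys[OF 0(2)] by (simp add: ydeg_eq_0_iff[symmetric])
    then show "(if y_part t = \<beta> then mono_poly (x_part t) else 0) = mono_poly t"
      using x_part_add_y_part[of t] \<open>\<beta> = 0\<close> by simp
  qed
  then show ?case using 0(1) by simp
next
  case (Suc c)
  let ?e = "\<lambda>j. single (Y j) (1::nat)"
  have "\<exists>j. lookup \<beta> (Y j) \<noteq> 0"
  proof (rule ccontr)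
    assume "\<not> ?thesis"
    then have "y_part \<beta> = 0" by (intro poly_mapping_eqI) (auto simp: lookup_y_part split: var.split)
    then show False using Suc.prems(5) by (simp add: ydeg_eq_0_iff[symmetric])
  qed
  then obtain j where j: "lookup \<beta> (Y j) \<noteq> 0" by blast
  then have jn: "j \<in> {1..n}" using lookup_outside[OF Suc.prems(4), of j] by (rule contrapos_np)
  note \<beta> = monom_minus_add[OF j]
  have "div_Y j u \<in> I" by (rule div[OF jn Suc.prems(1,2)])
  moreover have "div_Y j u \<in> bipoly_comp m n (int a, int c)"
    unfolding bipoly_comp_def
  proof (intro CollectI conjI ballI)
    show "div_Y j u \<in> bipolys m n" using Suc.prems(1) I by (blast intro: div_Y_closed)
    fix t assume "t \<in> keys (div_Y j u)"
    then have "t + ?e j \<in> keys u" by (simp add: in_keys_iff lookup_div_Y del: One_nat_def)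
    then show "(int (xdeg t), int (ydeg t)) = (int a, int c)"
      using bipoly_comp_keys[OF Suc.prems(2)] xdeg_add[of t "?e j"] ydeg_add[of t "?e j"] by auto
  qed
  moreover have "y_part (\<beta> - ?e j) = \<beta> - ?e j"
  proof (rule add_right_imp_eq)
    show "y_part (\<beta> - ?e j) + ?e j = (\<beta> - ?e j) + ?e j"
      using y_part_add[of "\<beta> - ?e j" "?e j"] unfolding \<beta> y_part_single_Y Suc.prems(3) by (rule sym)
  qed
  moreover have "keys (\<beta> - ?e j) \<subseteq> vars m n"
    using Suc.prems(4) keys_monom_minus[of \<beta>] by blast
  moreover have "ydeg (\<beta> - ?e j) = c"
    using ydeg_add[of "\<beta> - ?e j" "?e j"] Suc.prems(5) unfolding \<beta> ydeg_single_Y by simp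
  ultimately show ?case unfolding y_coeff_step[OF Suc.prems(3) j] by (rule Suc.IH)
qed

text \<open>
  Write \<open>f\<^sub>\<beta> \<in> I\<close> for the coefficient of \<open>Y\<^sup>\<beta>\<close> in \<open>f\<close>.  The top local cohomology of \<open>I/fS\<close> vanishes, so
  \<open>f\<^sub>\<beta> / Y\<^sup>1\<^sup>+\<^sup>\<alpha> = f \<xi>\<close> in the top local cohomology of \<open>S\<close> for some \<open>\<xi>\<close>.  Both sides have \<open>X\<close>-degree \<open>a\<close>, so only
  the part \<open>\<xi>\<^sub>0\<close> of \<open>\<xi>\<close> without \<open>X i\<close> matters, and the coefficients \<open>g\<^sub>\<delta>, g\<^sub>\<epsilon> \<in> K[Y]\<close> of \<open>X\<^sup>\<delta>, X\<^sup>\<epsilon>\<close> in \<open>f\<close> satisfy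
  \<open>c\<^sub>\<delta> / Y\<^sup>1\<^sup>+\<^sup>\<alpha> = g\<^sub>\<delta> \<xi>\<^sub>0\<close> and \<open>c\<^sub>\<epsilon> / Y\<^sup>1\<^sup>+\<^sup>\<alpha> = g\<^sub>\<epsilon> \<xi>\<^sub>0\<close>, where \<open>c\<^sub>\<delta>, c\<^sub>\<epsilon>\<close> are the scalar coefficients in
  \<open>f\<^sub>\<beta>\<close>.  Eliminating \<open>\<xi>\<^sub>0\<close> gives \<open>(c\<^sub>\<delta> g\<^sub>\<epsilon> - c\<^sub>\<epsilon> g\<^sub>\<delta>) / Y\<^sup>1\<^sup>+\<^sup>\<alpha> = 0\<close>, and the coefficient of \<open>1 / (Y 1 \<cdots> Y n)\<close>
  in this equation is the asserted minor.
\<close>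

lemma coefficient_minors:
  fixes f :: "'k::field bipoly"
  assumes f: "f \<in> bipoly_comp m n (int a, int b)"
    and I: "bipoly.submod m n I" and mem: "y_coeff \<beta> f \<in> I"
    and top: "bipoly.cech_exact n I ((*) f ` bipolys m n) n"
    and \<beta>: "y_part \<beta> = \<beta>" and \<alpha>: "y_part \<alpha> = \<alpha>" "keys \<alpha> \<subseteq> vars m n" "ydeg \<alpha> = b"
    and \<delta>: "x_part \<delta> = \<delta>" "xdeg \<delta> = a" and \<epsilon>: "x_part \<epsilon> = \<epsilon>" "xdeg \<epsilon> = a"
  shows "lookup f (\<delta> + \<beta>) * lookup f (\<epsilon> + \<alpha>) = lookup f (\<epsilon> + \<beta>) * lookup f (\<delta> + \<alpha>)"
proof -
  \<comment> \<open>With denominator exponent \<open>Suc b\<close>, the monomial \<open>\<gamma>\<close> stands for \<open>1 / Y\<^sup>1\<^sup>+\<^sup>\<alpha>\<close>.\<close>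
  define \<gamma> where "\<gamma> = y_monom n (\<lambda>j. b - lookup \<alpha> (Y j))"
  have "mono_poly \<gamma> * y_coeff \<beta> f \<in> I"
    by (intro bipoly.submod_mult[OF I _ mem] bipolys_single) (simp add: \<gamma>_def keys_y_monom)
  then obtain e g where g: "(\<Prod>i\<in>{1..n}. indet (Y i) ^ e) * (mono_poly \<gamma> * y_coeff \<beta> f) -
      (\<Sum>j\<in>{1..n}. indet (Y j) ^ (Suc b + e) * g j) \<in> (*) f ` bipolys m n"
    using top unfolding bipoly.cech_exact_top_iff[OF I] by blast
  define k where "k = Suc b + e"
  define \<mu> where "\<mu> = y_monom n (\<lambda>_. e) + \<gamma>"
  obtain v where v: "mono_poly \<mu> * y_coeff \<beta> f - (\<Sum>j\<in>{1..n}. indet (Y j) ^ k * g j) = f * v"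
    using g unfolding prod_indet by (auto simp: \<mu>_def k_def mult.assoc[symmetric] mult_single)
  have x_part_\<mu>: "x_part \<mu> = 0" by (simp add: \<mu>_def \<gamma>_def x_part_add)
  have eq: "mono_poly \<mu> * const_poly (lookup f (\<theta> + \<beta>)) =
      (\<Sum>j\<in>{1..n}. indet (Y j) ^ k * x_coeff \<theta> (g j)) + x_coeff \<theta> f * x_coeff 0 v"
    if \<theta>: "x_part \<theta> = \<theta>" "xdeg \<theta> = a" for \<theta>
  proof -
    have "x_coeff \<theta> (mono_poly \<mu> * y_coeff \<beta> f - (\<Sum>j\<in>{1..n}. indet (Y j) ^ k * g j)) =
        x_coeff \<theta> f * x_coeff 0 v"
      unfolding v by (rule x_coeff_mult_lowest) (use \<theta>(2) bipoly_comp_keys[OF f] in auto)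
    moreover have "x_coeff \<theta> (indet (Y j) ^ k * w) = indet (Y j) ^ k * x_coeff \<theta> w" for j and w :: "'k bipoly"
      unfolding indet_power by (rule x_coeff_mult_Y) simp
    ultimately show ?thesis
      by (simp add: x_coeff_diff x_coeff_sum x_coeff_mult_Y[OF x_part_\<mu>] x_coeff_y_coeff[OF \<theta>(1) \<beta>] diff_eq_eq add.commute)
  qed
  define w where "w j = x_coeff \<epsilon> f * x_coeff \<delta> (g j) - x_coeff \<delta> f * x_coeff \<epsilon> (g j)" for j
  have "mono_poly \<mu> * (const_poly (lookup f (\<delta> + \<beta>)) * x_coeff \<epsilon> f - const_poly (lookup f (\<epsilon> + \<beta>)) * x_coeff \<delta> f) =
      x_coeff \<epsilon> f * (mono_poly \<mu> * const_poly (lookup f (\<delta> + \<beta>))) -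
      x_coeff \<delta> f * (mono_poly \<mu> * const_poly (lookup f (\<epsilon> + \<beta>)))"
    by (simp add: right_diff_distrib ac_simps)
  also have "\<dots> = (\<Sum>j\<in>{1..n}. indet (Y j) ^ k * w j)"
    unfolding eq[OF \<delta>] eq[OF \<epsilon>] w_def
    by (simp only: distrib_left right_diff_distrib sum_subtractf sum_distrib_left) (simp add: ac_simps)
  finally have main: "mono_poly \<mu> * (const_poly (lookup f (\<delta> + \<beta>)) * x_coeff \<epsilon> f -
      const_poly (lookup f (\<epsilon> + \<beta>)) * x_coeff \<delta> f) = (\<Sum>j\<in>{1..n}. indet (Y j) ^ k * w j)" .
  have small: "lookup (\<mu> + \<alpha>) (Y j) = b + e" if "j \<in> {1..n}" for j
    using that lookup_le_ydeg[of \<alpha> j] \<alpha>(3) by (simp add: \<mu>_def \<gamma>_def lookup_add)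
  have "lookup (\<Sum>j\<in>{1..n}. indet (Y j) ^ k * w j) (\<mu> + \<alpha>) = 0"
    unfolding lookup_sum by (intro sum.neutral ballI lookup_power_indet_mult) (simp add: small k_def)
  then have "lookup (const_poly (lookup f (\<delta> + \<beta>)) * x_coeff \<epsilon> f -
      const_poly (lookup f (\<epsilon> + \<beta>)) * x_coeff \<delta> f) \<alpha> = 0"
    unfolding main[symmetric] by (simp only: lookup_mono_mult)
  moreover have "lookup (const_poly c * u) \<alpha> = c * lookup u \<alpha>" for c and u :: "'k bipoly"
    by (rule lookup_const_mult)
  ultimately show ?thesis
    by (simp add: lookup_minus lookup_x_coeff[OF \<delta>(1) \<alpha>(1)] lookup_x_coeff[OF \<epsilon>(1) \<alpha>(1)])
qed

lemma lookup_y_coeff: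
  assumes "x_part \<delta> = \<delta>" "y_part \<beta> = \<beta>"
  shows "lookup (y_coeff \<beta> u) \<delta> = lookup u (\<delta> + \<beta>)"
  unfolding y_coeff_def
proof (rule lookup_lin_ext_partial)
  fix t
  have "x_part \<beta> = 0" "y_part \<delta> = 0" using x_part_y_part[of \<beta>] y_part_x_part[of \<delta>] assms by simp_all
  then show "y_part t = \<beta> \<and> x_part t = \<delta> \<longleftrightarrow> t = \<delta> + \<beta>"
    using x_part_add_y_part[of t] assms by (auto simp: x_part_add y_part_add)
qed

lemma lookup_mult_separate:
  assumes u: "\<And>s. s \<in> keys u \<Longrightarrow> y_part s = 0" and v: "\<And>s. s \<in> keys v \<Longrightarrow> x_part s = 0"
  shows "lookup (u * v) t = lookup u (x_part t) * lookup v (y_part t)"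
proof -
  have eq: "s + r = t \<longleftrightarrow> s = x_part t \<and> r = y_part t" if s: "s \<in> keys u" and r: "r \<in> keys v" for s r
    using u[OF s] v[OF r] x_part_add_y_part[of s] x_part_add_y_part[of r] x_part_add_y_part[of t]
    by (auto simp: x_part_add y_part_add)
  have "lookup (u * v) t = (\<Sum>s\<in>keys u. \<Sum>r\<in>keys v.
      if s = x_part t then (if r = y_part t then lookup u s * lookup v r else 0) else 0)"
    unfolding lookup_mult_keys by (intro sum.cong refl) (simp add: eq)
  also have "\<dots> = (\<Sum>s\<in>keys u. if s = x_part t then (\<Sum>r\<in>keys v.
      if r = y_part t then lookup u s * lookup v r else 0) else 0)"
    by (intro sum.cong refl) simp
  finally show ?thesis by (auto simp: in_keys_iff)
qed

lemma keys_parts: "keys t \<subseteq> B \<Longrightarrow> keys (x_part t) \<subseteq> B \<and> keys (y_part t) \<subseteq> B"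
  using x_part_add_y_part[of t] keys_monom_add[of "x_part t" "y_part t"] by auto

text \<open>The matrix of coefficients, with rows and columns indexed by the monomials in the \<open>X i\<close> and in the \<open>Y j\<close>,
  has rank at most one.  So it is the product of the column and the row of a non-zero entry, up to the
  inverse of that entry.\<close>

lemma factor_of_minors:
  fixes f :: "'k::field bipoly"
  assumes f: "f \<in> bipoly_comp m n (int a, int b)" "f \<noteq> 0"
    and minors: "\<And>\<alpha> \<beta> \<delta> \<epsilon>. y_part \<beta> = \<beta> \<Longrightarrow> keys \<beta> \<subseteq> vars m n \<Longrightarrow> ydeg \<beta> = b \<Longrightarrow>
      y_part \<alpha> = \<alpha> \<Longrightarrow> keys \<alpha> \<subseteq> vars m n \<Longrightarrow> ydeg \<alpha> = b \<Longrightarrow>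
      x_part \<delta> = \<delta> \<Longrightarrow> xdeg \<delta> = a \<Longrightarrow> x_part \<epsilon> = \<epsilon> \<Longrightarrow> xdeg \<epsilon> = a \<Longrightarrow>
      lookup f (\<delta> + \<beta>) * lookup f (\<epsilon> + \<alpha>) = lookup f (\<epsilon> + \<beta>) * lookup f (\<delta> + \<alpha>)"
  shows "\<exists>h1 h2. bihomogeneous m n (a, 0) h1 \<and> bihomogeneous m n (0, b) h2 \<and> f = h1 * h2"
proof -
  note f_keys = bipoly_comp_keys[OF f(1)]
  obtain t\<^sub>0 where t0: "t\<^sub>0 \<in> keys f" using f(2) by (metis all_not_in_conv keys_eq_empty)
  define \<delta>\<^sub>0 \<beta>\<^sub>0 where "\<delta>\<^sub>0 = x_part t\<^sub>0" and "\<beta>\<^sub>0 = y_part t\<^sub>0"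
  have part0: "x_part \<delta>\<^sub>0 = \<delta>\<^sub>0" "y_part \<beta>\<^sub>0 = \<beta>\<^sub>0" "\<delta>\<^sub>0 + \<beta>\<^sub>0 = t\<^sub>0"
    by (simp_all add: \<delta>\<^sub>0_def \<beta>\<^sub>0_def x_part_add_y_part)
  have deg0: "xdeg \<delta>\<^sub>0 = a" "ydeg \<beta>\<^sub>0 = b" "keys \<beta>\<^sub>0 \<subseteq> vars m n"
    using f_keys[OF t0] keys_parts by (auto simp: \<delta>\<^sub>0_def \<beta>\<^sub>0_def)
  have c0: "lookup f t\<^sub>0 \<noteq> 0" using t0 by (simp add: in_keys_iff)
  define h1 where "h1 = y_coeff \<beta>\<^sub>0 f"
  define h2 where "h2 = const_poly (inverse (lookup f t\<^sub>0)) * x_coeff \<delta>\<^sub>0 f"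
  have keys_h1: "\<exists>t\<in>keys f. y_part t = \<beta>\<^sub>0 \<and> s = x_part t" if "s \<in> keys h1" for s
    using keys_lin_ext[OF that[unfolded h1_def y_coeff_def]] by (auto split: if_splits)
  have keys_h2: "\<exists>t\<in>keys f. x_part t = \<delta>\<^sub>0 \<and> s = y_part t" if "s \<in> keys h2" for s
  proof -
    have "s \<in> keys (x_coeff \<delta>\<^sub>0 f)" using that by (auto simp: h2_def in_keys_iff lookup_const_mult)
    from keys_lin_ext[OF this[unfolded x_coeff_def]] show ?thesis by (auto split: if_splits)
  qed
  have look_h1: "lookup h1 (x_part t) = lookup f (x_part t + \<beta>\<^sub>0)" for t
    by (simp add: h1_def lookup_y_coeff part0)
  have look_h2: "lookup h2 (y_part t) = lookup f (\<delta>\<^sub>0 + y_part t) / lookup f t\<^sub>0" for t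
    by (simp add: h2_def lookup_const_mult lookup_x_coeff part0 divide_inverse_commute)
  have "f = h1 * h2"
  proof (rule poly_mapping_eqI)
    fix t
    have "lookup f (x_part t + \<beta>\<^sub>0) * lookup f (\<delta>\<^sub>0 + y_part t) = lookup f t\<^sub>0 * lookup f t"
    proof (cases "xdeg t = a \<and> ydeg t = b \<and> keys (y_part t) \<subseteq> vars m n")
      case True
      then have "lookup f (x_part t + \<beta>\<^sub>0) * lookup f (\<delta>\<^sub>0 + y_part t) =
          lookup f (\<delta>\<^sub>0 + \<beta>\<^sub>0) * lookup f (x_part t + y_part t)"
        by (intro minors) (use part0 deg0 in auto)
      then show ?thesis by (simp add: part0 x_part_add_y_part)
    next
      case False
      have "lookup f t = 0"
        using False f_keys[of t] keys_parts[of t "vars m n"] by (auto simp: in_keys_iff)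
      moreover have "lookup f (x_part t + \<beta>\<^sub>0) = 0" if "xdeg t \<noteq> a"
      proof -
        have "xdeg (x_part t + \<beta>\<^sub>0) = xdeg t" by (simp add: xdeg_add \<beta>\<^sub>0_def)
        then show ?thesis using f_keys[of "x_part t + \<beta>\<^sub>0"] that by (auto simp: in_keys_iff)
      qed
      moreover have "lookup f (\<delta>\<^sub>0 + y_part t) = 0" if "\<not> (ydeg t = b \<and> keys (y_part t) \<subseteq> vars m n)"
      proof -
        have "ydeg (\<delta>\<^sub>0 + y_part t) = ydeg t" by (simp add: ydeg_add \<delta>\<^sub>0_def)
        then show ?thesis
          using f_keys[of "\<delta>\<^sub>0 + y_part t"] that by (auto simp: in_keys_iff keys_monom_add)
      qed
      ultimately show ?thesis using False by fastforce
    qed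
    then have "lookup h1 (x_part t) * lookup h2 (y_part t) = lookup f t"
      using c0 by (simp add: look_h1 look_h2)
    then show "lookup f t = lookup (h1 * h2) t"
      using lookup_mult_separate[of h1 h2 t] keys_h1 keys_h2 by fastforce
  qed
  moreover have "h1 \<noteq> 0" "h2 \<noteq> 0" using calculation f(2) by auto
  moreover have "h1 \<in> bipoly_comp m n (int a, 0)"
    using keys_h1 f_keys keys_parts by (fastforce simp: bipoly_comp_def mem_bipolys)
  moreover have "h2 \<in> bipoly_comp m n (0, int b)"
    using keys_h2 f_keys keys_parts by (fastforce simp: bipoly_comp_def mem_bipolys)
  ultimately show ?thesis by (auto simp: bihomogeneous_def)
qed

section \<open>Filtrations as chains of ideals\<close>

locale hypersurface_ring =
  fixes m n :: nat and f :: "'k::field bipoly" and a b :: nat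
  assumes f_comp: "f \<in> bipoly_comp m n (int a, int b)"
begin

lemma f_mem: "f \<in> bipolys m n" using f_comp by (simp add: bipoly_comp_def)

abbreviation S :: "'k bipoly ring" where "S \<equiv> bipoly_ring m n"
abbreviation fS :: "'k bipoly set" where "fS \<equiv> (*) f ` bipolys m n"
abbreviation M :: "('k bipoly, 'k bipoly set) module" where "M \<equiv> hypersurface m n f"

lemma cring_S: "cring S"
  using bipoly.cring_R[of m n] by (simp add: bipoly_ring_eq[symmetric])

lemma S_simps [simp]: "mult S = (*)" "one S = 1" "zero S = 0" "add S = (+)"
  by (simp_all add: bipoly_ring_def)

lemma PIdl_eq: "PIdl\<^bsub>S\<^esub> f = fS"
  by (auto simp: cgenideal_def mult.commute)

lemma ideal_fS: "ideal fS S"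
  using cring.cgenideal_ideal[OF cring_S f_mem] by (simp add: PIdl_eq)

definition cls :: "'k bipoly \<Rightarrow> 'k bipoly set" where
  "cls g = fS +>\<^bsub>S\<^esub> g"

lemma cls_eq_image: "cls g = (\<lambda>u. u + g) ` fS"
  by (auto simp: cls_def a_r_coset_def r_coset_def)

lemma submod_fS: "bipoly.submod m n fS" and fS_subset: "fS \<subseteq> bipolys m n"
  by (rule bipoly.submod_multiples[OF f_mem], rule bipoly.multiples_subset[OF f_mem])

lemma cls_eq_iff: "cls u = cls v \<longleftrightarrow> u - v \<in> fS"
proof
  assume "cls u = cls v"
  moreover have "u \<in> cls u" unfolding cls_eq_image
    using bipoly.submod_0[OF submod_fS] by (intro image_eqI[of _ _ 0]) auto
  ultimately obtain w where "w \<in> fS" "u = w + v" unfolding cls_eq_image by blast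
  then show "u - v \<in> fS" by simp
next
  have sub: "cls u \<subseteq> cls v" if "u - v \<in> fS" for u v
  proof
    fix x assume "x \<in> cls u"
    then obtain w where w: "w \<in> fS" "x = w + u" unfolding cls_eq_image by blast
    have "w + (u - v) \<in> fS" by (rule bipoly.submod_add[OF submod_fS w(1) that])
    moreover have "x = (w + (u - v)) + v" using w(2) by simp
    ultimately show "x \<in> cls v" unfolding cls_eq_image by (rule image_eqI[rotated])
  qed
  assume *: "u - v \<in> fS"
  then have "v - u \<in> fS" using bipoly.submod_uminus[OF submod_fS *] by simp
  with * show "cls u = cls v" using sub by blast
qed

lemma cls_image_fS: "cls ` fS = {cls 0}"
proof (intro equalityI subsetI)
  fix x assume "x \<in> cls ` fS"
  then obtain u where "u \<in> fS" "x = cls u" by blast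
  then show "x \<in> {cls 0}" by (simp add: cls_eq_iff)
next
  fix x assume "x \<in> {cls 0}"
  then show "x \<in> cls ` fS" using imageI[OF bipoly.submod_0[OF submod_fS], of cls] by simp
qed

lemma carrier_M: "carrier M = cls ` bipolys m n"
  unfolding hypersurface_def Quot_module_def PIdl_eq
  by (auto simp: ring.defs FactRing_def A_RCOSETS_def RCOSETS_def cls_def a_r_coset_def)

lemma zero_M: "\<zero>\<^bsub>M\<^esub> = cls 0"
proof -
  have "\<zero>\<^bsub>M\<^esub> = fS"
    unfolding hypersurface_def Quot_module_def PIdl_eq by (simp add: ring.defs FactRing_def)
  then show ?thesis by (simp add: cls_eq_image)
qed

lemma add_M: "u \<in> bipolys m n \<Longrightarrow> v \<in> bipolys m n \<Longrightarrow> cls u \<oplus>\<^bsub>M\<^esub> cls v = cls (u + v)"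
  using ideal.a_rcos_sum[OF ideal_fS, of u v]
  unfolding hypersurface_def Quot_module_def PIdl_eq by (simp add: ring.defs FactRing_def cls_def)

lemma smult_M: "u \<in> bipolys m n \<Longrightarrow> v \<in> bipolys m n \<Longrightarrow> u \<odot>\<^bsub>M\<^esub> cls v = cls (u * v)"
  using ideal.rcoset_mult_add[OF ideal_fS, of u v]
  unfolding hypersurface_def Quot_module_def PIdl_eq
  by (simp add: ring.defs module.defs FactRing_def cls_def)

lemma comp_M: "hypersurface_comp m n f d = cls ` bipoly_comp m n d"
  by (simp add: hypersurface_comp_def PIdl_eq cls_def)

lemma abelian_group_M: "abelian_group M"
proof (rule abelian_groupI)
  show "\<zero>\<^bsub>M\<^esub> \<in> carrier M" by (simp add: zero_M carrier_M)
  fix x assume "x \<in> carrier M"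
  then obtain u where u: "x = cls u" "u \<in> bipolys m n" by (auto simp: carrier_M)
  have minus: "- u \<in> bipolys m n" by (rule bipoly.submod_uminus[OF bipoly.submod_A u(2)])
  show "\<zero>\<^bsub>M\<^esub> \<oplus>\<^bsub>M\<^esub> x = x" using u by (simp add: zero_M add_M)
  show "\<exists>z\<in>carrier M. z \<oplus>\<^bsub>M\<^esub> x = \<zero>\<^bsub>M\<^esub>"
    using u minus by (intro bexI[of _ "cls (- u)"]) (auto simp: zero_M add_M carrier_M)
  fix z assume "z \<in> carrier M"
  then obtain v where v: "z = cls v" "v \<in> bipolys m n" by (auto simp: carrier_M)
  show "x \<oplus>\<^bsub>M\<^esub> z \<in> carrier M" using u v by (simp add: add_M carrier_M bipolys_add)
  show "x \<oplus>\<^bsub>M\<^esub> z = z \<oplus>\<^bsub>M\<^esub> x" using u v by (simp add: add_M add.commute)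
  fix w assume "w \<in> carrier M"
  then obtain r where r: "w = cls r" "r \<in> bipolys m n" by (auto simp: carrier_M)
  show "(x \<oplus>\<^bsub>M\<^esub> z) \<oplus>\<^bsub>M\<^esub> w = x \<oplus>\<^bsub>M\<^esub> (z \<oplus>\<^bsub>M\<^esub> w)"
    using u v r by (simp add: add_M bipolys_add add.assoc)
qed

lemma finsum_M:
  assumes "finite D" "\<And>d. d \<in> D \<Longrightarrow> g d \<in> bipolys m n"
  shows "(\<Oplus>\<^bsub>M\<^esub>d\<in>D. cls (g d)) = cls (\<Sum>d\<in>D. g d)"
proof -
  interpret abelian_group M by (rule abelian_group_M)
  show ?thesis using assms
  proof (induction D rule: finite_induct)
    case empty then show ?case by (simp add: zero_M)
  next
    case (insert d D)
    have "(\<Oplus>\<^bsub>M\<^esub>d\<in>insert d D. cls (g d)) = cls (g d) \<oplus>\<^bsub>M\<^esub> (\<Oplus>\<^bsub>M\<^esub>d\<in>D. cls (g d))"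
      by (rule finsum_insert) (use insert in \<open>auto simp: carrier_M\<close>)
    then show ?case using insert by (simp add: add_M bipolys_sum)
  qed
qed

definition preimage :: "'k bipoly set set \<Rightarrow> 'k bipoly set" where
  "preimage N = {g \<in> bipolys m n. cls g \<in> N}"

lemma submod_preimage:
  assumes "submodule N S M"
  shows "bipoly.submod m n (preimage N)" "preimage N \<subseteq> bipolys m n" "fS \<subseteq> preimage N" "cls ` preimage N = N"
proof -
  note subgroup = submodule.axioms(1)[OF assms]
  have sub: "N \<subseteq> carrier M" using subgroup.subset[OF subgroup] by simp
  have zero: "cls 0 \<in> N" using subgroup.one_closed[OF subgroup] by (simp add: zero_M)
  have add: "x \<oplus>\<^bsub>M\<^esub> y \<in> N" if "x \<in> N" "y \<in> N" for x y
    using subgroup.m_closed[OF subgroup that] by simp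
  have smult: "u \<odot>\<^bsub>M\<^esub> x \<in> N" if "u \<in> bipolys m n" "x \<in> N" for u x
    using submodule.smult_closed[OF assms] that by blast
  show "bipoly.submod m n (preimage N)"
    unfolding bipoly.submod_def preimage_def
    using zero add smult by (auto simp: add_M[symmetric] smult_M[symmetric] intro: bipolys_add bipolys_mult)
  show "preimage N \<subseteq> bipolys m n" by (auto simp: preimage_def)
  show "fS \<subseteq> preimage N"
  proof
    fix u assume u: "u \<in> fS"
    then have "cls u = cls 0" by (simp add: cls_eq_iff)
    then show "u \<in> preimage N" using u fS_subset zero by (auto simp: preimage_def)
  qed
  show "cls ` preimage N = N" using sub by (auto simp: preimage_def carrier_M)
qed

lemma submodule_image:
  assumes "bipoly.submod m n J" "J \<subseteq> bipolys m n"
  shows "submodule (cls ` J) S M"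
proof (intro submodule.intro subgroup.intro submodule_axioms.intro)
  interpret abelian_group M by (rule abelian_group_M)
  note J = bipoly.submod_0[OF assms(1)] bipoly.submod_add[OF assms(1)] bipoly.submod_mult[OF assms(1)]
    bipoly.submod_uminus[OF assms(1)]
  show "cls ` J \<subseteq> carrier (add_monoid M)" using assms(2) by (auto simp: carrier_M)
  show "\<one>\<^bsub>add_monoid M\<^esub> \<in> cls ` J" using J(1) by (auto simp: zero_M)
  show "x \<otimes>\<^bsub>add_monoid M\<^esub> y \<in> cls ` J" if "x \<in> cls ` J" "y \<in> cls ` J" for x y
    using that J(2) assms(2) by (auto simp: add_M subset_iff)
  show "inv\<^bsub>add_monoid M\<^esub> x \<in> cls ` J" if x: "x \<in> cls ` J" for x
  proof -
    obtain u where u: "x = cls u" "u \<in> J" using x by blast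
    then have mem: "u \<in> bipolys m n" "- u \<in> bipolys m n" using assms(2) J(4) by auto
    have "\<ominus>\<^bsub>M\<^esub> cls u = cls (- u)"
      by (rule minus_equality) (use mem in \<open>auto simp: add_M zero_M carrier_M\<close>)
    then show ?thesis using u J(4) by (auto simp: a_inv_def)
  qed
  show "a \<odot>\<^bsub>M\<^esub> x \<in> cls ` J" if "a \<in> carrier S" "x \<in> cls ` J" for a x
    using that J(3) assms(2) by (auto simp: smult_M subset_iff)
qed

text \<open>An element of the quotient is a coset of residue classes; this is the set of the residue classes of the
  elements of a coset of \<open>I\<close>.\<close>

lemma presented_quotient:
  assumes J: "bipoly.submod m n J" "J \<subseteq> bipolys m n" and I: "bipoly.submod m n I" "I \<subseteq> J" "fS \<subseteq> I"
  shows "presented_module (bipolys m n) n (\<lambda>j. indet (Y j))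
    (quotient_module (M\<lparr>carrier := cls ` J\<rparr>) (cls ` I)) (\<lambda>g. cls ` (\<lambda>u. u + g) ` I) J I"
proof -
  let ?Q = "quotient_module (M\<lparr>carrier := cls ` J\<rparr>) (cls ` I)"
  let ?\<pi> = "\<lambda>g. cls ` (\<lambda>u. u + g) ` I"
  have IS: "I \<subseteq> bipolys m n" using J I by blast
  have coset: "(\<Union>h\<in>cls ` I. {h \<oplus>\<^bsub>M\<^esub> cls g}) = ?\<pi> g" if "g \<in> bipolys m n" for g
    using that IS by (auto simp: add_M subset_iff image_iff)
  have in_pi: "cls g \<in> ?\<pi> g" for g using bipoly.submod_0[OF I(1)] by (auto intro!: image_eqI[of _ _ 0])
  have sub: "?\<pi> u \<subseteq> ?\<pi> v" if "u - v \<in> I" for u v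
  proof
    fix x assume "x \<in> ?\<pi> u"
    then obtain w where w: "w \<in> I" "x = cls (w + u)" by blast
    have "w + (u - v) \<in> I" by (rule bipoly.submod_add[OF I(1) w(1) that])
    then show "x \<in> ?\<pi> v" unfolding w(2) by (intro imageI image_eqI[of _ _ "w + (u - v)"]) auto
  qed
  show ?thesis
  proof (intro presented_module.intro presented_module_axioms.intro)
    show "subring_sequence (bipolys m n) n (\<lambda>j. indet (Y j) :: 'k bipoly)"
      by (rule bipoly.subring_sequence_axioms)
    show "bipoly.submod m n J" "bipoly.submod m n I" "I \<subseteq> J" by (rule J I)+
    show "carrier ?Q = ?\<pi> ` J"
    proof -
      have "carrier ?Q = (\<lambda>x. \<Union>h\<in>cls ` I. {h \<oplus>\<^bsub>M\<^esub> x}) ` cls ` J"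
        by (auto simp: quotient_module_def A_RCOSETS_def RCOSETS_def r_coset_def)
      also have "\<dots> = (\<lambda>g. \<Union>h\<in>cls ` I. {h \<oplus>\<^bsub>M\<^esub> cls g}) ` J" by (rule image_image)
      also have "\<dots> = ?\<pi> ` J" by (rule image_cong[OF refl coset]) (use J(2) in auto)
      finally show ?thesis .
    qed
    show "?\<pi> 0 = \<zero>\<^bsub>?Q\<^esub>" by (simp add: quotient_module_def)
    fix u v assume u: "u \<in> J" and v: "v \<in> J"
    have uv: "u \<in> bipolys m n" "v \<in> bipolys m n" using u v J(2) by auto
    show "?\<pi> (u + v) = ?\<pi> u \<oplus>\<^bsub>?Q\<^esub> ?\<pi> v"
    proof -
      have "?\<pi> u \<oplus>\<^bsub>?Q\<^esub> ?\<pi> v = (\<Union>p\<in>I. \<Union>q\<in>I. {cls (p + u) \<oplus>\<^bsub>M\<^esub> cls (q + v)})"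
        by (auto simp: quotient_module_def set_add_def set_mult_def)
      also have "\<dots> = (\<Union>p\<in>I. \<Union>q\<in>I. {cls (p + q + (u + v))})"
        using IS uv by (intro SUP_cong refl) (subst add_M; auto intro: bipolys_add simp: ac_simps)
      also have "\<dots> = ?\<pi> (u + v)"
      proof
        show "(\<Union>p\<in>I. \<Union>q\<in>I. {cls (p + q + (u + v))}) \<subseteq> ?\<pi> (u + v)"
          using bipoly.submod_add[OF I(1)] by blast
        show "?\<pi> (u + v) \<subseteq> (\<Union>p\<in>I. \<Union>q\<in>I. {cls (p + q + (u + v))})"
          using bipoly.submod_0[OF I(1)] by force
      qed
      finally show ?thesis by simp
    qed
    show "?\<pi> u = ?\<pi> v \<longleftrightarrow> u - v \<in> I"
    proof
      assume "?\<pi> u = ?\<pi> v"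
      then obtain w where w: "w \<in> I" "cls u = cls (w + v)" using in_pi[of u] by auto
      then have "u - (w + v) \<in> I" using I(3) by (auto simp: cls_eq_iff)
      then have "(u - (w + v)) + w \<in> I" by (rule bipoly.submod_add[OF I(1) _ w(1)])
      then show "u - v \<in> I" by simp
    next
      assume *: "u - v \<in> I"
      then have "v - u \<in> I" using bipoly.submod_uminus[OF I(1) *] by simp
      with * show "?\<pi> u = ?\<pi> v" using sub by blast
    qed
    fix a :: "'k bipoly" assume a: "a \<in> bipolys m n"
    show "?\<pi> (a * u) = a \<odot>\<^bsub>?Q\<^esub> ?\<pi> u"
    proof -
      have "a \<odot>\<^bsub>?Q\<^esub> ?\<pi> u = (\<Union>p\<in>I. \<Union>h\<in>cls ` I. {h \<oplus>\<^bsub>M\<^esub> (a \<odot>\<^bsub>M\<^esub> cls (p + u))})"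
        by (auto simp: quotient_module_def a_r_coset_def r_coset_def)
      also have "\<dots> = (\<Union>p\<in>I. ?\<pi> (a * (p + u)))"
      proof (rule SUP_cong)
        fix p assume "p \<in> I"
        then have "p + u \<in> bipolys m n" using IS uv by (auto intro: bipolys_add)
        then show "(\<Union>h\<in>cls ` I. {h \<oplus>\<^bsub>M\<^esub> (a \<odot>\<^bsub>M\<^esub> cls (p + u))}) = ?\<pi> (a * (p + u))"
          by (subst smult_M[OF a], assumption, subst coset) (auto intro: bipolys_mult a)
      qed simp
      also have "\<dots> = (\<Union>p\<in>I. ?\<pi> (a * u))"
      proof (rule SUP_cong)
        fix p assume "p \<in> I"
        then have "a * (p + u) - a * u \<in> I" using bipoly.submod_mult[OF I(1) a] by (simp add: distrib_left)
        moreover from bipoly.submod_uminus[OF I(1) this] have "a * u - a * (p + u) \<in> I" by simp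
        ultimately show "?\<pi> (a * (p + u)) = ?\<pi> (a * u)" using sub by blast
      qed simp
      also have "\<dots> = ?\<pi> (a * u)" using bipoly.submod_0[OF I(1)] by auto
      finally show ?thesis by simp
    qed
  qed
qed

lemma H_Q_nonzero_iff:
  assumes "bipoly.submod m n J" "J \<subseteq> bipolys m n" "bipoly.submod m n I" "I \<subseteq> J" "fS \<subseteq> I"
  shows "H_Q_nonzero m n p (quotient_module (M\<lparr>carrier := cls ` J\<rparr>) (cls ` I)) \<longleftrightarrow>
    \<not> bipoly.cech_exact n J I p"
  using presented_module.local_cohomology_zero_iff[OF presented_quotient[OF assms], of p]
  by (simp add: H_Q_nonzero_def H_Q_def bipoly_ring_eq[symmetric])

lemma CM_Q_iff: "CM_Q m n N \<longleftrightarrow> (\<forall>p. H_Q_nonzero m n p N \<longleftrightarrow> p = cd_Q m n N)"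
proof
  assume "CM_Q m n N"
  then obtain q where q: "\<And>p. H_Q_nonzero m n p N \<longleftrightarrow> p = q" unfolding CM_Q_def by metis
  then have "cd_Q m n N = q" unfolding cd_Q_def by (intro Greatest_equality) auto
  with q show "\<forall>p. H_Q_nonzero m n p N \<longleftrightarrow> p = cd_Q m n N" by simp
qed (auto simp: CM_Q_def)

lemma cd_Q_eq: "(\<And>p. H_Q_nonzero m n p N \<longleftrightarrow> p = q) \<Longrightarrow> cd_Q m n N = q"
  unfolding cd_Q_def by (intro Greatest_equality) auto

definition graded :: "'k bipoly set \<Rightarrow> bool" where
  "graded J \<longleftrightarrow> (\<forall>u\<in>J. \<forall>d. hom_comp d u \<in> J)"

text \<open>
  Modulo \<open>fS\<close>, an element of the preimage is a sum of homogeneous elements of the preimage; and \<open>fS\<close> is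
  itself graded, because \<open>f\<close> is bihomogeneous.
\<close>

lemma graded_preimage:
  assumes "bigraded_submodule m n M (hypersurface_comp m n f) N"
  shows "graded (preimage N)"
  unfolding graded_def
proof (intro ballI allI)
  fix u and e :: "int \<times> int" assume u: "u \<in> preimage N"
  have N: "submodule N S M" using assms by (simp add: bigraded_submodule_def)
  note P = submod_preimage[OF N]
  have "cls u \<in> N" using u by (simp add: preimage_def)
  from bspec[OF conjunct2[OF assms[unfolded bigraded_submodule_def comp_M]] this]
  obtain D c where Dc: "finite D \<and> (\<forall>d\<in>D. c d \<in> N \<inter> cls ` bipoly_comp m n d) \<and>
      cls u = (\<Oplus>\<^bsub>M\<^esub>d\<in>D. c d)"
    by (elim exE)
  then have D: "finite D" "\<And>d. d \<in> D \<Longrightarrow> c d \<in> N \<inter> cls ` bipoly_comp m n d"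
    "cls u = (\<Oplus>\<^bsub>M\<^esub>d\<in>D. c d)" by auto
  have "\<forall>d. \<exists>g. d \<in> D \<longrightarrow> g \<in> bipoly_comp m n d \<and> c d = cls g" using D(2) by blast
  then obtain g where g: "\<And>d. d \<in> D \<Longrightarrow> g d \<in> bipoly_comp m n d" "\<And>d. d \<in> D \<Longrightarrow> c d = cls (g d)"
    by metis
  have g_mem: "g d \<in> bipolys m n" if "d \<in> D" for d using g(1)[OF that] by (simp add: bipoly_comp_def)
  interpret abelian_group M by (rule abelian_group_M)
  have "(\<Oplus>\<^bsub>M\<^esub>d\<in>D. c d) = (\<Oplus>\<^bsub>M\<^esub>d\<in>D. cls (g d))"
    by (rule finsum_cong') (use g g_mem in \<open>auto simp: carrier_M\<close>)
  also have "\<dots> = cls (\<Sum>d\<in>D. g d)" by (rule finsum_M[OF D(1) g_mem])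
  finally have "u - (\<Sum>d\<in>D. g d) \<in> fS" using D(3) by (simp add: cls_eq_iff)
  then obtain v where v: "v \<in> bipolys m n" "u = (\<Sum>d\<in>D. g d) + f * v" by (auto simp: algebra_simps)
  obtain i k where e: "e = (i, k)" by (cases e)
  have "hom_comp e u = (\<Sum>d\<in>D. hom_comp e (g d)) + f * hom_comp (i - int a, k - int b) v"
    unfolding v(2) hom_comp_add hom_comp_sum unfolding e
    by (subst hom_comp_mult[of f a b]) (use bipoly_comp_keys[OF f_comp] in auto)
  also have "\<dots> \<in> preimage N"
  proof (intro bipoly.submod_add[OF P(1)] bipoly.submod_sum[OF P(1)])
    show "f * hom_comp (i - int a, k - int b) v \<in> preimage N"
      using P(3) hom_comp_closed[OF v(1)] by blast
    fix d assume d: "d \<in> D"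
    show "hom_comp e (g d) \<in> preimage N"
    proof (cases "e = d")
      case True
      then have "hom_comp e (g d) = g d" using hom_comp_id[OF g(1)[OF d]] by simp
      then show ?thesis using D(2)[OF d] g(2)[OF d] g_mem[OF d] by (simp add: preimage_def)
    next
      case False
      then show ?thesis using hom_comp_other[OF g(1)[OF d]] bipoly.submod_0[OF P(1)] by simp
    qed
  qed
  finally show "hom_comp e u \<in> preimage N" .
qed

lemma bigraded_image:
  assumes J: "bipoly.submod m n J" "J \<subseteq> bipolys m n" and graded: "graded J"
  shows "bigraded_submodule m n M (hypersurface_comp m n f) (cls ` J)"
  unfolding bigraded_submodule_def comp_M
proof (intro conjI ballI submodule_image J)
  fix x assume "x \<in> cls ` J"
  then obtain g where g: "x = cls g" "g \<in> J" by blast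
  define D where "D = (\<lambda>t. (int (xdeg t), int (ydeg t))) ` keys g"
  have mem: "g \<in> bipolys m n" using g J by blast
  have "(\<Sum>d\<in>D. hom_comp d g) = g"
  proof (rule poly_mapping_eqI)
    fix t
    have "lookup (\<Sum>d\<in>D. hom_comp d g) t =
        (\<Sum>d\<in>D. if (int (xdeg t), int (ydeg t)) = d then lookup g t else 0)"
      by (simp add: lookup_sum lookup_hom_comp)
    also have "\<dots> = (if (int (xdeg t), int (ydeg t)) \<in> D then lookup g t else 0)"
      by (simp add: D_def)
    also have "\<dots> = lookup g t" by (auto simp: D_def in_keys_iff)
    finally show "lookup (\<Sum>d\<in>D. hom_comp d g) t = lookup g t" .
  qed
  then have "x = (\<Oplus>\<^bsub>M\<^esub>d\<in>D. cls (hom_comp d g))"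
    using finsum_M[of D "\<lambda>d. hom_comp d g"] hom_comp_closed[OF mem] g(1) by (simp add: D_def)
  moreover have "cls (hom_comp d g) \<in> cls ` J \<inter> cls ` bipoly_comp m n d" for d
    using graded g(2) hom_comp_mem[OF mem, of d] unfolding graded_def by blast
  ultimately show "\<exists>D c. finite D \<and> (\<forall>d\<in>D. c d \<in> cls ` J \<inter> cls ` bipoly_comp m n d) \<and> x = (\<Oplus>\<^bsub>M\<^esub>d\<in>D. c d)"
    by (intro exI[of _ D] exI[of _ "\<lambda>d. cls (hom_comp d g)"]) (simp add: D_def)
qed

lemma preimage_image: "fS \<subseteq> J \<Longrightarrow> bipoly.submod m n J \<Longrightarrow> J \<subseteq> bipolys m n \<Longrightarrow> preimage (cls ` J) = J"
proof (intro equalityI subsetI)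
  fix u assume J: "fS \<subseteq> J" "bipoly.submod m n J" and "u \<in> preimage (cls ` J)"
  then obtain v where v: "v \<in> J" "u - v \<in> fS" by (auto simp: preimage_def cls_eq_iff)
  then have "(u - v) + v \<in> J" using J by (intro bipoly.submod_add[OF J(2)]) auto
  then show "u \<in> J" by simp
qed (auto simp: preimage_def)

text \<open>A Cohen--Macaulay filtration of \<open>S/fS\<close>, pulled back to a chain of ideals from \<open>fS\<close> to \<open>S\<close>; the number
  \<open>c i\<close> is the cohomological dimension of \<open>L (Suc i) / L i\<close>.  The inclusions are strict because this quotient
  has non-zero cohomology in degree \<open>c i\<close>.\<close>

definition CM_chain :: "nat \<Rightarrow> (nat \<Rightarrow> 'k bipoly set) \<Rightarrow> (nat \<Rightarrow> nat) \<Rightarrow> bool" where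
  "CM_chain r L c \<longleftrightarrow> L 0 = fS \<and> L r = bipolys m n \<and>
    (\<forall>i\<le>r. bipoly.submod m n (L i) \<and> graded (L i)) \<and> (\<forall>i<r. L i \<subseteq> L (Suc i)) \<and>
    (\<forall>i<r. \<forall>p. bipoly.cech_exact n (L (Suc i)) (L i) p \<longleftrightarrow> p \<noteq> c i) \<and>
    (\<forall>i. Suc i < r \<longrightarrow> c i < c (Suc i))"

lemma CM_chain_bounds:
  assumes "CM_chain r L c" "i \<le> r"
  shows "fS \<subseteq> L i" "L i \<subseteq> bipolys m n"
proof -
  have mono: "L i \<subseteq> L j" if "i \<le> j" "j \<le> r" for i j
    using that
  proof (induction j)
    case (Suc j)
    have "L j \<subseteq> L (Suc j)" using assms(1) Suc.prems(2) by (simp add: CM_chain_def)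
    then show ?case using Suc by (cases "i = Suc j") auto
  qed simp
  show "fS \<subseteq> L i" "L i \<subseteq> bipolys m n"
    using mono[of 0 i] mono[of i r] assms by (auto simp: CM_chain_def)
qed

lemma sequentially_CM_iff_chain:
  "sequentially_CM_Q m n M (hypersurface_comp m n f) \<longleftrightarrow> (\<exists>r L c. CM_chain r L c)"
proof
  assume "sequentially_CM_Q m n M (hypersurface_comp m n f)"
  then obtain r F where F: "CM_filtration_Q m n M (hypersurface_comp m n f) r F"
    by (auto simp: sequentially_CM_Q_def)
  define L where "L i = preimage (F i)" for i
  define c where "c i = cd_Q m n (quotient_module (M\<lparr>carrier := F (Suc i)\<rparr>) (F i))" for i
  have bigr: "bigraded_submodule m n M (hypersurface_comp m n f) (F i)" if "i \<le> r" for i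
    using F that by (simp add: CM_filtration_Q_def)
  then have sub: "submodule (F i) S M" if "i \<le> r" for i
    using that by (simp add: bigraded_submodule_def)
  note P = submod_preimage[OF sub, folded L_def]
  have L_mono: "L i \<subseteq> L (Suc i)" if "i < r" for i
    using F that by (auto simp: CM_filtration_Q_def L_def preimage_def)
  have "bipoly.cech_exact n (L (Suc i)) (L i) p \<longleftrightarrow> p \<noteq> c i" if i: "i < r" for i p
  proof -
    have "CM_Q m n (quotient_module (M\<lparr>carrier := F (Suc i)\<rparr>) (F i))"
      using F i by (simp add: CM_filtration_Q_def)
    then have "H_Q_nonzero m n p (quotient_module (M\<lparr>carrier := F (Suc i)\<rparr>) (F i)) \<longleftrightarrow> p = c i"
      by (simp add: CM_Q_iff c_def)
    moreover have "H_Q_nonzero m n p (quotient_module (M\<lparr>carrier := F (Suc i)\<rparr>) (F i)) \<longleftrightarrow>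
        \<not> bipoly.cech_exact n (L (Suc i)) (L i) p"
      using H_Q_nonzero_iff[OF P(1,2)[of "Suc i"] P(1)[of i] L_mono[OF i] P(3)[of i]] P(4)[of i] P(4)[of "Suc i"] i
      by simp
    ultimately show ?thesis by blast
  qed
  moreover have "L 0 = fS"
    using F fS_subset by (auto simp: CM_filtration_Q_def L_def preimage_def zero_M cls_eq_iff)
  moreover have "L r = bipolys m n"
    using F by (auto simp: CM_filtration_Q_def L_def preimage_def carrier_M)
  moreover have "graded (L i)" if "i \<le> r" for i unfolding L_def by (rule graded_preimage[OF bigr[OF that]])
  moreover have "c i < c (Suc i)" if "Suc i < r" for i
    using F that by (simp add: CM_filtration_Q_def c_def)
  ultimately have "CM_chain r L c" using P(1) L_mono by (simp add: CM_chain_def)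
  then show "\<exists>r L c. CM_chain r L c" by blast
next
  assume "\<exists>r L c. CM_chain r L c"
  then obtain r L c where chain: "CM_chain r L c" by blast
  note bounds = CM_chain_bounds[OF chain]
  define F where "F i = cls ` L i" for i
  have L: "bipoly.submod m n (L i)" "graded (L i)" if "i \<le> r" for i
    using chain that by (auto simp: CM_chain_def)
  have L_mono: "L i \<subseteq> L (Suc i)" if "i < r" for i using chain that by (simp add: CM_chain_def)
  have nonzero: "H_Q_nonzero m n p (quotient_module (M\<lparr>carrier := F (Suc i)\<rparr>) (F i)) \<longleftrightarrow> p = c i"
    if i: "i < r" for i p
  proof -
    have "H_Q_nonzero m n p (quotient_module (M\<lparr>carrier := F (Suc i)\<rparr>) (F i)) \<longleftrightarrow>
        \<not> bipoly.cech_exact n (L (Suc i)) (L i) p"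
      unfolding F_def by (rule H_Q_nonzero_iff) (use i L bounds L_mono in auto)
    then show ?thesis using chain i by (simp add: CM_chain_def)
  qed
  have "F i \<subset> F (Suc i)" if i: "i < r" for i
  proof -
    have "\<not> bipoly.cech_exact n (L (Suc i)) (L i) (c i)" using chain i by (simp add: CM_chain_def)
    then have "L i \<noteq> L (Suc i)" using bipoly.cech_exact_refl[OF L(1)[of i]] i by auto
    moreover have "preimage (F i) = L i" "preimage (F (Suc i)) = L (Suc i)"
      unfolding F_def using i by (intro preimage_image bounds L; simp)+
    ultimately have "F i \<noteq> F (Suc i)" by metis
    moreover have "F i \<subseteq> F (Suc i)" unfolding F_def by (rule image_mono[OF L_mono[OF i]])
    ultimately show ?thesis by blast
  qed
  moreover have "F 0 = {\<zero>\<^bsub>M\<^esub>}" using chain by (simp add: CM_chain_def F_def zero_M cls_image_fS)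
  moreover have "F r = carrier M" using chain by (simp add: CM_chain_def F_def carrier_M)
  moreover have "bigraded_submodule m n M (hypersurface_comp m n f) (F i)" if "i \<le> r" for i
    unfolding F_def by (intro bigraded_image L bounds that)
  moreover have cd: "cd_Q m n (quotient_module (M\<lparr>carrier := F (Suc i)\<rparr>) (F i)) = c i" if "i < r" for i
    by (rule cd_Q_eq) (rule nonzero[OF that])
  moreover have "CM_Q m n (quotient_module (M\<lparr>carrier := F (Suc i)\<rparr>) (F i))" if "i < r" for i
    using nonzero[OF that] cd[OF that] by (simp add: CM_Q_iff)
  moreover have "c i < c (Suc i)" if "Suc i < r" for i using chain that by (simp add: CM_chain_def)
  ultimately have "CM_filtration_Q m n M (hypersurface_comp m n f) r F"
    by (simp add: CM_filtration_Q_def)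
  then show "sequentially_CM_Q m n M (hypersurface_comp m n f)"
    by (auto simp: sequentially_CM_Q_def)
qed

section \<open>Factorizations and chains\<close>

lemma graded_multiples:
  assumes h: "h \<in> bipoly_comp m n (int p, int q)"
  shows "graded ((*) h ` bipolys m n)"
  unfolding graded_def
proof (intro ballI allI)
  fix u and d :: "int \<times> int" assume "u \<in> (*) h ` bipolys m n"
  then obtain v where v: "u = h * v" "v \<in> bipolys m n" by blast
  obtain i k where d: "d = (i, k)" by (cases d)
  have "hom_comp d u = h * hom_comp (i - int p, k - int q) v"
    unfolding v(1) d by (rule hom_comp_mult) (use bipoly_comp_keys[OF h] in auto)
  then show "hom_comp d u \<in> (*) h ` bipolys m n" using hom_comp_closed[OF v(2)] by blast
qed

lemma graded_bipolys: "graded (bipolys m n)"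
  by (simp add: graded_def hom_comp_closed)

text \<open>
  The chain is \<open>fS \<subseteq> h1 S \<subseteq> S\<close>, where \<open>h1 S / fS\<close> is isomorphic to \<open>S / h2 S\<close>.  An ideal is omitted if it
  coincides with its neighbour because \<open>h1\<close> or \<open>h2\<close> is a unit.
\<close>

lemma chain_if_factorization:
  assumes h1: "h1 \<in> bipoly_comp m n (int a, 0)" "h1 \<noteq> 0"
    and h2: "h2 \<in> bipoly_comp m n (0, int b)" "h2 \<noteq> 0" and f: "f = h1 * h2"
  shows "\<exists>r L c. CM_chain r L c"
proof -
  note graded_f = graded_multiples[OF f_comp]
  have f0: "f \<noteq> 0" using f h1(2) h2(2) by simp
  have h1S: "h1 \<in> bipolys m n" and h2S: "h2 \<in> bipolys m n" using h1 h2 by (auto simp: bipoly_comp_def)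
  consider "a = 0" "b = 0" | "a \<noteq> 0" "b = 0" | "a = 0" "b \<noteq> 0" | "a \<noteq> 0" "b \<noteq> 0" by blast
  then show ?thesis
  proof cases
    case 1
    have zero: "t = 0" if "t \<in> keys f" for t
      using bipoly_comp_keys[OF f_comp that] 1 x_part_add_y_part[of t] xdeg_eq_0_iff[of t] ydeg_eq_0_iff[of t]
      by simp
    have "f = const_poly (lookup f 0)"
      by (rule poly_mapping_eqI) (use zero in \<open>auto simp: lookup_single when_def in_keys_iff\<close>)
    moreover from this have "lookup f 0 \<noteq> 0" using f0 by auto
    ultimately have "f * const_poly (inverse (lookup f 0)) = 1"
      by (metis mult_single add_0 right_inverse single_one)
    then have "u = f * (const_poly (inverse (lookup f 0)) * u)" for u
      by (simp add: mult.assoc[symmetric])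
    moreover have "const_poly c * u \<in> bipolys m n" if "u \<in> bipolys m n" for c u
      by (intro bipolys_mult bipolys_single that) simp
    ultimately have "fS = bipolys m n" using fS_subset by blast
    then have "CM_chain 0 (\<lambda>_. fS) (\<lambda>_. 0)" using submod_fS graded_f by (simp add: CM_chain_def)
    then show ?thesis by blast
  next
    case 2
    have "bipoly.cech_exact n (bipolys m n) fS p \<longleftrightarrow> p \<noteq> n" for p
      using cech_exact_no_Y_iff[of f m n a p] f_comp 2 by simp
    then have "CM_chain 1 (\<lambda>i. if i = 0 then fS else bipolys m n) (\<lambda>_. n)"
      using submod_fS graded_f fS_subset graded_bipolys by (simp add: CM_chain_def bipoly.submod_A)
    then show ?thesis by blast
  next
    case 3
    have "bipoly.cech_exact n (bipolys m n) fS p \<longleftrightarrow> p \<noteq> n - 1" for p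
      using cech_exact_no_X_iff(1)[of f m n b p] cech_exact_no_X_iff(2)[of f m n b] f_comp f0 3 by auto
    then have "CM_chain 1 (\<lambda>i. if i = 0 then fS else bipolys m n) (\<lambda>_. n - 1)"
      using submod_fS graded_f fS_subset graded_bipolys by (simp add: CM_chain_def bipoly.submod_A)
    then show ?thesis by blast
  next
    case 4
    let ?h1S = "(*) h1 ` bipolys m n"
    define L where "L i = (if i = 0 then fS else if i = 1 then ?h1S else bipolys m n)" for i :: nat
    define c where "c i = (if i = 0 then n - 1 else n)" for i :: nat
    have n: "n \<noteq> 0" by (rule cech_exact_no_X_iff(2)[OF h2 4(2)])
    have top: "bipoly.cech_exact n (bipolys m n) ?h1S p \<longleftrightarrow> p \<noteq> n" for p
      by (rule cech_exact_no_Y_iff[OF h1(1) 4(1)])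
    have fS: "fS = (*) h1 ` (*) h2 ` bipolys m n" by (simp add: f image_image mult.assoc)
    have bottom: "bipoly.cech_exact n ?h1S fS p \<longleftrightarrow> p \<noteq> n - 1" for p
    proof -
      have "bipoly.cech_exact n ?h1S fS p \<longleftrightarrow> bipoly.cech_exact n (bipolys m n) ((*) h2 ` bipolys m n) p"
        unfolding fS
        by (rule bipoly.cech_exact_mult[OF bipoly.submod_multiples[OF h2S] bipoly.submod_A
              bipoly.multiples_subset[OF h2S] subset_refl h1S]) (use h1(2) in simp)
      also have "\<dots> \<longleftrightarrow> Suc p \<noteq> n" by (rule cech_exact_no_X_iff(1)[OF h2 4(2)])
      also have "\<dots> \<longleftrightarrow> p \<noteq> n - 1" using n by linarith
      finally show ?thesis .
    qed
    have sub: "fS \<subseteq> ?h1S" unfolding fS using bipoly.multiples_subset[OF h2S] by blast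
    have graded_h1: "graded ?h1S" using graded_multiples[of h1 a 0] h1(1) by simp
    have "bipoly.submod m n (L i) \<and> graded (L i)" for i
      using submod_fS graded_f bipoly.submod_multiples[OF h1S] graded_h1 graded_bipolys
      by (simp add: L_def bipoly.submod_A)
    moreover have "L i \<subseteq> L (Suc i)" for i
      using sub bipoly.multiples_subset[OF h1S] by (auto simp: L_def)
    moreover have "bipoly.cech_exact n (L (Suc i)) (L i) p \<longleftrightarrow> p \<noteq> c i" if "i < 2" for i p
      using that top bottom less_2_cases[OF that] by (auto simp: L_def c_def)
    moreover have "c i < c (Suc i)" if "Suc i < 2" for i using that n by (simp add: c_def)
    ultimately have "CM_chain 2 L c" by (simp add: CM_chain_def) (simp add: L_def)
    then show ?thesis by blast
  qed
qed

text \<open>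
  Let \<open>I\<close> be the last ideal of the chain before \<open>S\<close>.  The cohomological dimensions increase along the chain
  and are at most \<open>n\<close>, so the top local cohomology of \<open>I/fS\<close> vanishes.  That of \<open>S/fS\<close> does not, because
  \<open>a\<close> is positive; so \<open>S/I\<close> has cohomological dimension \<open>n\<close>, and being Cohen--Macaulay it has depth \<open>n\<close>.
  Therefore \<open>I\<close> contains the \<open>K[X]\<close>-coefficients of \<open>f\<close>, and the minors of its coefficient matrix vanish.
\<close>

lemma factorization_if_chain:
  assumes "CM_chain r L c" and f0: "f \<noteq> 0" and ab: "a \<noteq> 0" "b \<noteq> 0"
  shows "\<exists>h1 h2. bihomogeneous m n (a, 0) h1 \<and> bihomogeneous m n (0, b) h2 \<and> f = h1 * h2"
proof -
  note chain = assms(1)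
  note bounds = CM_chain_bounds[OF chain]
  have L: "bipoly.submod m n (L i)" "graded (L i)" if "i \<le> r" for i
    using chain that by (auto simp: CM_chain_def)
  have L_mono: "L i \<subseteq> L (Suc i)" if "i < r" for i using chain that by (simp add: CM_chain_def)
  have exact: "bipoly.cech_exact n (L (Suc i)) (L i) p \<longleftrightarrow> p \<noteq> c i" if "i < r" for i p
    using chain that by (simp add: CM_chain_def)
  have L0: "L 0 = fS" and Lr: "L r = bipolys m n" using chain by (auto simp: CM_chain_def)
  have not_top: "\<not> bipoly.cech_exact n (bipolys m n) fS n"
    by (rule not_cech_exact_top[OF f_mem]) (use bipoly_comp_keys[OF f_comp] ab in auto)
  have "r \<noteq> 0"
  proof
    assume "r = 0"
    then have "bipolys m n = fS" using L0 Lr by simp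
    then show False using not_top bipoly.cech_exact_refl[OF submod_fS, of n] by simp
  qed
  then obtain k where r: "r = Suc k" by (cases r) auto
  define I where "I = L k"
  have I: "bipoly.submod m n I" "graded I" "fS \<subseteq> I" "I \<subseteq> bipolys m n"
    using L[of k] bounds[of k] r by (auto simp: I_def)
  have SI: "bipoly.cech_exact n (bipolys m n) I p \<longleftrightarrow> p \<noteq> c k" for p
    using exact[of k p] r Lr by (simp add: I_def)
  have "c k \<le> n" using SI bipoly.cech_exact_above[OF _ bipoly.submod_A] by (metis not_le)
  have c_mono: "c i < c k" if "i < k" for i
    using that
  proof (induction "k - i" arbitrary: i)
    case (Suc d)
    have step: "c i < c (Suc i)" using chain Suc.prems r by (simp add: CM_chain_def)
    show ?case
    proof (cases "Suc i = k")
      case False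
      then have "c (Suc i) < c k" using Suc by (intro Suc.hyps(1)) auto
      then show ?thesis using step by simp
    qed (use step in simp)
  qed simp
  have lower: "bipoly.cech_exact n (L i) fS n" if "i \<le> k" for i
    using that
  proof (induction i)
    case 0 then show ?case using bipoly.cech_exact_refl[OF submod_fS] by (simp add: L0)
  next
    case (Suc i)
    have "bipoly.cech_exact n (L (Suc i)) (L i) n"
      using exact[of i n] c_mono[of i] \<open>c k \<le> n\<close> Suc.prems r by simp
    then show ?case
      using bipoly.cech_exact_extension[OF submod_fS L(1)[of i] L(1)[of "Suc i"] bounds(1)[of i] L_mono[of i] Suc.IH]
        Suc.prems r by simp
  qed
  then have top_I: "bipoly.cech_exact n I fS n" by (simp add: I_def)
  have "\<not> bipoly.cech_exact n (bipolys m n) I n"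
    using bipoly.cech_exact_extension[OF submod_fS I(1) bipoly.submod_A I(3,4) top_I] not_top by blast
  then have "c k = n" using SI by simp
  then have below: "bipoly.cech_exact n (bipolys m n) I p" if "p < n" for p using SI that by simp
  obtain t where t: "t \<in> keys f" using f0 by (metis all_not_in_conv keys_eq_empty)
  have n: "0 < n"
  proof (rule ccontr)
    assume "\<not> 0 < n"
    then have "lookup t (Y j) = 0" for j
      using lookup_outside[of t m n j] bipoly_comp_keys[OF f_comp t] by simp
    then have "y_part t = 0" by (intro poly_mapping_eqI) (auto simp: lookup_y_part split: var.split)
    then show False using bipoly_comp_keys[OF f_comp t] ab by (simp add: ydeg_eq_0_iff[symmetric])
  qed
  have "bipoly.koszul_exact n (bipolys m n) I (\<lambda>_. 1) (n - 1)"
    by (rule bipoly.koszul_exact_if_cech_exact[OF bipoly.submod_A I(1,4) below]) (use n in auto)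
  note relation = bipoly.koszul_exact_relation[OF I(1,4) n this]
  have div: "div_Y i u \<in> I" if "i \<in> {1..n}" "u \<in> I" "u \<in> bipoly_comp m n (int a, int d)" for i u d
    by (rule div_Y_mem_graded_ideal[OF I(1,4) _ relation that]) (use I(2) in \<open>auto simp: graded_def\<close>)
  have f_I: "f \<in> I" using I(3) bipoly.one_closed by (auto intro!: subsetD[OF I(3)] image_eqI[of _ _ 1])
  show ?thesis
  proof (rule factor_of_minors[OF f_comp f0])
    fix \<alpha> \<beta> \<delta> \<epsilon>
    assume \<beta>: "y_part \<beta> = \<beta>" "keys \<beta> \<subseteq> vars m n" "ydeg \<beta> = b"
      and \<alpha>: "y_part \<alpha> = \<alpha>" "keys \<alpha> \<subseteq> vars m n" "ydeg \<alpha> = b"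
      and \<delta>: "x_part \<delta> = \<delta>" "xdeg \<delta> = a" and \<epsilon>: "x_part \<epsilon> = \<epsilon>" "xdeg \<epsilon> = a"
    have "y_coeff \<beta> f \<in> I" by (rule y_coeff_mem[OF I(1,4) div f_I f_comp \<beta>])
    then show "lookup f (\<delta> + \<beta>) * lookup f (\<epsilon> + \<alpha>) = lookup f (\<epsilon> + \<beta>) * lookup f (\<delta> + \<alpha>)"
      by (rule coefficient_minors[OF f_comp I(1) _ top_I \<beta>(1) \<alpha> \<delta> \<epsilon>])
  qed
qed

end

theorem theorem3p4:
  fixes f :: "'k::field bipoly" and m n a b :: nat
  assumes "bihomogeneous m n (a, b) f"
  shows "sequentially_CM_Q m n (hypersurface m n f) (hypersurface_comp m n f)
    \<longleftrightarrow> (\<exists>h1 h2. bihomogeneous m n (a, 0) h1 \<and> bihomogeneous m n (0, b) h2 \<and> f = h1 * h2)"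
proof -
  have f0: "f \<noteq> 0" and f: "f \<in> bipoly_comp m n (int a, int b)"
    using assms by (auto simp: bihomogeneous_def)
  interpret hypersurface_ring m n f a b by unfold_locales (rule f)
  have one: "bihomogeneous m n (0, 0) (1 :: 'k bipoly)"
    by (auto simp: bihomogeneous_def bipoly_comp_def bipoly.one_closed)
  show ?thesis
    unfolding sequentially_CM_iff_chain
  proof
    assume "\<exists>r L c. CM_chain r L c"
    then obtain r L c where chain: "CM_chain r L c" by blast
    consider "a = 0" | "b = 0" | "a \<noteq> 0" "b \<noteq> 0" by blast
    then show "\<exists>h1 h2. bihomogeneous m n (a, 0) h1 \<and> bihomogeneous m n (0, b) h2 \<and> f = h1 * h2"
    proof cases
      case 1 then show ?thesis using one assms by (intro exI[of _ 1] exI[of _ f]) simp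
    next
      case 2 then show ?thesis using one assms by (intro exI[of _ f] exI[of _ 1]) simp
    next
      case 3 then show ?thesis by (rule factorization_if_chain[OF chain f0])
    qed
  next
    assume "\<exists>h1 h2. bihomogeneous m n (a, 0) h1 \<and> bihomogeneous m n (0, b) h2 \<and> f = h1 * h2"
    then show "\<exists>r L c. CM_chain r L c"
      using chain_if_factorization by (auto simp: bihomogeneous_def)
  qed
qed

end
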